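(* Let $J\subseteq I$ be monomial ideals in $S=k[x_1,\dots,x_n]$ and let $M=I/J$. Fix $i\in\mathbb{Z}_{\ge0}$, and let $\mathbf a\in\mathbb{Z}^n$ and $\mathbf b\in\mathbb{N}^n$ be such that $G_{\mathbf a+\mathbf b}=G_{\mathbf a}$. Then multiplication by $x^{\mathbf b}$ induces a commutative diagram $$\begin{array}{ccc} H^i_{\mathfrak m}(M)_{\mathbf a} & \xrightarrow{\ \cdot x^{\mathbf b}\ } & H^i_{\mathfrak m}(M)_{\mathbf a+\mathbf b}\\ \downarrow\cong & & \downarrow\cong\\ \widetilde H^{\,i-|G_{\mathbf a}|-1}\big(\Delta_{\mathbf a}(J),\Delta_{\mathbf a}(I)\big) & \longrightarrow & \widetilde H^{\,i-|G_{\mathbf a}|-1}\big(\Delta_{\mathbf a+\mathbf b}(J),\Delta_{\mathbf a+\mathbf b}(I)\big), \end{array}$$ where the vertical isomorphisms are those of the relative Hochster--Takayama formula, and the bottom horizontal map is induced by the natural inclusions $\Delta_{\mathbf a+\mathbf b}(J)\subseteq\Delta_{\mathbf a}(J)$ and $\Delta_{\mathbf a+\mathbf b}(I)\subseteq\Delta_{\mathbf a}(I)$. In particular, under the hypothesis $G_{\mathbf a+\mathbf b}=G_{\mathbf a}$, the multiplication map $\cdot x^{\mathbf b}: H^i_{\mathfrak m}(M)_{\mathbf a}\to H^i_{\mathfrak m}(M)_{\mathbf a+\mathbf b}$ is zero if and only if the induced map on relative reduced cohomology is zero.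
   Context: $k$ is an arbitrary field, $S=k[x_1,\dots,x_n]$ with its $\mathbb{Z}^n$-grading, $\mathfrak m=(x_1,\dots,x_n)$, $[n]=\{1,\dots,n\}$. For $\mathbf a\in\mathbb{Z}^n$, $G_{\mathbf a}=\{i:a_i<0\}$. A simplicial complex on $[n]$ is a collection of subsets of $[n]$ closed under subsets (possibly empty or $\{\varnothing\}$). For a monomial ideal $K$, the degree complex $\Delta_{\mathbf a}(K)$ consists of all $F\subseteq[n]$ with $F\cap G_{\mathbf a}=\varnothing$ such that for every minimal monomial generator $x^{\mathbf c}$ of $K$ there is $i\notin F\cup G_{\mathbf a}$ with $c_i>a_i$. For $J\subseteq I$ one has $\Delta_{\mathbf a}(I)\subseteq\Delta_{\mathbf a}(J)$. For $\Gamma\subseteq\Delta$, $\widetilde H^j(\Delta,\Gamma)=\widetilde H^j((\Delta,\Gamma);k)$ is the $j$-th cohomology of the $k$-dual of the quotient of augmented oriented chain complexes $\mathcal C(\Delta)_\bullet/\mathcal C(\Gamma)_\bullet$ (empty face in degree $-1$). The relative Hochster--Takayama formula is the isomorphism $H^i_{\mathfrak m}(I/J)_{\mathbf a}\cong\widetilde H^{\,i-|G_{\mathbf a}|-1}(\Delta_{\mathbf a}(J),\Delta_{\mathbf a}(I))$ obtained as follows. Let $\check C^\bullet$ be the $\mathbb{Z}^n$-graded Čech complex on $x_1,\dots,x_n$, so $H^i_{\mathfrak m}(M)_{\mathbf a}=H^i((\check C^\bullet\otimes_S M)_{\mathbf a})$. Write $\mathbf a^-=\sum_{i\in G_{\mathbf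 a}}(-a_i)\mathbf e_i$, $\mathbf a^+=\mathbf a+\mathbf a^-$, and $x_F=\prod_{i\in F}x_i$. For $E\subseteq[n]\setminus G_{\mathbf a}$ and $F=G_{\mathbf a}\cup E$, the space $(M_{x_F})_{\mathbf a}$ is nonzero exactly when $E\in\Delta_{\mathbf a}(J)\setminus\Delta_{\mathbf a}(I)$, and then it is one-dimensional, spanned by the class of $x^{\mathbf a^+}/x^{\mathbf a^-}$; for $F\not\supseteq G_{\mathbf a}$ it is zero. The complex $(\check C^\bullet\otimes_S M)_{\mathbf a}$, shifted by $|G_{\mathbf a}|+1$, is identified with the reduced relative cochain complex of $(\Delta_{\mathbf a}(J),\Delta_{\mathbf a}(I))$ by matching this class with the basis cochain of the face $E$ (with the usual sign conventions, depending only on $G_{\mathbf a}$ and $E$), and the isomorphism is the induced one on cohomology. *)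

theory Defs
  imports "HOL-Algebra.Module" "HOL-Algebra.Ideal" "HOL-Library.Function_Algebras" "HOL-Library.Poly_Mapping"
begin

section \<open>Modules, quotients, duals and cohomology\<close>

text \<open>
  Modules are records \<open>('r, 'v) module\<close> of HOL-Algebra whose scalars range over the whole type
  \<open>'r\<close>.  The record fields for an internal multiplication play no role.
\<close>

definition make_module ::
  "'v set \<Rightarrow> 'v \<Rightarrow> ('v \<Rightarrow> 'v \<Rightarrow> 'v) \<Rightarrow> ('r \<Rightarrow> 'v \<Rightarrow> 'v) \<Rightarrow> ('r, 'v) module" where
  "make_module C z p s =
     \<lparr>partial_object.carrier = C, monoid.mult = undefined, monoid.one = undefined,
      ring.zero = z, ring.add = p, module.smult = s\<rparr>"

definition linear_map ::
  "('r, 'v) module \<Rightarrow> ('r, 'w) module \<Rightarrow> ('v \<Rightarrow> 'w) \<Rightarrow> bool" where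
  "linear_map V W f \<longleftrightarrow>
     f \<in> hom (add_monoid V) (add_monoid W) \<and>
     (\<forall>r. \<forall>x\<in>carrier V. f (r \<odot>\<^bsub>V\<^esub> x) = r \<odot>\<^bsub>W\<^esub> f x)"

definition linear_iso ::
  "('r, 'v) module \<Rightarrow> ('r, 'w) module \<Rightarrow> ('v \<Rightarrow> 'w) \<Rightarrow> bool" where
  "linear_iso V W f \<longleftrightarrow> linear_map V W f \<and> bij_betw f (carrier V) (carrier W)"

definition zero_map ::
  "('r, 'v) module \<Rightarrow> ('r, 'w) module \<Rightarrow> ('v \<Rightarrow> 'w) \<Rightarrow> bool" where
  "zero_map V W f \<longleftrightarrow> (\<forall>x\<in>carrier V. f x = \<zero>\<^bsub>W\<^esub>)"

definition quot_module :: "('r, 'v) module \<Rightarrow> 'v set \<Rightarrow> ('r, 'v set) module" where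
  "quot_module V N =
     make_module (a_rcosets\<^bsub>V\<^esub> N) N (set_add V)
       (\<lambda>r X. \<Union>x\<in>X. N +>\<^bsub>V\<^esub> (r \<odot>\<^bsub>V\<^esub> x))"

text \<open>
  Maps out of a quotient are written \<open>\<lambda>X. \<Union>x\<in>X. N' + f x\<close>.  If \<open>f\<close> is compatible with the two
  submodules, all cosets in the union coincide; otherwise the value is not a coset, so a
  statement that such a map lands in the quotient includes its well-definedness.
\<close>

definition quot_map :: "('r, 'w) module \<Rightarrow> 'w set \<Rightarrow> ('v \<Rightarrow> 'w) \<Rightarrow> 'v set \<Rightarrow> 'w set" where
  "quot_map W N' f X = (\<Union>x\<in>X. N' +>\<^bsub>W\<^esub> f x)"

definition field_module :: "('k::field, 'k) module" where
  "field_module = make_module UNIV 0 (+) (*)"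

definition dual_module :: "('k::field, 'v) module \<Rightarrow> ('k, 'v \<Rightarrow> 'k) module" where
  "dual_module V =
     make_module {\<phi> \<in> extensional (carrier V). linear_map V field_module \<phi>}
       (\<lambda>x\<in>carrier V. 0)
       (\<lambda>\<phi> \<psi>. \<lambda>x\<in>carrier V. \<phi> x + \<psi> x)
       (\<lambda>r \<phi>. \<lambda>x\<in>carrier V. r * \<phi> x)"

text \<open>A cochain complex is a family \<open>C\<close> of modules and maps \<open>d p\<close> from \<open>C p\<close> to \<open>C (p + 1)\<close>.\<close>

definition cocycles ::
  "(int \<Rightarrow> ('r, 'v) module) \<Rightarrow> (int \<Rightarrow> 'v \<Rightarrow> 'v) \<Rightarrow> int \<Rightarrow> ('r, 'v) module" where
  "cocycles C d p = (C p)\<lparr>carrier := {z \<in> carrier (C p). d p z = \<zero>\<^bsub>C (p + 1)\<^esub>}\<rparr>"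

definition coboundaries ::
  "(int \<Rightarrow> ('r, 'v) module) \<Rightarrow> (int \<Rightarrow> 'v \<Rightarrow> 'v) \<Rightarrow> int \<Rightarrow> 'v set" where
  "coboundaries C d p = d (p - 1) ` carrier (C (p - 1))"

definition cohomology ::
  "(int \<Rightarrow> ('r, 'v) module) \<Rightarrow> (int \<Rightarrow> 'v \<Rightarrow> 'v) \<Rightarrow> int \<Rightarrow> ('r, 'v set) module" where
  "cohomology C d p = quot_module (cocycles C d p) (coboundaries C d p)"

text \<open>
  The map on cohomology induced by a cochain-level map \<open>f\<close> into degree \<open>q\<close> of \<open>(C', d')\<close>.
\<close>

definition cohomology_map ::
  "(int \<Rightarrow> ('r, 'w) module) \<Rightarrow> (int \<Rightarrow> 'w \<Rightarrow> 'w) \<Rightarrow> int \<Rightarrow> ('v \<Rightarrow> 'w) \<Rightarrow> 'v set \<Rightarrow> 'w set" where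
  "cohomology_map C' d' q f = quot_map (cocycles C' d' q) (coboundaries C' d' q) f"

text \<open>Vertices are elements of a finite linearly ordered type \<open>'n\<close>, which plays the role of \<open>[n]\<close>.\<close>

definition incidence_sign :: "'n::linorder \<Rightarrow> 'n set \<Rightarrow> 'r::ring_1" where
  "incidence_sign j F = (-1) ^ card {l \<in> F. l < j}"


section \<open>Relative reduced simplicial cohomology\<close>

text \<open>
  The oriented chain complex is augmented: the empty face has degree \<open>-1\<close>.
\<close>

definition faces :: "'n set set \<Rightarrow> int \<Rightarrow> 'n set set" where
  "faces \<Delta> p = {E \<in> \<Delta>. int (card E) = p + 1}"

definition chains :: "'n set set \<Rightarrow> int \<Rightarrow> ('k::field, 'n set \<Rightarrow>\<^sub>0 'k) module" where
  "chains \<Delta> p =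
     make_module {z. Poly_Mapping.keys z \<subseteq> faces \<Delta> p} 0 (+) (\<lambda>r. Poly_Mapping.map ((*) r))"

definition boundary :: "('n::{finite,linorder} set \<Rightarrow>\<^sub>0 'k::field) \<Rightarrow> ('n set \<Rightarrow>\<^sub>0 'k)" where
  "boundary z =
     (\<Sum>E\<in>Poly_Mapping.keys z. \<Sum>j\<in>E.
        Poly_Mapping.single (E - {j}) (incidence_sign j E * Poly_Mapping.lookup z E))"

definition rel_chains ::
  "'n set set \<Rightarrow> 'n set set \<Rightarrow> int \<Rightarrow> ('k::field, ('n set \<Rightarrow>\<^sub>0 'k) set) module" where
  "rel_chains \<Delta> \<Gamma> p =
     quot_module (chains \<Delta> p) (carrier (chains \<Gamma> p :: ('k, 'n set \<Rightarrow>\<^sub>0 'k) module))"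

definition rel_boundary ::
  "'n::{finite,linorder} set set \<Rightarrow> 'n set set \<Rightarrow> int \<Rightarrow>
     ('n set \<Rightarrow>\<^sub>0 'k::field) set \<Rightarrow> ('n set \<Rightarrow>\<^sub>0 'k) set" where
  "rel_boundary \<Delta> \<Gamma> p =
     quot_map (chains \<Delta> (p - 1) :: ('k, 'n set \<Rightarrow>\<^sub>0 'k) module)
       (carrier (chains \<Gamma> (p - 1) :: ('k, 'n set \<Rightarrow>\<^sub>0 'k) module)) boundary"

definition rel_cochains ::
  "'n set set \<Rightarrow> 'n set set \<Rightarrow> int \<Rightarrow> ('k::field, ('n set \<Rightarrow>\<^sub>0 'k) set \<Rightarrow> 'k) module" where
  "rel_cochains \<Delta> \<Gamma> p = dual_module (rel_chains \<Delta> \<Gamma> p)"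

definition rel_coboundary ::
  "'n::{finite,linorder} set set \<Rightarrow> 'n set set \<Rightarrow> int \<Rightarrow>
     (('n set \<Rightarrow>\<^sub>0 'k::field) set \<Rightarrow> 'k) \<Rightarrow> (('n set \<Rightarrow>\<^sub>0 'k) set \<Rightarrow> 'k)" where
  "rel_coboundary \<Delta> \<Gamma> p \<phi> =
     (\<lambda>X\<in>carrier (rel_chains \<Delta> \<Gamma> (p + 1) :: ('k, ('n set \<Rightarrow>\<^sub>0 'k) set) module).
        \<phi> (rel_boundary \<Delta> \<Gamma> (p + 1) X))"

definition rel_cohomology ::
  "'n::{finite,linorder} set set \<Rightarrow> 'n set set \<Rightarrow> int \<Rightarrow>
     ('k::field, (('n set \<Rightarrow>\<^sub>0 'k) set \<Rightarrow> 'k) set) module" where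
  "rel_cohomology \<Delta> \<Gamma> = cohomology (rel_cochains \<Delta> \<Gamma>) (rel_coboundary \<Delta> \<Gamma>)"

text \<open>
  For an inclusion of pairs \<open>\<Delta>' \<subseteq> \<Delta>\<close>, \<open>\<Gamma>' \<subseteq> \<Gamma>\<close>: the restriction of cochains dual to the
  inclusion of relative chains, and its effect on cohomology.
\<close>

definition rel_restrict ::
  "'n set set \<Rightarrow> 'n set set \<Rightarrow> 'n set set \<Rightarrow> 'n set set \<Rightarrow> int \<Rightarrow>
     (('n set \<Rightarrow>\<^sub>0 'k::field) set \<Rightarrow> 'k) \<Rightarrow> (('n set \<Rightarrow>\<^sub>0 'k) set \<Rightarrow> 'k)" where
  "rel_restrict \<Delta> \<Gamma> \<Delta>' \<Gamma>' p \<phi> =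
     (\<lambda>X\<in>carrier (rel_chains \<Delta>' \<Gamma>' p :: ('k, ('n set \<Rightarrow>\<^sub>0 'k) set) module).
        \<phi> (quot_map (chains \<Delta> p :: ('k, 'n set \<Rightarrow>\<^sub>0 'k) module)
             (carrier (chains \<Gamma> p :: ('k, 'n set \<Rightarrow>\<^sub>0 'k) module)) (\<lambda>z. z) X))"

definition rel_cohomology_inclusion ::
  "'n::{finite,linorder} set set \<Rightarrow> 'n set set \<Rightarrow> 'n set set \<Rightarrow> 'n set set \<Rightarrow> int \<Rightarrow>
     (('n set \<Rightarrow>\<^sub>0 'k::field) set \<Rightarrow> 'k) set \<Rightarrow> (('n set \<Rightarrow>\<^sub>0 'k) set \<Rightarrow> 'k) set" where
  "rel_cohomology_inclusion \<Delta> \<Gamma> \<Delta>' \<Gamma>' p =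
     cohomology_map (rel_cochains \<Delta>' \<Gamma>') (rel_coboundary \<Delta>' \<Gamma>') p
       (rel_restrict \<Delta> \<Gamma> \<Delta>' \<Gamma>' p)"


section \<open>Monomial ideals and degree complexes\<close>

text \<open>
  The polynomial ring \<open>S = k[x\<^sub>i : i \<in> 'n]\<close> is the monoid algebra of \<open>'n \<Rightarrow> nat\<close>, with pointwise
  addition of exponent vectors.
\<close>

type_synonym ('n, 'k) polyS = "('n \<Rightarrow> nat) \<Rightarrow>\<^sub>0 'k"

definition xpow :: "('n \<Rightarrow> nat) \<Rightarrow> ('n, 'k::field) polyS" where
  "xpow e = Poly_Mapping.single e 1"

definition const :: "'k::field \<Rightarrow> ('n, 'k) polyS" where
  "const r = Poly_Mapping.single 0 r"

definition xF :: "'n set \<Rightarrow> ('n, 'k::field) polyS" where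
  "xF F = xpow (\<lambda>i. of_bool (i \<in> F))"

definition poly_ring :: "('n, 'k::field) polyS ring" where
  "poly_ring = \<lparr>partial_object.carrier = UNIV, monoid.mult = (*), monoid.one = 1, ring.zero = 0, ring.add = (+)\<rparr>"

definition monomial_ideal :: "('n, 'k::field) polyS set \<Rightarrow> bool" where
  "monomial_ideal K \<longleftrightarrow> (\<exists>A. K = Idl\<^bsub>poly_ring\<^esub> (xpow ` A))"

definition min_gens :: "('n, 'k::field) polyS set \<Rightarrow> ('n \<Rightarrow> nat) set" where
  "min_gens K = {c. xpow c \<in> K \<and> (\<forall>c'. xpow c' \<in> K \<and> c' \<le> c \<longrightarrow> c' = c)}"

definition neg_supp :: "('n \<Rightarrow> int) \<Rightarrow> 'n set" where
  "neg_supp a = {i. a i < 0}"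

definition degree_complex :: "('n \<Rightarrow> int) \<Rightarrow> ('n, 'k::field) polyS set \<Rightarrow> 'n set set" where
  "degree_complex a K =
     {F. F \<inter> neg_supp a = {} \<and>
         (\<forall>c\<in>min_gens K. \<exists>i. i \<notin> F \<union> neg_supp a \<and> int (c i) > a i)}"


section \<open>The Cech complex in a fixed degree\<close>

text \<open>
  Localization of an \<open>S\<close>-module at one element \<open>f\<close>; the class \<open>fraction M f m t\<close> of the pair
  \<open>(m, t)\<close> is \<open>m / f\<^sup>t\<close>.
\<close>

definition fraction :: "('r::comm_ring_1, 'm) module \<Rightarrow> 'r \<Rightarrow> 'm \<Rightarrow> nat \<Rightarrow> ('m \<times> nat) set" where
  "fraction M f m t =
     {(m', t'). m' \<in> carrier M \<and> (\<exists>s. f ^ (s + t') \<odot>\<^bsub>M\<^esub> m = f ^ (s + t) \<odot>\<^bsub>M\<^esub> m')}"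

definition localization ::
  "('r::comm_ring_1, 'm) module \<Rightarrow> 'r \<Rightarrow> ('r, ('m \<times> nat) set) module" where
  "localization M f =
     make_module {fraction M f m t | m t. m \<in> carrier M} (fraction M f \<zero>\<^bsub>M\<^esub> 0)
       (\<lambda>X Y. \<Union>(m, t)\<in>X. \<Union>(m', t')\<in>Y.
          fraction M f ((f ^ t' \<odot>\<^bsub>M\<^esub> m) \<oplus>\<^bsub>M\<^esub> (f ^ t \<odot>\<^bsub>M\<^esub> m')) (t + t'))
       (\<lambda>r X. \<Union>(m, t)\<in>X. fraction M f (r \<odot>\<^bsub>M\<^esub> m) t)"

text \<open>The canonical map from \<open>M\<^sub>f\<close> to \<open>M\<^bsub>f g\<^esub>\<close>, sending \<open>m / f\<^sup>t\<close> to \<open>g\<^sup>t m / (f g)\<^sup>t\<close>.\<close>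

definition loc_map ::
  "('r::comm_ring_1, 'm) module \<Rightarrow> 'r \<Rightarrow> 'r \<Rightarrow> ('m \<times> nat) set \<Rightarrow> ('m \<times> nat) set" where
  "loc_map M f g X = (\<Union>(m, t)\<in>X. fraction M (f * g) (g ^ t \<odot>\<^bsub>M\<^esub> m) t)"

text \<open>
  In what follows \<open>M\<close> is a \<open>\<int>\<^sup>n\<close>-graded \<open>S\<close>-module and \<open>D d\<close> is its homogeneous component of
  degree \<open>d\<close>.  An element \<open>m / x\<^sub>F\<^sup>t\<close> has degree \<open>a\<close> if \<open>m\<close> has degree \<open>a + t e\<^sub>F\<close>.
\<close>

definition add_eF :: "('n \<Rightarrow> int) \<Rightarrow> nat \<Rightarrow> 'n set \<Rightarrow> ('n \<Rightarrow> int)" where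
  "add_eF a t F = (\<lambda>i. a i + int t * of_bool (i \<in> F))"

definition loc_degree ::
  "(('n, 'k::field) polyS, 'm) module \<Rightarrow> (('n \<Rightarrow> int) \<Rightarrow> 'm set) \<Rightarrow>
     ('n \<Rightarrow> int) \<Rightarrow> 'n set \<Rightarrow> ('m \<times> nat) set set" where
  "loc_degree M D a F = {fraction M (xF F) m t | m t. m \<in> D (add_eF a t F)}"

text \<open>
  The degree-\<open>a\<close> strand of the Cech complex of \<open>M\<close> on the variables, as a complex of
  \<open>k\<close>-vector spaces: in cohomological degree \<open>p\<close> it is the direct sum of the spaces
  \<open>(M\<^bsub>x\<^sub>F\<^esub>)\<^sub>a\<close> over all \<open>F\<close> with \<open>p\<close> elements.
\<close>

definition subsets_of_size :: "int \<Rightarrow> 'n set set" where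
  "subsets_of_size p = {F. int (card F) = p}"

definition cech ::
  "(('n::{finite,linorder}, 'k::field) polyS, 'm) module \<Rightarrow> (('n \<Rightarrow> int) \<Rightarrow> 'm set) \<Rightarrow>
     ('n \<Rightarrow> int) \<Rightarrow> int \<Rightarrow> ('k, 'n set \<Rightarrow> ('m \<times> nat) set) module" where
  "cech M D a p =
     make_module (\<Pi>\<^sub>E F\<in>subsets_of_size p. loc_degree M D a F)
       (\<lambda>F\<in>subsets_of_size p. \<zero>\<^bsub>localization M (xF F)\<^esub>)
       (\<lambda>c c'. \<lambda>F\<in>subsets_of_size p. c F \<oplus>\<^bsub>localization M (xF F)\<^esub> c' F)
       (\<lambda>r c. \<lambda>F\<in>subsets_of_size p. const r \<odot>\<^bsub>localization M (xF F)\<^esub> c F)"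

definition cech_diff ::
  "(('n::{finite,linorder}, 'k::field) polyS, 'm) module \<Rightarrow> int \<Rightarrow>
     ('n set \<Rightarrow> ('m \<times> nat) set) \<Rightarrow> ('n set \<Rightarrow> ('m \<times> nat) set)" where
  "cech_diff M p c =
     (\<lambda>F\<in>subsets_of_size (p + 1).
        \<Oplus>\<^bsub>localization M (xF F)\<^esub> j\<in>F.
          incidence_sign j F \<odot>\<^bsub>localization M (xF F)\<^esub>
            loc_map M (xF (F - {j})) (xF {j}) (c (F - {j})))"

definition local_cohomology ::
  "(('n::{finite,linorder}, 'k::field) polyS, 'm) module \<Rightarrow> (('n \<Rightarrow> int) \<Rightarrow> 'm set) \<Rightarrow>
     ('n \<Rightarrow> int) \<Rightarrow> int \<Rightarrow> ('k, ('n set \<Rightarrow> ('m \<times> nat) set) set) module" where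
  "local_cohomology M D a = cohomology (cech M D a) (cech_diff M)"

text \<open>
  Multiplication by \<open>x\<^sup>b\<close>, from degree \<open>a\<close> to degree \<open>a + b\<close>.
\<close>

definition shift_deg :: "('n \<Rightarrow> int) \<Rightarrow> ('n \<Rightarrow> nat) \<Rightarrow> ('n \<Rightarrow> int)" where
  "shift_deg a b = (\<lambda>i. a i + int (b i))"

definition cech_mult ::
  "(('n::{finite,linorder}, 'k::field) polyS, 'm) module \<Rightarrow> ('n \<Rightarrow> nat) \<Rightarrow> int \<Rightarrow>
     ('n set \<Rightarrow> ('m \<times> nat) set) \<Rightarrow> ('n set \<Rightarrow> ('m \<times> nat) set)" where
  "cech_mult M b p c =
     (\<lambda>F\<in>subsets_of_size p. xpow b \<odot>\<^bsub>localization M (xF F)\<^esub> c F)"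

definition local_cohomology_mult ::
  "(('n::{finite,linorder}, 'k::field) polyS, 'm) module \<Rightarrow> (('n \<Rightarrow> int) \<Rightarrow> 'm set) \<Rightarrow>
     ('n \<Rightarrow> int) \<Rightarrow> ('n \<Rightarrow> nat) \<Rightarrow> int \<Rightarrow>
     ('n set \<Rightarrow> ('m \<times> nat) set) set \<Rightarrow> ('n set \<Rightarrow> ('m \<times> nat) set) set" where
  "local_cohomology_mult M D a b p =
     cohomology_map (cech M D (shift_deg a b)) (cech_diff M) p (cech_mult M b p)"


section \<open>The module \<open>I/J\<close> and the relative Hochster--Takayama map\<close>

definition ideal_module :: "('n, 'k::field) polyS set \<Rightarrow> (('n, 'k) polyS, ('n, 'k) polyS) module" where
  "ideal_module I = make_module I 0 (+) (*)"

definition ideal_quot ::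
  "('n, 'k::field) polyS set \<Rightarrow> ('n, 'k) polyS set \<Rightarrow>
     (('n, 'k) polyS, ('n, 'k) polyS set) module" where
  "ideal_quot I J = quot_module (ideal_module I) J"

definition ideal_quot_degree ::
  "('n, 'k::field) polyS set \<Rightarrow> ('n, 'k) polyS set \<Rightarrow> ('n \<Rightarrow> int) \<Rightarrow> ('n, 'k) polyS set set" where
  "ideal_quot_degree I J d =
     {J +>\<^bsub>ideal_module I\<^esub> p | p. p \<in> I \<and> (\<forall>e\<in>Poly_Mapping.keys p. (\<lambda>i. int (e i)) = d)}"

text \<open>
  The class of \<open>x\<^sup>a = x\<^bsup>a\<^sup>+\<^esup> / x\<^bsup>a\<^sup>-\<^esup>\<close> in the localization of \<open>I/J\<close> at \<open>x\<^sub>F\<close>.  Written with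
  denominator \<open>x\<^sub>F\<^sup>t\<close> its numerator is the monomial of exponent \<open>a + t e\<^sub>F\<close>, which has to be a genuine
  monomial in \<open>I\<close>; all such \<open>t\<close> give the same fraction, so the union is that fraction.
\<close>

definition monomial_class ::
  "('n, 'k::field) polyS set \<Rightarrow> ('n, 'k) polyS set \<Rightarrow> ('n \<Rightarrow> int) \<Rightarrow> 'n set \<Rightarrow>
     (('n, 'k) polyS set \<times> nat) set" where
  "monomial_class I J a F =
     (\<Union>(e, t)\<in>{(e, t). (\<lambda>i. int (e i)) = add_eF a t F \<and> (xpow e :: ('n, 'k) polyS) \<in> I}.
        fraction (ideal_quot I J) (xF F) (J +>\<^bsub>ideal_module I\<^esub> xpow e) t)"

definition monomial_coeff ::
  "('n, 'k::field) polyS set \<Rightarrow> ('n, 'k) polyS set \<Rightarrow> ('n \<Rightarrow> int) \<Rightarrow> 'n set \<Rightarrow>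
     (('n, 'k) polyS set \<times> nat) set \<Rightarrow> 'k" where
  "monomial_coeff I J a F y =
     (THE r. y = const r \<odot>\<^bsub>localization (ideal_quot I J) (xF F)\<^esub> monomial_class I J a F)"

text \<open>
  The basis cochain of a face \<open>E\<close> of \<open>\<Delta>\<close> not in \<open>\<Gamma>\<close>: the coefficient of \<open>E\<close> in a relative chain,
  which is the same for all representatives.
\<close>

definition basis_cochain ::
  "'n set set \<Rightarrow> 'n set set \<Rightarrow> int \<Rightarrow> 'n set \<Rightarrow> ('n set \<Rightarrow>\<^sub>0 'k::field) set \<Rightarrow> 'k" where
  "basis_cochain \<Delta> \<Gamma> q E =
     (\<lambda>X\<in>carrier (rel_chains \<Delta> \<Gamma> q :: ('k, ('n set \<Rightarrow>\<^sub>0 'k) set) module).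
        the_elem ((\<lambda>z. Poly_Mapping.lookup z E) ` X))"

text \<open>
  With the incidence signs used above, removing \<open>j \<in> E\<close> from \<open>G \<union> E\<close> carries the sign of removing
  \<open>j\<close> from \<open>E\<close> times \<open>(-1)\<^sup>m\<close>, where \<open>m\<close> counts the \<open>l \<in> G\<close> with \<open>l < j\<close>; the following sign
  absorbs this difference.
\<close>

definition ht_sign :: "'n::linorder set \<Rightarrow> 'n set \<Rightarrow> 'k::comm_ring_1" where
  "ht_sign G E = (\<Prod>j\<in>E. incidence_sign j G)"

text \<open>
  On cochains, the Hochster--Takayama map sends the class of \<open>x\<^sup>a\<close> in the summand \<open>F = G\<^sub>a \<union> E\<close> to
  the signed basis cochain of \<open>E\<close>.
\<close>

definition ht_cochain ::
  "('n::{finite,linorder}, 'k::field) polyS set \<Rightarrow> ('n, 'k) polyS set \<Rightarrow> ('n \<Rightarrow> int) \<Rightarrow> int \<Rightarrow>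
     ('n set \<Rightarrow> (('n, 'k) polyS set \<times> nat) set) \<Rightarrow> (('n set \<Rightarrow>\<^sub>0 'k) set \<Rightarrow> 'k)" where
  "ht_cochain I J a q c =
     (\<lambda>X\<in>carrier (rel_chains (degree_complex a J) (degree_complex a I) q
                    :: ('k, ('n set \<Rightarrow>\<^sub>0 'k) set) module).
        \<Sum>E\<in>faces (degree_complex a J - degree_complex a I) q.
          ht_sign (neg_supp a) E
            * monomial_coeff I J a (neg_supp a \<union> E) (c (neg_supp a \<union> E))
            * basis_cochain (degree_complex a J) (degree_complex a I) q E X)"

definition ht_map ::
  "('n::{finite,linorder}, 'k::field) polyS set \<Rightarrow> ('n, 'k) polyS set \<Rightarrow> ('n \<Rightarrow> int) \<Rightarrow> int \<Rightarrow>
     ('n set \<Rightarrow> (('n, 'k) polyS set \<times> nat) set) set \<Rightarrow> (('n set \<Rightarrow>\<^sub>0 'k) set \<Rightarrow> 'k) set" where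
  "ht_map I J a q =
     cohomology_map (rel_cochains (degree_complex a J) (degree_complex a I))
       (rel_coboundary (degree_complex a J) (degree_complex a I)) q (ht_cochain I J a q)"

end

theory Submission
  imports Defs
begin

text \<open>
  The diagram commutes before passing to cohomology, because everything in it can be
  computed in coordinates.

  Fix a degree \<open>a\<close> with negative support \<open>G\<close>.  Multiplying \<open>x\<^sup>a\<close> by powers of \<open>x\<^sub>F\<close> raises exactly the
  exponents in \<open>F\<close>, so some such product lies in a monomial ideal \<open>K\<close> precisely if \<open>G \<subseteq> F\<close> and
  \<open>F - G\<close> is not a face of \<open>\<Delta>\<^sub>a(K)\<close> (\<open>mono_in_iff_min_gens\<close>, \<open>mem_degree_complex_iff\<close>).  Hence the degree-\<open>a\<close> part
  of the localization of \<open>I/J\<close> at \<open>x\<^sub>F\<close> is the line spanned by the class of \<open>x\<^sup>a\<close> if \<open>F = G \<union> E\<close> with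
  \<open>E \<in> \<Delta>\<^sub>a(J) - \<Delta>\<^sub>a(I)\<close>, and zero otherwise (\<open>loc_degree_mono_in\<close>, \<open>loc_degree_not_live\<close>).  A Cech cochain of
  degree \<open>a\<close> is therefore the family of its coefficients with respect to these classes.  A
  relative simplicial cochain of \<open>(\<Delta>\<^sub>a(J), \<Delta>\<^sub>a(I))\<close> is likewise the family of its values on the same
  faces \<open>E\<close> (\<open>cochain_eqI\<close>), and the Hochster--Takayama map only inserts signs.  So it is bijective
  on cochains, and the signs are made such that it commutes with the differentials
  (\<open>bij_betw_ht_cochain\<close>, \<open>ht_cochain_cech_diff\<close>).

  Multiplication by \<open>x\<^sup>b\<close> sends the class of \<open>x\<^sup>a\<close> to that of \<open>x\<^bsup>a+b\<^esup>\<close>, so it keeps the coefficients at those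
  faces that survive in degree \<open>a + b\<close> and drops the others.  Restriction of simplicial
  cochains does the same, and as both degrees have negative support \<open>G\<close> the signs agree too
  (\<open>ht_cochain_cech_mult\<close>).  The assertions about cohomology follow formally; the last one holds
  because the vertical maps are bijective.
\<close>

section \<open>Modules, quotients and cochain complexes\<close>

text \<open>
  A commutative ring type regarded as a ring with full carrier.  With it the modules in
  the theorem, whose scalars form a type, become modules over a ring in the sense of the locale.
\<close>

definition scalar_ring :: "'r::comm_ring_1 ring" where
  "scalar_ring = \<lparr>partial_object.carrier = UNIV, monoid.mult = (*), monoid.one = 1,
     ring.zero = 0, ring.add = (+)\<rparr>"

abbreviation is_module :: "('r::comm_ring_1, 'v) module \<Rightarrow> bool" where
  "is_module V \<equiv> module scalar_ring V"

lemma scalar_ring_simps [simp]: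
  "carrier scalar_ring = UNIV" "x \<otimes>\<^bsub>scalar_ring\<^esub> y = x * y" "\<one>\<^bsub>scalar_ring\<^esub> = 1"
  "\<zero>\<^bsub>scalar_ring\<^esub> = 0" "x \<oplus>\<^bsub>scalar_ring\<^esub> y = x + y"
  by (simp_all add: scalar_ring_def)

lemma make_module_simps [simp]:
  "carrier (make_module C z p s) = C" "\<zero>\<^bsub>make_module C z p s\<^esub> = z"
  "x \<oplus>\<^bsub>make_module C z p s\<^esub> y = p x y" "r \<odot>\<^bsub>make_module C z p s\<^esub> x = s r x"
  by (simp_all add: make_module_def)

lemma cring_scalar_ring: "cring (scalar_ring :: 'r::comm_ring_1 ring)"
proof -
  have "\<exists>y. y + x = 0" for x :: 'r
    by (rule exI[of _ "- x"]) simp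
  then show ?thesis
    by (intro cringI abelian_groupI comm_monoidI) (auto simp: algebra_simps)
qed

text \<open>
  Additive inverses need not be supplied: \<open>(- 1) \<odot> x\<close> is one, by distributivity and \<open>0 \<odot> x = \<zero>\<close>.
\<close>

lemma is_moduleI:
  fixes V :: "('r::comm_ring_1, 'v) module"
  assumes zero: "\<zero>\<^bsub>V\<^esub> \<in> carrier V"
    and add: "\<And>x y. x \<in> carrier V \<Longrightarrow> y \<in> carrier V \<Longrightarrow> x \<oplus>\<^bsub>V\<^esub> y \<in> carrier V"
    and smult: "\<And>r x. x \<in> carrier V \<Longrightarrow> r \<odot>\<^bsub>V\<^esub> x \<in> carrier V"
    and assoc: "\<And>x y z. x \<in> carrier V \<Longrightarrow> y \<in> carrier V \<Longrightarrow> z \<in> carrier V \<Longrightarrow>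
                  x \<oplus>\<^bsub>V\<^esub> y \<oplus>\<^bsub>V\<^esub> z = x \<oplus>\<^bsub>V\<^esub> (y \<oplus>\<^bsub>V\<^esub> z)"
    and comm: "\<And>x y. x \<in> carrier V \<Longrightarrow> y \<in> carrier V \<Longrightarrow> x \<oplus>\<^bsub>V\<^esub> y = y \<oplus>\<^bsub>V\<^esub> x"
    and l_zero: "\<And>x. x \<in> carrier V \<Longrightarrow> \<zero>\<^bsub>V\<^esub> \<oplus>\<^bsub>V\<^esub> x = x"
    and l_null: "\<And>x. x \<in> carrier V \<Longrightarrow> 0 \<odot>\<^bsub>V\<^esub> x = \<zero>\<^bsub>V\<^esub>"
    and l_distr: "\<And>r s x. x \<in> carrier V \<Longrightarrow> (r + s) \<odot>\<^bsub>V\<^esub> x = r \<odot>\<^bsub>V\<^esub> x \<oplus>\<^bsub>V\<^esub> s \<odot>\<^bsub>V\<^esub> x"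
    and r_distr: "\<And>r x y. x \<in> carrier V \<Longrightarrow> y \<in> carrier V \<Longrightarrow>
                    r \<odot>\<^bsub>V\<^esub> (x \<oplus>\<^bsub>V\<^esub> y) = r \<odot>\<^bsub>V\<^esub> x \<oplus>\<^bsub>V\<^esub> r \<odot>\<^bsub>V\<^esub> y"
    and mult: "\<And>r s x. x \<in> carrier V \<Longrightarrow> (r * s) \<odot>\<^bsub>V\<^esub> x = r \<odot>\<^bsub>V\<^esub> (s \<odot>\<^bsub>V\<^esub> x)"
    and one: "\<And>x. x \<in> carrier V \<Longrightarrow> 1 \<odot>\<^bsub>V\<^esub> x = x"
  shows "is_module V"
proof (rule moduleI)
  show "cring (scalar_ring :: 'r ring)"
    by (rule cring_scalar_ring)
  show "abelian_group V"
  proof (rule abelian_groupI)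
    fix x assume x: "x \<in> carrier V"
    have "(- 1) \<odot>\<^bsub>V\<^esub> x \<oplus>\<^bsub>V\<^esub> x = (- 1 + 1) \<odot>\<^bsub>V\<^esub> x"
      using x by (simp only: l_distr one)
    then show "\<exists>y\<in>carrier V. y \<oplus>\<^bsub>V\<^esub> x = \<zero>\<^bsub>V\<^esub>"
      using x l_null smult by (metis add.left_inverse)
  qed (use assms in auto)
qed (use assms in auto)

lemma is_moduleD:
  fixes V :: "('r::comm_ring_1, 'v) module"
  assumes "is_module V"
  shows "abelian_group V" "\<zero>\<^bsub>V\<^esub> \<in> carrier V"
    and "x \<in> carrier V \<Longrightarrow> y \<in> carrier V \<Longrightarrow> x \<oplus>\<^bsub>V\<^esub> y \<in> carrier V"
    and "x \<in> carrier V \<Longrightarrow> r \<odot>\<^bsub>V\<^esub> x \<in> carrier V"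
    and "x \<in> carrier V \<Longrightarrow> (r + s) \<odot>\<^bsub>V\<^esub> x = r \<odot>\<^bsub>V\<^esub> x \<oplus>\<^bsub>V\<^esub> s \<odot>\<^bsub>V\<^esub> x"
    and "x \<in> carrier V \<Longrightarrow> y \<in> carrier V \<Longrightarrow> r \<odot>\<^bsub>V\<^esub> (x \<oplus>\<^bsub>V\<^esub> y) = r \<odot>\<^bsub>V\<^esub> x \<oplus>\<^bsub>V\<^esub> r \<odot>\<^bsub>V\<^esub> y"
    and "x \<in> carrier V \<Longrightarrow> (r * s) \<odot>\<^bsub>V\<^esub> x = r \<odot>\<^bsub>V\<^esub> (s \<odot>\<^bsub>V\<^esub> x)"
    and "x \<in> carrier V \<Longrightarrow> 1 \<odot>\<^bsub>V\<^esub> x = x"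
    and "x \<in> carrier V \<Longrightarrow> 0 \<odot>\<^bsub>V\<^esub> x = \<zero>\<^bsub>V\<^esub>"
    and "r \<odot>\<^bsub>V\<^esub> \<zero>\<^bsub>V\<^esub> = \<zero>\<^bsub>V\<^esub>"
    and "x \<in> carrier V \<Longrightarrow> \<zero>\<^bsub>V\<^esub> \<oplus>\<^bsub>V\<^esub> x = x"
    and "x \<in> carrier V \<Longrightarrow> x \<oplus>\<^bsub>V\<^esub> \<zero>\<^bsub>V\<^esub> = x"
    and "x \<in> carrier V \<Longrightarrow> y \<in> carrier V \<Longrightarrow> x \<oplus>\<^bsub>V\<^esub> y = y \<oplus>\<^bsub>V\<^esub> x"
    and "x \<in> carrier V \<Longrightarrow> y \<in> carrier V \<Longrightarrow> z \<in> carrier V \<Longrightarrow>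
           x \<oplus>\<^bsub>V\<^esub> y \<oplus>\<^bsub>V\<^esub> z = x \<oplus>\<^bsub>V\<^esub> (y \<oplus>\<^bsub>V\<^esub> z)"
    and "x \<in> carrier V \<Longrightarrow> (- 1) \<odot>\<^bsub>V\<^esub> x = \<ominus>\<^bsub>V\<^esub> x"
proof -
  interpret module scalar_ring V by fact
  show ag: "abelian_group V" by (rule M.abelian_group_axioms)
  show "x \<in> carrier V \<Longrightarrow> (r + s) \<odot>\<^bsub>V\<^esub> x = r \<odot>\<^bsub>V\<^esub> x \<oplus>\<^bsub>V\<^esub> s \<odot>\<^bsub>V\<^esub> x"
    using smult_l_distr[of r s x] by simp
  show "x \<in> carrier V \<Longrightarrow> (r * s) \<odot>\<^bsub>V\<^esub> x = r \<odot>\<^bsub>V\<^esub> (s \<odot>\<^bsub>V\<^esub> x)"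
    using smult_assoc1[of r s x] by simp
  show "x \<in> carrier V \<Longrightarrow> 1 \<odot>\<^bsub>V\<^esub> x = x"
    using smult_one[of x] by simp
  show null: "x \<in> carrier V \<Longrightarrow> 0 \<odot>\<^bsub>V\<^esub> x = \<zero>\<^bsub>V\<^esub>" for x
    using smult_l_null[of x] by simp
  show "x \<in> carrier V \<Longrightarrow> (- 1) \<odot>\<^bsub>V\<^esub> x = \<ominus>\<^bsub>V\<^esub> x"
  proof -
    assume x: "x \<in> carrier V"
    have "\<ominus>\<^bsub>scalar_ring\<^esub> 1 = (- 1 :: 'r)"
      using R.minus_equality[of "- 1" 1] by simp
    then show ?thesis
      using smult_l_minus[of 1 x] smult_one[of x] x by simp
  qed
qed (use module.smult_closed[OF assms] module.smult_r_distr[OF assms] module.smult_r_null[OF assms]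
       module.axioms(2)[OF assms] in
      \<open>auto intro: abelian_monoid.a_comm abelian_monoid.a_assoc
         abelian_group.axioms abelian_monoid.zero_closed abelian_monoid.a_closed
         abelian_monoid.l_zero abelian_monoid.r_zero\<close>)

lemma linear_mapI:
  assumes "\<And>x. x \<in> carrier V \<Longrightarrow> f x \<in> carrier W"
    and "\<And>x y. x \<in> carrier V \<Longrightarrow> y \<in> carrier V \<Longrightarrow> f (x \<oplus>\<^bsub>V\<^esub> y) = f x \<oplus>\<^bsub>W\<^esub> f y"
    and "\<And>r x. x \<in> carrier V \<Longrightarrow> f (r \<odot>\<^bsub>V\<^esub> x) = r \<odot>\<^bsub>W\<^esub> f x"
  shows "linear_map V W f"
  using assms by (auto simp: linear_map_def hom_def)

lemma linear_mapD:
  assumes "linear_map V W f"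
  shows "x \<in> carrier V \<Longrightarrow> f x \<in> carrier W"
    and "x \<in> carrier V \<Longrightarrow> y \<in> carrier V \<Longrightarrow> f (x \<oplus>\<^bsub>V\<^esub> y) = f x \<oplus>\<^bsub>W\<^esub> f y"
    and "x \<in> carrier V \<Longrightarrow> f (r \<odot>\<^bsub>V\<^esub> x) = r \<odot>\<^bsub>W\<^esub> f x"
  using assms by (auto simp: linear_map_def hom_def)

lemma linear_map_zero:
  assumes "linear_map V W f" "is_module V" "is_module W"
  shows "f \<zero>\<^bsub>V\<^esub> = \<zero>\<^bsub>W\<^esub>"
proof -
  have "f \<zero>\<^bsub>V\<^esub> = f (0 \<odot>\<^bsub>V\<^esub> \<zero>\<^bsub>V\<^esub>)"
    by (simp only: is_moduleD(10)[OF assms(2)])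
  also have "\<dots> = 0 \<odot>\<^bsub>W\<^esub> f \<zero>\<^bsub>V\<^esub>"
    by (rule linear_mapD(3)[OF assms(1) is_moduleD(2)[OF assms(2)]])
  also have "\<dots> = \<zero>\<^bsub>W\<^esub>"
    by (intro is_moduleD(9)[OF assms(3)] linear_mapD(1)[OF assms(1)] is_moduleD(2)[OF assms(2)])
  finally show ?thesis .
qed

lemma is_submoduleI:
  assumes V: "is_module V" and "N \<subseteq> carrier V" "\<zero>\<^bsub>V\<^esub> \<in> N"
    and "\<And>x y. x \<in> N \<Longrightarrow> y \<in> N \<Longrightarrow> x \<oplus>\<^bsub>V\<^esub> y \<in> N"
    and smult: "\<And>r x. x \<in> N \<Longrightarrow> r \<odot>\<^bsub>V\<^esub> x \<in> N"
  shows "submodule N scalar_ring V"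
proof (rule module.submoduleI[OF V])
  fix x assume "x \<in> N"
  then show "\<ominus>\<^bsub>V\<^esub> x \<in> N"
    using smult[of x "- 1"] assms(2) is_moduleD(15)[OF V] by auto
qed (use assms in auto)

text \<open>
  The module axioms pass from \<open>V\<close> to any image on which the operations are computed on
  representatives; coset spaces are the case in point.
\<close>

lemma is_module_image:
  assumes V: "is_module V"
    and "C = \<pi> ` carrier V" "z = \<pi> \<zero>\<^bsub>V\<^esub>"
    and "\<And>x y. x \<in> carrier V \<Longrightarrow> y \<in> carrier V \<Longrightarrow> p (\<pi> x) (\<pi> y) = \<pi> (x \<oplus>\<^bsub>V\<^esub> y)"
    and "\<And>r x. x \<in> carrier V \<Longrightarrow> s r (\<pi> x) = \<pi> (r \<odot>\<^bsub>V\<^esub> x)"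
  shows "is_module (make_module C z p s)"
proof -
  note V' = is_moduleD(2-12,14)[OF V]
  show ?thesis
    unfolding assms(2,3)
    by (rule is_moduleI)
       (auto simp: assms(4,5) V' intro!: arg_cong[where f = \<pi>] is_moduleD(13)[OF V])
qed

locale module_quotient =
  fixes V :: "('r::comm_ring_1, 'v) module" and N :: "'v set"
  assumes V: "is_module V" and N: "submodule N scalar_ring V"
begin

sublocale abelian_subgroup N V
proof (rule abelian_subgroupI3)
  show "additive_subgroup N V"
    using N by (simp add: additive_subgroup_def submodule_def)
  show "abelian_group V"
    by (rule is_moduleD[OF V])
qed

lemma coset_self: "x \<in> carrier V \<Longrightarrow> x \<in> N +>\<^bsub>V\<^esub> x"
  by (rule a_rcos_self)

lemma carrier_quot: "carrier (quot_module V N) = (\<lambda>x. N +>\<^bsub>V\<^esub> x) ` carrier V"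
  by (auto simp: quot_module_def A_RCOSETS_def')

lemma zero_quot: "\<zero>\<^bsub>quot_module V N\<^esub> = N +>\<^bsub>V\<^esub> \<zero>\<^bsub>V\<^esub>"
  by (simp add: quot_module_def a_subset)

lemma coset_eq_iff:
  assumes "x \<in> carrier V" "y \<in> carrier V"
  shows "N +>\<^bsub>V\<^esub> x = N +>\<^bsub>V\<^esub> y \<longleftrightarrow> x \<ominus>\<^bsub>V\<^esub> y \<in> N"
  using a_rcos_module[OF assms(2,1)] a_repr_independence'[OF _ assms(2), of x]
    a_repr_independenceD[OF assms(1), of y] by (auto simp: a_minus_def)

lemma coset_eq_zero_iff:
  assumes "x \<in> carrier V"
  shows "N +>\<^bsub>V\<^esub> x = \<zero>\<^bsub>quot_module V N\<^esub> \<longleftrightarrow> x \<in> N"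
proof -
  have "\<ominus>\<^bsub>V\<^esub> \<zero>\<^bsub>V\<^esub> = \<zero>\<^bsub>V\<^esub>"
    by (metis is_moduleD(2,10,15)[OF V])
  then have "x \<ominus>\<^bsub>V\<^esub> \<zero>\<^bsub>V\<^esub> = x"
    using is_moduleD(12)[OF V assms] by (simp only: a_minus_def)
  then show ?thesis
    using coset_eq_iff[OF assms is_moduleD(2)[OF V]] by (simp only: zero_quot)
qed

lemma coset_memD:
  assumes "x \<in> carrier V" "x' \<in> N +>\<^bsub>V\<^esub> x"
  obtains n where "n \<in> N" "x' = n \<oplus>\<^bsub>V\<^esub> x"
  using assms by (auto simp: a_r_coset_def')

lemma add_quot:
  assumes "x \<in> carrier V" "y \<in> carrier V"
  shows "(N +>\<^bsub>V\<^esub> x) \<oplus>\<^bsub>quot_module V N\<^esub> (N +>\<^bsub>V\<^esub> y) = N +>\<^bsub>V\<^esub> (x \<oplus>\<^bsub>V\<^esub> y)"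
  using assms by (simp add: quot_module_def a_rcos_sum)

end

text \<open>
  Every representative of the coset of \<open>x\<close> is \<open>n \<oplus> x\<close> with \<open>n \<in> N\<close>, and \<open>f n\<close> disappears modulo
  \<open>N'\<close>; so all cosets in the union that defines \<open>quot_map\<close> agree.
\<close>

lemma quot_map_coset:
  assumes "module_quotient V N" "module_quotient W N'" "linear_map V W f" "f ` N \<subseteq> N'" "x \<in> carrier V"
  shows "quot_map W N' f (N +>\<^bsub>V\<^esub> x) = N' +>\<^bsub>W\<^esub> f x"
proof -
  interpret Q: module_quotient V N by fact
  interpret Q': module_quotient W N' by fact
  have "N' +>\<^bsub>W\<^esub> f x' = N' +>\<^bsub>W\<^esub> f x" if x': "x' \<in> N +>\<^bsub>V\<^esub> x" for x'
  proof -
    obtain n where n: "n \<in> N" "x' = n \<oplus>\<^bsub>V\<^esub> x"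
      using Q.coset_memD assms(5) x' by blast
    have "N' +>\<^bsub>W\<^esub> f x' = (N' +>\<^bsub>W\<^esub> f n) \<oplus>\<^bsub>quot_module W N'\<^esub> (N' +>\<^bsub>W\<^esub> f x)"
      using n assms(5) linear_mapD[OF assms(3)] Q'.add_quot Q.a_Hcarr by simp
    also have "N' +>\<^bsub>W\<^esub> f n = N' +>\<^bsub>W\<^esub> \<zero>\<^bsub>W\<^esub>"
      using n assms(4) Q'.coset_eq_zero_iff[of "f n"] by (auto simp: Q'.zero_quot)
    also have "\<dots> \<oplus>\<^bsub>quot_module W N'\<^esub> (N' +>\<^bsub>W\<^esub> f x) = N' +>\<^bsub>W\<^esub> f x"
      using Q'.add_quot assms(5) linear_mapD[OF assms(3)] is_moduleD[OF Q'.V] by simp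
    finally show ?thesis .
  qed
  moreover have "x \<in> N +>\<^bsub>V\<^esub> x"
    using Q.a_rcos_self assms(5) by simp
  ultimately show ?thesis
    unfolding quot_map_def by blast
qed

context module_quotient
begin

text \<open>
  Scalar multiplication on a quotient is the map induced by scalar multiplication on \<open>V\<close>, which is
  linear because the scalars commute.
\<close>

lemma smult_quot:
  assumes "x \<in> carrier V"
  shows "r \<odot>\<^bsub>quot_module V N\<^esub> (N +>\<^bsub>V\<^esub> x) = N +>\<^bsub>V\<^esub> (r \<odot>\<^bsub>V\<^esub> x)"
proof -
  have "linear_map V V (\<lambda>x. r \<odot>\<^bsub>V\<^esub> x)"
    by (rule linear_mapI)
       (auto simp: is_moduleD[OF V] simp flip: is_moduleD(7)[OF V] simp: mult.commute)
  moreover have "(\<lambda>x. r \<odot>\<^bsub>V\<^esub> x) ` N \<subseteq> N"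
    using submodule.smult_closed[OF N] by auto
  ultimately show ?thesis
    using quot_map_coset[OF module_quotient_axioms module_quotient_axioms] assms
    by (simp add: quot_module_def quot_map_def)
qed

lemma is_module_quot: "is_module (quot_module V N)"
  unfolding quot_module_def
  by (rule is_module_image[OF V, where \<pi> = "\<lambda>x. N +>\<^bsub>V\<^esub> x"])
     (use carrier_quot zero_quot add_quot smult_quot in \<open>simp_all add: quot_module_def\<close>)

end

lemma linear_map_quot_map:
  assumes "module_quotient V N" "module_quotient W N'" "linear_map V W f" "f ` N \<subseteq> N'"
  shows "linear_map (quot_module V N) (quot_module W N') (quot_map W N' f)"
proof -
  interpret Q: module_quotient V N by fact
  interpret Q': module_quotient W N' by fact
  note V' = is_moduleD[OF Q.V] linear_mapD[OF assms(3)]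
  show ?thesis
    by (rule linear_mapI)
       (auto simp: Q.carrier_quot Q'.carrier_quot quot_map_coset[OF assms]
          Q.add_quot Q'.add_quot Q.smult_quot Q'.smult_quot V')
qed

lemma linear_iso_quot_map:
  assumes "module_quotient V N" "module_quotient W N'" "linear_iso V W f" "f ` N = N'"
  shows "linear_iso (quot_module V N) (quot_module W N') (quot_map W N' f)"
proof -
  interpret Q: module_quotient V N by fact
  interpret Q': module_quotient W N' by fact
  have lin: "linear_map V W f" and bij: "bij_betw f (carrier V) (carrier W)"
    using assms(3) by (auto simp: linear_iso_def)
  note V' = is_moduleD(2-4)[OF Q.V] linear_mapD[OF lin]
  have sub: "f ` N \<subseteq> N'" using assms(4) by simp
  note co = quot_map_coset[OF assms(1,2) lin sub]
  have "bij_betw (quot_map W N' f) (carrier (quot_module V N)) (carrier (quot_module W N'))"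
    unfolding bij_betw_def
  proof
    show "inj_on (quot_map W N' f) (carrier (quot_module V N))"
    proof (rule inj_onI)
      fix X Y assume "X \<in> carrier (quot_module V N)" "Y \<in> carrier (quot_module V N)"
        and eq: "quot_map W N' f X = quot_map W N' f Y"
      then obtain x y where x: "x \<in> carrier V" "X = N +>\<^bsub>V\<^esub> x" and y: "y \<in> carrier V" "Y = N +>\<^bsub>V\<^esub> y"
        by (auto simp: Q.carrier_quot)
      have my: "\<ominus>\<^bsub>V\<^esub> y = (- 1) \<odot>\<^bsub>V\<^esub> y" "\<ominus>\<^bsub>W\<^esub> f y = (- 1) \<odot>\<^bsub>W\<^esub> f y"
        by (simp_all only: is_moduleD(15)[OF Q.V y(1)] is_moduleD(15)[OF Q'.V V'(4)[OF y(1)]])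
      have "f x \<ominus>\<^bsub>W\<^esub> f y = f (x \<ominus>\<^bsub>V\<^esub> y)"
        using x y by (simp add: a_minus_def my V')
      moreover have "f x \<ominus>\<^bsub>W\<^esub> f y \<in> N'"
        using eq x y Q'.coset_eq_iff V' by (simp add: co)
      moreover have "x \<ominus>\<^bsub>V\<^esub> y \<in> carrier V"
        using x y by (simp add: a_minus_def my V')
      moreover obtain n where "n \<in> N" "f n = f x \<ominus>\<^bsub>W\<^esub> f y"
        using calculation(2) assms(4) by auto
      ultimately have "x \<ominus>\<^bsub>V\<^esub> y \<in> N"
        using bij_betw_imp_inj_on[OF bij] Q.a_Hcarr inj_onD by metis
      then show "X = Y"
        using Q.coset_eq_iff x y by simp
    qed
    show "quot_map W N' f ` carrier (quot_module V N) = carrier (quot_module W N')"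
      using bij_betw_imp_surj_on[OF bij]
      by (simp add: Q.carrier_quot Q'.carrier_quot co image_image flip: image_image[of "(+>\<^bsub>W\<^esub>) N'" f] cong: image_cong_simp)
  qed
  then show ?thesis
    using linear_map_quot_map[OF assms(1,2) lin sub] by (simp add: linear_iso_def)
qed

definition cochain_complex ::
  "(int \<Rightarrow> ('r::comm_ring_1, 'v) module) \<Rightarrow> (int \<Rightarrow> 'v \<Rightarrow> 'v) \<Rightarrow> bool" where
  "cochain_complex C d \<longleftrightarrow>
     (\<forall>p. is_module (C p) \<and> linear_map (C p) (C (p + 1)) (d p) \<and>
        (\<forall>x\<in>carrier (C p). d (p + 1) (d p x) = \<zero>\<^bsub>C (p + 2)\<^esub>))"

text \<open>
  The integer \<open>s\<close> is a degree shift: the Hochster--Takayama map lowers degrees by \<open>|G\<^sub>a| + 1\<close>.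
\<close>

definition cochain_map ::
  "(int \<Rightarrow> ('r::comm_ring_1, 'v) module) \<Rightarrow> (int \<Rightarrow> 'v \<Rightarrow> 'v) \<Rightarrow>
   (int \<Rightarrow> ('r, 'w) module) \<Rightarrow> (int \<Rightarrow> 'w \<Rightarrow> 'w) \<Rightarrow> int \<Rightarrow> (int \<Rightarrow> 'v \<Rightarrow> 'w) \<Rightarrow> bool" where
  "cochain_map C d C' d' s f \<longleftrightarrow>
     (\<forall>p. linear_map (C p) (C' (p - s)) (f p) \<and>
        (\<forall>x\<in>carrier (C p). f (p + 1) (d p x) = d' (p - s) (f p x)))"

lemma cochain_complexD:
  assumes "cochain_complex C d"
  shows "is_module (C p)" "linear_map (C p) (C (p + 1)) (d p)"
    and "x \<in> carrier (C p) \<Longrightarrow> d (p + 1) (d p x) = \<zero>\<^bsub>C (p + 2)\<^esub>"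
  using assms by (auto simp: cochain_complex_def)

lemma cochain_mapD:
  assumes "cochain_map C d C' d' s f"
  shows "linear_map (C p) (C' (p - s)) (f p)"
    and "x \<in> carrier (C p) \<Longrightarrow> f (p + 1) (d p x) = d' (p - s) (f p x)"
  using assms by (auto simp: cochain_map_def)

lemma cocycles_simps [simp]:
  "carrier (cocycles C d p) = {z \<in> carrier (C p). d p z = \<zero>\<^bsub>C (p + 1)\<^esub>}"
  "\<zero>\<^bsub>cocycles C d p\<^esub> = \<zero>\<^bsub>C p\<^esub>" "x \<oplus>\<^bsub>cocycles C d p\<^esub> y = x \<oplus>\<^bsub>C p\<^esub> y"
  "r \<odot>\<^bsub>cocycles C d p\<^esub> x = r \<odot>\<^bsub>C p\<^esub> x"
  by (simp_all add: cocycles_def)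

lemma quotient_cocycles:
  assumes C: "cochain_complex C d"
  shows "module_quotient (cocycles C d p) (coboundaries C d p)"
proof (rule module_quotient.intro)
  note M = is_moduleD[OF cochain_complexD(1)[OF C]]
  note L = linear_mapD[OF cochain_complexD(2)[OF C]]
  have d0: "d p \<zero>\<^bsub>C p\<^esub> = \<zero>\<^bsub>C (p + 1)\<^esub>" for p
    using cochain_complexD[OF C] linear_map_zero by blast
  have "submodule (carrier (cocycles C d p)) scalar_ring (C p)"
    by (rule is_submoduleI[OF cochain_complexD(1)[OF C]]) (auto simp: M L d0)
  then show Z: "is_module (cocycles C d p)"
    using submodule.submodule_is_module cochain_complexD(1)[OF C]
    by (fastforce simp: cocycles_def)
  have step: "x \<in> carrier (C (p - 1)) \<Longrightarrow> d (p - 1) x \<in> carrier (C p)"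
    "x \<in> carrier (C (p - 1)) \<Longrightarrow> d p (d (p - 1) x) = \<zero>\<^bsub>C (p + 1)\<^esub>"
    "x \<in> carrier (C (p - 1)) \<Longrightarrow> y \<in> carrier (C (p - 1)) \<Longrightarrow>
       d (p - 1) x \<oplus>\<^bsub>C p\<^esub> d (p - 1) y = d (p - 1) (x \<oplus>\<^bsub>C (p - 1)\<^esub> y)"
    "x \<in> carrier (C (p - 1)) \<Longrightarrow> r \<odot>\<^bsub>C p\<^esub> d (p - 1) x = d (p - 1) (r \<odot>\<^bsub>C (p - 1)\<^esub> x)"
    for x y r
    using linear_mapD[OF cochain_complexD(2)[OF C, of "p - 1"]]
      cochain_complexD(3)[OF C, where p = "p - 1"] by (auto simp: add.commute)
  have "\<zero>\<^bsub>C p\<^esub> = d (p - 1) \<zero>\<^bsub>C (p - 1)\<^esub>"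
    using d0[of "p - 1"] by simp
  then show "submodule (coboundaries C d p) scalar_ring (cocycles C d p)"
    by (intro is_submoduleI[OF Z]) (auto simp: coboundaries_def step M intro!: imageI)
qed

lemma cohomology_cases:
  assumes "cochain_complex C d" "\<xi> \<in> carrier (cohomology C d p)"
  obtains z where "z \<in> carrier (cocycles C d p)"
    "\<xi> = coboundaries C d p +>\<^bsub>cocycles C d p\<^esub> z"
  using assms module_quotient.carrier_quot[OF quotient_cocycles[OF assms(1)]]
  unfolding cohomology_def by blast

lemma is_module_cohomology:
  assumes "cochain_complex C d"
  shows "is_module (cohomology C d p)"
  unfolding cohomology_def
  by (rule module_quotient.is_module_quot[OF quotient_cocycles[OF assms]])

lemma cochain_map_cocycles:
  assumes C: "cochain_complex C d" "cochain_complex C' d'" "cochain_map C d C' d' s f"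
  shows "linear_map (cocycles C d p) (cocycles C' d' (p - s)) (f p)"
    and "f p ` coboundaries C d p \<subseteq> coboundaries C' d' (p - s)"
proof -
  note L = linear_mapD[OF cochain_mapD(1)[OF C(3)]]
  have eq: "p + 1 - s = p - s + 1" "p - 1 - s = p - s - 1"
    by simp_all
  have "f (p + 1) \<zero>\<^bsub>C (p + 1)\<^esub> = \<zero>\<^bsub>C' (p + 1 - s)\<^esub>"
    using linear_map_zero[OF cochain_mapD(1)[OF C(3)]] cochain_complexD(1)[OF C(1)]
      cochain_complexD(1)[OF C(2)] by simp
  then have "d' (p - s) (f p x) = \<zero>\<^bsub>C' (p - s + 1)\<^esub>"
    if "x \<in> carrier (C p)" "d p x = \<zero>\<^bsub>C (p + 1)\<^esub>" for x
    using that cochain_mapD(2)[OF C(3), of x p] by (simp add: eq)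
  then show "linear_map (cocycles C d p) (cocycles C' d' (p - s)) (f p)"
    by (intro linear_mapI) (auto simp: L)
  have "f p (d (p - 1) x) = d' (p - s - 1) (f (p - 1) x)" "f (p - 1) x \<in> carrier (C' (p - s - 1))"
    if "x \<in> carrier (C (p - 1))" for x
    using cochain_mapD(2)[OF C(3) that] L(1)[OF that] by (simp_all only: eq diff_add_cancel)
  then show "f p ` coboundaries C d p \<subseteq> coboundaries C' d' (p - s)"
    by (auto simp: coboundaries_def)
qed

lemma linear_map_cohomology_map:
  assumes "cochain_complex C d" "cochain_complex C' d'" "cochain_map C d C' d' s f"
  shows "linear_map (cohomology C d p) (cohomology C' d' (p - s)) (cohomology_map C' d' (p - s) (f p))"
  unfolding cohomology_def cohomology_map_def
  by (intro linear_map_quot_map quotient_cocycles cochain_map_cocycles[OF assms] assms)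

lemma cohomology_map_coset:
  assumes "cochain_complex C d" "cochain_complex C' d'" "cochain_map C d C' d' s f"
    and "z \<in> carrier (cocycles C d p)"
  shows "cohomology_map C' d' (p - s) (f p) (coboundaries C d p +>\<^bsub>cocycles C d p\<^esub> z) =
     coboundaries C' d' (p - s) +>\<^bsub>cocycles C' d' (p - s)\<^esub> f p z"
  unfolding cohomology_map_def
  by (intro quot_map_coset quotient_cocycles cochain_map_cocycles[OF assms(1-3)] assms)

text \<open>
  A cochain map bijective in all degrees has a cochain map as inverse, so it matches cocycles with
  cocycles (by injectivity in degree \<open>p + 1\<close>) and coboundaries with coboundaries (by surjectivity in
  degree \<open>p - 1\<close>).
\<close>

lemma linear_iso_cohomology_map:
  assumes C: "cochain_complex C d" "cochain_complex C' d'" "cochain_map C d C' d' s f"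
    and bij: "\<And>p. bij_betw (f p) (carrier (C p)) (carrier (C' (p - s)))"
  shows "linear_iso (cohomology C d p) (cohomology C' d' (p - s)) (cohomology_map C' d' (p - s) (f p))"
  unfolding cohomology_def cohomology_map_def
proof (intro linear_iso_quot_map quotient_cocycles C)
  note L = linear_mapD[OF cochain_mapD(1)[OF C(3)]]
  have eq: "p + 1 - s = p - s + 1" "p - 1 - s = p - s - 1"
    by simp_all
  have inj: "inj_on (f p) (carrier (C p))" and surj: "f p ` carrier (C p) = carrier (C' (p - s))" for p
    using bij[of p] by (auto simp: bij_betw_def)
  have "f p ` carrier (cocycles C d p) = carrier (cocycles C' d' (p - s))"
  proof
    show "f p ` carrier (cocycles C d p) \<subseteq> carrier (cocycles C' d' (p - s))"
      using linear_mapD(1)[OF cochain_map_cocycles(1)[OF C]] by blast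
    show "carrier (cocycles C' d' (p - s)) \<subseteq> f p ` carrier (cocycles C d p)"
    proof
      fix y assume y: "y \<in> carrier (cocycles C' d' (p - s))"
      then obtain x where x: "x \<in> carrier (C p)" "y = f p x"
        using surj[of p] by auto
      have "f (p + 1) (d p x) = \<zero>\<^bsub>C' (p + 1 - s)\<^esub>"
        using y x cochain_mapD(2)[OF C(3), of x p] by (simp add: eq)
      also have "\<dots> = f (p + 1) \<zero>\<^bsub>C (p + 1)\<^esub>"
        using linear_map_zero[OF cochain_mapD(1)[OF C(3)]] cochain_complexD(1)[OF C(1)]
          cochain_complexD(1)[OF C(2)] by simp
      finally have "d p x = \<zero>\<^bsub>C (p + 1)\<^esub>"
        using inj[of "p + 1"] x linear_mapD(1)[OF cochain_complexD(2)[OF C(1)]]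
          is_moduleD(2)[OF cochain_complexD(1)[OF C(1)]]
        by (simp add: inj_on_eq_iff)
      then show "y \<in> f p ` carrier (cocycles C d p)"
        using x by auto
    qed
  qed
  moreover have "inj_on (f p) (carrier (cocycles C d p))"
    by (rule inj_on_subset[OF inj[of p]]) auto
  ultimately show "linear_iso (cocycles C d p) (cocycles C' d' (p - s)) (f p)"
    using cochain_map_cocycles(1)[OF C] by (simp add: linear_iso_def bij_betw_def)
  have "f p (d (p - 1) x) = d' (p - s - 1) (f (p - 1) x)" if "x \<in> carrier (C (p - 1))" for x
    using cochain_mapD(2)[OF C(3) that] by (simp only: eq diff_add_cancel)
  moreover have "carrier (C' (p - s - 1)) = f (p - 1) ` carrier (C (p - 1))"
    using surj[of "p - 1"] by (simp only: eq)
  ultimately show "f p ` coboundaries C d p = coboundaries C' d' (p - s)"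
    by (simp add: coboundaries_def image_image)
qed

section \<open>Relative simplicial cochains\<close>

lemma lookup_map_scale:
  "Poly_Mapping.lookup (Poly_Mapping.map ((*) r) z) E = r * Poly_Mapping.lookup z E"
  for r :: "'k::field"
  by (simp add: Poly_Mapping.map.rep_eq when_def)

lemma in_chains_iff:
  "z \<in> carrier (chains \<Delta> p) \<longleftrightarrow> (\<forall>E. Poly_Mapping.lookup z E \<noteq> 0 \<longrightarrow> E \<in> faces \<Delta> p)"
  by (auto simp: chains_def in_keys_iff)

lemma chains_simps [simp]:
  "\<zero>\<^bsub>chains \<Delta> p\<^esub> = 0" "z \<oplus>\<^bsub>chains \<Delta> p\<^esub> w = z + w"
  "r \<odot>\<^bsub>chains \<Delta> p\<^esub> z = Poly_Mapping.map ((*) r) z"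
  by (simp_all add: chains_def)

lemma is_module_chains: "is_module (chains \<Delta> p :: ('k::field, 'n set \<Rightarrow>\<^sub>0 'k) module)"
  by (rule is_moduleI)
     (auto simp: in_chains_iff lookup_add lookup_map_scale algebra_simps intro!: poly_mapping_eqI,
      metis add.left_neutral)

lemma quotient_chains:
  assumes "\<Gamma> \<subseteq> \<Delta>"
  shows "module_quotient (chains \<Delta> p) (carrier (chains \<Gamma> p :: ('k::field, 'n set \<Rightarrow>\<^sub>0 'k) module))"
proof (rule module_quotient.intro[OF is_module_chains], rule is_submoduleI[OF is_module_chains])
  show "carrier (chains \<Gamma> p) \<subseteq> carrier (chains \<Delta> p :: ('k::field, 'n set \<Rightarrow>\<^sub>0 'k) module)"
    using assms by (auto simp: chains_def faces_def)
qed (use is_moduleD[OF is_module_chains[of \<Gamma> p]] in auto)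

text \<open>
  Removing the larger vertex first does not change the position of the smaller one, while removing
  the smaller first lowers that of the larger by one.  This is why the boundary squares to zero.
\<close>

lemma incidence_sign_swap:
  fixes E :: "'n::{finite,linorder} set"
  assumes "j \<in> E" "l \<in> E" "l < j"
  shows "incidence_sign l (E - {j}) * incidence_sign j E =
     - (incidence_sign j (E - {l}) * incidence_sign l E :: 'r::comm_ring_1)"
proof -
  have "{i \<in> E - {j}. i < l} = {i \<in> E. i < l}"
    using assms by auto
  moreover have "{i \<in> E. i < j} = insert l {i \<in> E - {l}. i < j}"
    using assms by auto
  ultimately show ?thesis
    by (simp add: incidence_sign_def)
qed

text \<open>
  The sum is split into \<open>l < j\<close> and \<open>j < l\<close>, and the halves cancel.  Showing instead that the sum equals
  its own negative would prove nothing in characteristic two.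
\<close>

lemma sum_two_vertices_cancel:
  fixes h :: "'r::comm_ring_1 \<Rightarrow> 'n::{finite,linorder} set \<Rightarrow> 'b::ab_group_add"
  assumes "\<And>r D. h (- r) D = - h r D"
  shows "(\<Sum>j\<in>E. \<Sum>l\<in>E - {j}. h (incidence_sign l (E - {j}) * incidence_sign j E) (E - {j} - {l})) = 0"
proof -
  let ?t = "\<lambda>j l. h (incidence_sign l (E - {j}) * incidence_sign j E) (E - {j} - {l})"
  have swap: "?t j l = - ?t l j" if "j \<in> E" "l \<in> E" "l < j" for j l
  proof -
    have "E - {j} - {l} = E - {l} - {j}" by auto
    then show ?thesis
      using incidence_sign_swap[OF that, where 'r = 'r] assms by simp
  qed
  have "(\<Sum>j\<in>E. \<Sum>l\<in>E - {j}. ?t j l) = (\<Sum>j\<in>E. (\<Sum>l\<in>{l\<in>E. l < j}. ?t j l) + (\<Sum>l\<in>{l\<in>E. j < l}. ?t j l))"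
  proof (rule sum.cong[OF refl])
    fix j
    have "E - {j} = {l\<in>E. l < j} \<union> {l\<in>E. j < l}" by auto
    then show "(\<Sum>l\<in>E - {j}. ?t j l) = (\<Sum>l\<in>{l\<in>E. l < j}. ?t j l) + (\<Sum>l\<in>{l\<in>E. j < l}. ?t j l)"
      by (metis (no_types, lifting) finite sum.union_disjoint disjoint_iff mem_Collect_eq order_less_asym)
  qed
  also have "\<dots> = (\<Sum>j\<in>E. \<Sum>l\<in>{l\<in>E. l < j}. ?t j l) + (\<Sum>j\<in>E. \<Sum>l\<in>{l\<in>E. j < l}. ?t j l)"
    by (rule sum.distrib)
  also have "(\<Sum>j\<in>E. \<Sum>l\<in>{l\<in>E. j < l}. ?t j l) = (\<Sum>j\<in>E. \<Sum>l\<in>{l\<in>E. l < j}. ?t l j)"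
    by (rule sum.swap_restrict) auto
  also have "(\<Sum>j\<in>E. \<Sum>l\<in>{l\<in>E. l < j}. ?t j l) = - (\<Sum>j\<in>E. \<Sum>l\<in>{l\<in>E. l < j}. ?t l j)"
    unfolding sum_negf[symmetric] by (intro sum.cong refl) (use swap in auto)
  finally show ?thesis by simp
qed

lemma boundary_eq_sum:
  "boundary z = (\<Sum>E\<in>UNIV. \<Sum>j\<in>E.
     Poly_Mapping.single (E - {j}) (incidence_sign j E * Poly_Mapping.lookup z E))"
  unfolding boundary_def by (rule sum.mono_neutral_left) (auto simp: in_keys_iff)

lemma boundary_add: "boundary (z + w) = boundary z + boundary w"
  by (simp add: boundary_eq_sum lookup_add ring_distribs single_add sum.distrib)

lemma boundary_scale:
  "boundary (Poly_Mapping.map ((*) r) z) = Poly_Mapping.map ((*) r) (boundary z)"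
proof (rule poly_mapping_eqI)
  fix D
  show "Poly_Mapping.lookup (boundary (Poly_Mapping.map ((*) r) z)) D =
      Poly_Mapping.lookup (Poly_Mapping.map ((*) r) (boundary z)) D"
    by (simp add: boundary_eq_sum lookup_map_scale lookup_sum lookup_single sum_distrib_left
        when_def mult.left_commute if_distrib[of "(*) r"] cong: if_cong)
qed

lemma boundary_sum: "boundary (\<Sum>i\<in>A. z i) = (\<Sum>i\<in>A. boundary (z i))"
proof (induction A rule: infinite_finite_induct)
  case (insert i A)
  then show ?case by (simp add: boundary_add)
qed (simp_all add: boundary_def)

lemma boundary_single:
  "boundary (Poly_Mapping.single E r) = (\<Sum>j\<in>E. Poly_Mapping.single (E - {j}) (incidence_sign j E * r))"
  by (cases "r = 0") (simp_all add: boundary_def)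

lemma chain_eq_sum:
  fixes z :: "'n::finite set \<Rightarrow>\<^sub>0 'k::field"
  assumes "z \<in> carrier (chains \<Delta> p)"
  shows "z = (\<Sum>E\<in>faces \<Delta> p. Poly_Mapping.single E (Poly_Mapping.lookup z E))"
proof (rule poly_mapping_eqI)
  fix D
  show "Poly_Mapping.lookup z D =
      Poly_Mapping.lookup (\<Sum>E\<in>faces \<Delta> p. Poly_Mapping.single E (Poly_Mapping.lookup z E)) D"
    using assms by (auto simp: lookup_sum lookup_single in_chains_iff when_def)
qed

lemma boundary_boundary:
  fixes z :: "'n::{finite,linorder} set \<Rightarrow>\<^sub>0 'k::field"
  shows "boundary (boundary z) = 0"
proof -
  have "boundary (boundary (Poly_Mapping.single E r)) = 0" for E :: "'n set" and r :: 'k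
    using sum_two_vertices_cancel[of "\<lambda>s D. Poly_Mapping.single D (s * r)" E]
    by (simp add: boundary_single boundary_sum single_uminus mult.assoc)
  moreover have "boundary z = (\<Sum>E\<in>UNIV. boundary (Poly_Mapping.single E (Poly_Mapping.lookup z E)))"
    by (simp add: boundary_eq_sum[of z] boundary_single)
  then have "boundary (boundary z) =
      (\<Sum>E\<in>UNIV. boundary (boundary (Poly_Mapping.single E (Poly_Mapping.lookup z E))))"
    by (simp only: boundary_sum)
  ultimately show ?thesis by simp
qed

lemma field_module_simps [simp]:
  "carrier field_module = UNIV" "\<zero>\<^bsub>field_module\<^esub> = 0" "x \<oplus>\<^bsub>field_module\<^esub> y = x + y"
  "r \<odot>\<^bsub>field_module\<^esub> x = r * x"
  by (simp_all add: field_module_def)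

lemma is_module_field_module: "is_module field_module"
  by (rule is_moduleI) (auto simp: algebra_simps)

lemma dual_module_simps [simp]:
  "carrier (dual_module V) = {\<phi> \<in> extensional (carrier V). linear_map V field_module \<phi>}"
  "\<zero>\<^bsub>dual_module V\<^esub> = (\<lambda>x\<in>carrier V. 0)"
  "\<phi> \<oplus>\<^bsub>dual_module V\<^esub> \<psi> = (\<lambda>x\<in>carrier V. \<phi> x + \<psi> x)"
  "r \<odot>\<^bsub>dual_module V\<^esub> \<phi> = (\<lambda>x\<in>carrier V. r * \<phi> x)"
  by (simp_all add: dual_module_def)

lemma is_module_dual_module:
  assumes "is_module V"
  shows "is_module (dual_module V)"
proof -
  note V = is_moduleD(2-4)[OF assms]
  show ?thesis
    by (rule is_moduleI)
       (auto intro!: linear_mapI ext simp: V linear_mapD algebra_simps restrict_def extensional_def)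
qed

lemma linear_map_dual:
  assumes "is_module V" "is_module W" "linear_map W V f"
  shows "linear_map (dual_module V) (dual_module W) (\<lambda>\<phi>. \<lambda>x\<in>carrier W. \<phi> (f x))"
proof -
  note V = is_moduleD(2-4)[OF assms(1)] is_moduleD(2-4)[OF assms(2)] linear_mapD[OF assms(3)]
  show ?thesis
    by (rule linear_mapI)
       (auto intro!: linear_mapI ext simp: V linear_mapD restrict_def extensional_def)
qed

text \<open>
  Closure under removing one vertex at a time is what the boundary uses; on a finite vertex
  set it amounts to closure under subsets.
\<close>

locale simplicial_pair =
  fixes \<Delta> \<Gamma> :: "'n::{finite,linorder} set set"
  assumes sub: "\<Gamma> \<subseteq> \<Delta>"
    and closed: "E \<in> \<Delta> \<Longrightarrow> j \<in> E \<Longrightarrow> E - {j} \<in> \<Delta>"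
    and closed': "E \<in> \<Gamma> \<Longrightarrow> j \<in> E \<Longrightarrow> E - {j} \<in> \<Gamma>"

text \<open>
  The class of the oriented face \<open>E\<close> in the relative chains; it vanishes for \<open>E \<in> \<Gamma>\<close>.  A relative
  cochain is handled through its values on these classes.
\<close>

definition rel_basis :: "'n set set \<Rightarrow> 'n set set \<Rightarrow> int \<Rightarrow> 'n set \<Rightarrow> ('n set \<Rightarrow>\<^sub>0 'k::field) set" where
  "rel_basis \<Delta> \<Gamma> p E =
     carrier (chains \<Gamma> p :: ('k, 'n set \<Rightarrow>\<^sub>0 'k) module)
       +>\<^bsub>(chains \<Delta> p :: ('k, 'n set \<Rightarrow>\<^sub>0 'k) module)\<^esub> Poly_Mapping.single E 1"

definition cochain_with_values ::
  "'n::finite set set \<Rightarrow> 'n set set \<Rightarrow> int \<Rightarrow> ('n set \<Rightarrow> 'k::field) \<Rightarrow> ('n set \<Rightarrow>\<^sub>0 'k) set \<Rightarrow> 'k" where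
  "cochain_with_values \<Delta> \<Gamma> p v =
     (\<lambda>X\<in>carrier (rel_chains \<Delta> \<Gamma> p :: ('k, ('n set \<Rightarrow>\<^sub>0 'k) set) module).
        \<Sum>E\<in>faces (\<Delta> - \<Gamma>) p. v E * basis_cochain \<Delta> \<Gamma> p E X)"

lemma chains_mono:
  assumes "\<Gamma> \<subseteq> \<Delta>"
  shows "carrier (chains \<Gamma> p :: ('k::field, 'n set \<Rightarrow>\<^sub>0 'k) module) \<subseteq> carrier (chains \<Delta> p)"
  using subsetD[OF assms] by (auto simp: in_chains_iff faces_def)

lemma faces_remove_vertex:
  fixes E :: "'n::finite set"
  assumes "E \<in> faces \<Delta> (p + 1)" "j \<in> E" "E - {j} \<in> \<Delta>"
  shows "E - {j} \<in> faces \<Delta> p"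
  using assms card_Suc_Diff1[of E j] by (auto simp: faces_def)

lemma linear_map_boundary:
  fixes \<Delta> :: "'n::{finite,linorder} set set"
  assumes "\<And>E j. E \<in> \<Delta> \<Longrightarrow> j \<in> E \<Longrightarrow> E - {j} \<in> \<Delta>"
  shows "linear_map (chains \<Delta> p) (chains \<Delta> (p - 1) :: ('k::field, 'n set \<Rightarrow>\<^sub>0 'k) module) boundary"
proof (rule linear_mapI)
  fix z :: "'n set \<Rightarrow>\<^sub>0 'k" assume z: "z \<in> carrier (chains \<Delta> p)"
  have "E - {j} \<in> faces \<Delta> (p - 1)" if "E \<in> faces \<Delta> p" "j \<in> E" for E j
    using that assms by (intro faces_remove_vertex) (auto simp: faces_def)
  moreover have "Poly_Mapping.keys (boundary z) \<subseteq>
      (\<Union>E\<in>Poly_Mapping.keys z. \<Union>j\<in>E. Poly_Mapping.keys (Poly_Mapping.single (E - {j})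
         (incidence_sign j E * Poly_Mapping.lookup z E)))"
    unfolding boundary_def by (intro order_trans[OF keys_sum] UN_mono keys_sum order_refl)
  ultimately show "boundary z \<in> carrier (chains \<Delta> (p - 1) :: ('k, 'n set \<Rightarrow>\<^sub>0 'k) module)"
    using z by (fastforce simp: chains_def split: if_splits)
qed (simp_all add: boundary_add boundary_scale)

context simplicial_pair
begin

lemma quotient_pair:
  "module_quotient (chains \<Delta> p) (carrier (chains \<Gamma> p :: ('k::field, 'n set \<Rightarrow>\<^sub>0 'k) module))"
  by (rule quotient_chains[OF sub])

lemma is_module_rel_chains: "is_module (rel_chains \<Delta> \<Gamma> p :: ('k::field, ('n set \<Rightarrow>\<^sub>0 'k) set) module)"
  unfolding rel_chains_def by (rule module_quotient.is_module_quot[OF quotient_pair])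

lemma boundary_chains:
  "linear_map (chains \<Delta> p) (chains \<Delta> (p - 1) :: ('k::field, 'n set \<Rightarrow>\<^sub>0 'k) module) boundary"
  "boundary ` carrier (chains \<Gamma> p :: ('k, 'n set \<Rightarrow>\<^sub>0 'k) module) \<subseteq> carrier (chains \<Gamma> (p - 1) :: ('k, 'n set \<Rightarrow>\<^sub>0 'k) module)"
proof -
  show "linear_map (chains \<Delta> p) (chains \<Delta> (p - 1) :: ('k::field, 'n set \<Rightarrow>\<^sub>0 'k) module) boundary"
    by (rule linear_map_boundary[OF closed])
  have "linear_map (chains \<Gamma> p) (chains \<Gamma> (p - 1) :: ('k::field, 'n set \<Rightarrow>\<^sub>0 'k) module) boundary"
    by (rule linear_map_boundary[OF closed'])
  from linear_mapD(1)[OF this] show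
    "boundary ` carrier (chains \<Gamma> p :: ('k, 'n set \<Rightarrow>\<^sub>0 'k) module) \<subseteq> carrier (chains \<Gamma> (p - 1) :: ('k, 'n set \<Rightarrow>\<^sub>0 'k) module)"
    by blast
qed

lemma linear_map_rel_boundary:
  "linear_map (rel_chains \<Delta> \<Gamma> p) (rel_chains \<Delta> \<Gamma> (p - 1) :: ('k::field, ('n set \<Rightarrow>\<^sub>0 'k) set) module)
     (rel_boundary \<Delta> \<Gamma> p)"
  unfolding rel_chains_def rel_boundary_def
  by (intro linear_map_quot_map quotient_pair boundary_chains)

lemma rel_boundary_coset:
  fixes z :: "'n set \<Rightarrow>\<^sub>0 'k::field"
  assumes "z \<in> carrier (chains \<Delta> p)"
  shows "rel_boundary \<Delta> \<Gamma> p (carrier (chains \<Gamma> p) +>\<^bsub>chains \<Delta> p\<^esub> z) =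
     carrier (chains \<Gamma> (p - 1)) +>\<^bsub>chains \<Delta> (p - 1)\<^esub> boundary z"
  unfolding rel_boundary_def
  by (intro quot_map_coset quotient_pair boundary_chains assms)

lemma rel_chain_cases:
  fixes X :: "('n set \<Rightarrow>\<^sub>0 'k::field) set"
  assumes "X \<in> carrier (rel_chains \<Delta> \<Gamma> p)"
  obtains z where "z \<in> carrier (chains \<Delta> p)" "X = carrier (chains \<Gamma> p) +>\<^bsub>chains \<Delta> p\<^esub> z"
  using assms unfolding rel_chains_def module_quotient.carrier_quot[OF quotient_pair] by blast

lemma coset_in_rel_chains:
  fixes z :: "'n set \<Rightarrow>\<^sub>0 'k::field"
  assumes "z \<in> carrier (chains \<Delta> p)"
  shows "carrier (chains \<Gamma> p) +>\<^bsub>chains \<Delta> p\<^esub> z \<in> carrier (rel_chains \<Delta> \<Gamma> p)"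
  using assms unfolding rel_chains_def module_quotient.carrier_quot[OF quotient_pair] by blast

lemma cochain_complex_rel_cochains:
  "cochain_complex (rel_cochains \<Delta> \<Gamma> :: int \<Rightarrow> ('k::field, ('n set \<Rightarrow>\<^sub>0 'k) set \<Rightarrow> 'k) module)
     (rel_coboundary \<Delta> \<Gamma>)"
  unfolding cochain_complex_def
proof (intro allI conjI ballI)
  fix p
  show "is_module (rel_cochains \<Delta> \<Gamma> p :: ('k::field, ('n set \<Rightarrow>\<^sub>0 'k) set \<Rightarrow> 'k) module)"
    unfolding rel_cochains_def by (intro is_module_dual_module is_module_rel_chains)
  have lb: "linear_map (rel_chains \<Delta> \<Gamma> (p + 1)) (rel_chains \<Delta> \<Gamma> p :: ('k::field, ('n set \<Rightarrow>\<^sub>0 'k) set) module)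
     (rel_boundary \<Delta> \<Gamma> (p + 1))" for p
    using linear_map_rel_boundary[of "p + 1"] by simp
  show "linear_map (rel_cochains \<Delta> \<Gamma> p) (rel_cochains \<Delta> \<Gamma> (p + 1))
     (rel_coboundary \<Delta> \<Gamma> p :: (('n set \<Rightarrow>\<^sub>0 'k) set \<Rightarrow> 'k) \<Rightarrow> _)"
    unfolding rel_cochains_def rel_coboundary_def
    by (intro linear_map_dual is_module_rel_chains lb)
  fix \<phi> :: "('n set \<Rightarrow>\<^sub>0 'k) set \<Rightarrow> 'k" assume \<phi>: "\<phi> \<in> carrier (rel_cochains \<Delta> \<Gamma> p)"
  then have \<phi>0: "\<phi> \<zero>\<^bsub>rel_chains \<Delta> \<Gamma> p\<^esub> = 0"
    using linear_map_zero[of "rel_chains \<Delta> \<Gamma> p" field_module \<phi>]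
    by (auto simp: rel_cochains_def is_module_rel_chains is_module_field_module)
  have "rel_boundary \<Delta> \<Gamma> (p + 1) (rel_boundary \<Delta> \<Gamma> (p + 2) X) = \<zero>\<^bsub>rel_chains \<Delta> \<Gamma> p\<^esub>"
    if X: "X \<in> carrier (rel_chains \<Delta> \<Gamma> (p + 2))" for X :: "('n set \<Rightarrow>\<^sub>0 'k) set"
  proof -
    obtain z where z: "z \<in> carrier (chains \<Delta> (p + 2))" "X = carrier (chains \<Gamma> (p + 2)) +>\<^bsub>chains \<Delta> (p + 2)\<^esub> z"
      using rel_chain_cases[OF X] .
    have "boundary z \<in> carrier (chains \<Delta> (p + 1))"
      using linear_mapD(1)[OF boundary_chains(1) z(1)] by (simp add: add.commute)
    then show ?thesis
      using z rel_boundary_coset[of z "p + 2"] rel_boundary_coset[of "boundary z" "p + 1"]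
      by (simp add: boundary_boundary rel_chains_def module_quotient.zero_quot[OF quotient_pair] add.commute[of 1])
  qed
  moreover have "rel_boundary \<Delta> \<Gamma> (p + 2) X \<in> carrier (rel_chains \<Delta> \<Gamma> (p + 1))"
    if X: "X \<in> carrier (rel_chains \<Delta> \<Gamma> (p + 2))" for X :: "('n set \<Rightarrow>\<^sub>0 'k) set"
    using linear_mapD(1)[OF linear_map_rel_boundary X] by (simp add: add.commute)
  ultimately show "rel_coboundary \<Delta> \<Gamma> (p + 1) (rel_coboundary \<Delta> \<Gamma> p \<phi>) = \<zero>\<^bsub>rel_cochains \<Delta> \<Gamma> (p + 2)\<^esub>"
    using \<phi>0 by (auto simp: rel_coboundary_def rel_cochains_def add.assoc intro!: ext)
qed

lemma rel_basis_in_rel_chains: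
  assumes "E \<in> faces \<Delta> p"
  shows "(rel_basis \<Delta> \<Gamma> p E :: ('n set \<Rightarrow>\<^sub>0 'k::field) set) \<in> carrier (rel_chains \<Delta> \<Gamma> p)"
  unfolding rel_basis_def
  by (rule coset_in_rel_chains) (use assms in \<open>auto simp: chains_def\<close>)

lemma cochain_coset_linear:
  assumes "\<phi> \<in> carrier (rel_cochains \<Delta> \<Gamma> p)"
  shows "linear_map (chains \<Delta> p) field_module
     (\<lambda>z. \<phi> (carrier (chains \<Gamma> p) +>\<^bsub>chains \<Delta> p\<^esub> z) :: 'k::field)"
proof -
  have \<phi>: "linear_map (rel_chains \<Delta> \<Gamma> p) field_module \<phi>"
    using assms by (simp add: rel_cochains_def)
  note q = module_quotient.add_quot[OF quotient_pair, symmetric, simplified]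
    module_quotient.smult_quot[OF quotient_pair, symmetric, simplified]
  show ?thesis
    by (rule linear_mapI)
      (use linear_mapD(2,3)[OF \<phi>] in \<open>simp_all add: q coset_in_rel_chains flip: rel_chains_def\<close>)
qed

text \<open>
  The faces are indexed by a map \<open>h\<close>, so that the statement covers a chain written over its faces as
  well as the boundary of a face, whose terms are indexed by vertices.
\<close>

lemma linear_form_sum:
  fixes g :: "('n set \<Rightarrow>\<^sub>0 'k::field) \<Rightarrow> 'k"
  assumes g: "linear_map (chains \<Delta> p) field_module g" and A: "\<And>i. i \<in> A \<Longrightarrow> h i \<in> faces \<Delta> p"
  shows "g (\<Sum>i\<in>A. Poly_Mapping.single (h i) (c i)) = (\<Sum>i\<in>A. c i * g (Poly_Mapping.single (h i) 1))"
  using A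
proof (induction A rule: infinite_finite_induct)
  case (insert i A)
  have "(\<Sum>i\<in>A. Poly_Mapping.single (h i) (c i)) \<in> carrier (chains \<Delta> p)"
  proof -
    have "Poly_Mapping.keys (\<Sum>i\<in>A. Poly_Mapping.single (h i) (c i)) \<subseteq>
        (\<Union>i\<in>A. Poly_Mapping.keys (Poly_Mapping.single (h i) (c i)))"
      by (rule keys_sum)
    also have "\<dots> \<subseteq> faces \<Delta> p"
      using insert.prems by (auto split: if_splits)
    finally show ?thesis by (simp add: chains_def)
  qed
  moreover have s: "Poly_Mapping.single (h i) r \<in> carrier (chains \<Delta> p)" for r :: 'k
    using insert.prems by (auto simp: chains_def)
  moreover have "g (Poly_Mapping.single (h i) (c i)) = c i * g (Poly_Mapping.single (h i) 1)"
    using linear_mapD(3)[OF g s[of 1], of "c i"] by simp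
  ultimately show ?case
    using insert linear_mapD(2)[OF g] by simp
qed (use linear_map_zero[OF g is_module_chains is_module_field_module] in simp_all)

lemma cochain_coset_eq_sum:
  fixes z :: "'n set \<Rightarrow>\<^sub>0 'k::field"
  assumes \<phi>: "\<phi> \<in> carrier (rel_cochains \<Delta> \<Gamma> p)" and z: "z \<in> carrier (chains \<Delta> p)"
  shows "\<phi> (carrier (chains \<Gamma> p) +>\<^bsub>chains \<Delta> p\<^esub> z) =
     (\<Sum>E\<in>faces \<Delta> p. Poly_Mapping.lookup z E * \<phi> (rel_basis \<Delta> \<Gamma> p E))"
  by (subst chain_eq_sum[OF z])
     (simp add: linear_form_sum[OF cochain_coset_linear[OF \<phi>]] rel_basis_def)

lemma cochain_rel_basis_subcomplex:
  assumes \<phi>: "\<phi> \<in> carrier (rel_cochains \<Delta> \<Gamma> p)" and E: "E \<in> faces \<Gamma> p"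
  shows "\<phi> (rel_basis \<Delta> \<Gamma> p E) = (0 :: 'k::field)"
proof -
  have m: "Poly_Mapping.single E 1 \<in> carrier (chains \<Gamma> p :: ('k::field, 'n set \<Rightarrow>\<^sub>0 'k) module)"
    using E by (simp add: chains_def)
  have "rel_basis \<Delta> \<Gamma> p E = \<zero>\<^bsub>rel_chains \<Delta> \<Gamma> p :: ('k::field, ('n set \<Rightarrow>\<^sub>0 'k) set) module\<^esub>"
    unfolding rel_basis_def rel_chains_def
    using m chains_mono[OF sub] by (subst module_quotient.coset_eq_zero_iff[OF quotient_pair]) auto
  then show ?thesis
    using linear_map_zero[of "rel_chains \<Delta> \<Gamma> p" field_module \<phi>] \<phi>
    by (auto simp: rel_cochains_def is_module_rel_chains is_module_field_module)
qed

text \<open>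
  The classes of the faces outside \<open>\<Gamma>\<close> span the relative chains, so equality of relative cochains is
  equality of coordinates; all later identities between cochains are proved in this form.
\<close>

lemma cochain_eqI:
  fixes \<phi> \<psi> :: "('n set \<Rightarrow>\<^sub>0 'k::field) set \<Rightarrow> 'k"
  assumes "\<phi> \<in> carrier (rel_cochains \<Delta> \<Gamma> p)" "\<psi> \<in> carrier (rel_cochains \<Delta> \<Gamma> p)"
    and eq: "\<And>E. E \<in> faces (\<Delta> - \<Gamma>) p \<Longrightarrow> \<phi> (rel_basis \<Delta> \<Gamma> p E) = \<psi> (rel_basis \<Delta> \<Gamma> p E)"
  shows "\<phi> = \<psi>"
proof -
  have eq': "\<phi> (rel_basis \<Delta> \<Gamma> p E) = \<psi> (rel_basis \<Delta> \<Gamma> p E)" if "E \<in> faces \<Delta> p" for E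
    using eq[of E] that cochain_rel_basis_subcomplex[OF assms(1), of E]
      cochain_rel_basis_subcomplex[OF assms(2), of E]
    by (cases "E \<in> \<Gamma>") (auto simp: faces_def)
  have "\<phi> X = \<psi> X" if X: "X \<in> carrier (rel_chains \<Delta> \<Gamma> p)" for X
  proof -
    obtain z where z: "z \<in> carrier (chains \<Delta> p)" "X = carrier (chains \<Gamma> p) +>\<^bsub>chains \<Delta> p\<^esub> z"
      using rel_chain_cases[OF X] .
    then show ?thesis
      using assms(1,2) eq' by (simp add: cochain_coset_eq_sum)
  qed
  then show ?thesis
    using assms(1,2) by (auto simp: rel_cochains_def intro: extensionalityI)
qed

text \<open>
  Chains of \<open>\<Gamma>\<close> have coefficient zero at a face outside \<open>\<Gamma>\<close>, so the coefficient at \<open>E\<close> is constant on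
  each coset and \<open>the_elem\<close> picks a determined value.
\<close>

lemma basis_cochain_coset:
  fixes z :: "'n set \<Rightarrow>\<^sub>0 'k::field"
  assumes z: "z \<in> carrier (chains \<Delta> p)" and "E \<notin> \<Gamma>"
  shows "basis_cochain \<Delta> \<Gamma> p E (carrier (chains \<Gamma> p) +>\<^bsub>chains \<Delta> p\<^esub> z) = Poly_Mapping.lookup z E"
proof -
  let ?X = "carrier (chains \<Gamma> p) +>\<^bsub>chains \<Delta> p\<^esub> z"
  have "Poly_Mapping.lookup x E = Poly_Mapping.lookup z E" if x: "x \<in> ?X" for x
  proof -
    obtain n where "n \<in> carrier (chains \<Gamma> p)" "x = n + z"
      using module_quotient.coset_memD[OF quotient_pair z x] by auto
    then show ?thesis
      using assms(2) by (auto simp: lookup_add in_chains_iff faces_def)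
  qed
  then have "(\<lambda>x. Poly_Mapping.lookup x E) ` ?X = (\<lambda>x. Poly_Mapping.lookup z E) ` ?X"
    by (rule image_cong[OF refl])
  also have "\<dots> = {Poly_Mapping.lookup z E}"
    using module_quotient.coset_self[OF quotient_pair z] by auto
  finally have "(\<lambda>x. Poly_Mapping.lookup x E) ` ?X = {Poly_Mapping.lookup z E}" .
  then show ?thesis
    using coset_in_rel_chains[OF z] by (simp add: basis_cochain_def)
qed

lemma cochain_with_values_coset:
  fixes z :: "'n set \<Rightarrow>\<^sub>0 'k::field"
  assumes z: "z \<in> carrier (chains \<Delta> p)"
  shows "cochain_with_values \<Delta> \<Gamma> p v (carrier (chains \<Gamma> p) +>\<^bsub>chains \<Delta> p\<^esub> z) =
    (\<Sum>E\<in>faces (\<Delta> - \<Gamma>) p. v E * Poly_Mapping.lookup z E)"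
  unfolding cochain_with_values_def
  using coset_in_rel_chains[OF z]
  by (simp, intro sum.cong refl) (simp add: faces_def basis_cochain_coset[OF z])

lemma cochain_with_values_in_rel_cochains:
  "cochain_with_values \<Delta> \<Gamma> p v \<in> carrier (rel_cochains \<Delta> \<Gamma> p :: ('k::field, ('n set \<Rightarrow>\<^sub>0 'k) set \<Rightarrow> 'k) module)"
proof -
  note q = module_quotient.add_quot[OF quotient_pair, folded rel_chains_def]
    module_quotient.smult_quot[OF quotient_pair, folded rel_chains_def]
  have "linear_map (rel_chains \<Delta> \<Gamma> p) field_module (cochain_with_values \<Delta> \<Gamma> p v :: _ \<Rightarrow> 'k)"
  proof (rule linear_mapI)
    fix X Y :: "('n set \<Rightarrow>\<^sub>0 'k) set" and r :: 'k
    assume X: "X \<in> carrier (rel_chains \<Delta> \<Gamma> p)"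
    obtain x where x: "x \<in> carrier (chains \<Delta> p)" "X = carrier (chains \<Gamma> p) +>\<^bsub>chains \<Delta> p\<^esub> x"
      using rel_chain_cases[OF X] .
    show "cochain_with_values \<Delta> \<Gamma> p v (r \<odot>\<^bsub>rel_chains \<Delta> \<Gamma> p\<^esub> X) = r \<odot>\<^bsub>field_module\<^esub> cochain_with_values \<Delta> \<Gamma> p v X"
      using x is_moduleD(4)[OF is_module_chains x(1), of r]
      by (simp add: q cochain_with_values_coset lookup_map_scale sum_distrib_left mult.left_commute)
    assume Y: "Y \<in> carrier (rel_chains \<Delta> \<Gamma> p)"
    obtain y where y: "y \<in> carrier (chains \<Delta> p)" "Y = carrier (chains \<Gamma> p) +>\<^bsub>chains \<Delta> p\<^esub> y"
      using rel_chain_cases[OF Y] .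
    show "cochain_with_values \<Delta> \<Gamma> p v (X \<oplus>\<^bsub>rel_chains \<Delta> \<Gamma> p\<^esub> Y) =
       cochain_with_values \<Delta> \<Gamma> p v X \<oplus>\<^bsub>field_module\<^esub> cochain_with_values \<Delta> \<Gamma> p v Y"
      using x y is_moduleD(3)[OF is_module_chains x(1) y(1)]
      by (simp add: q cochain_with_values_coset lookup_add distrib_left sum.distrib)
  qed auto
  then show ?thesis
    by (simp add: rel_cochains_def cochain_with_values_def)
qed

lemma cochain_with_values_rel_basis:
  assumes "D \<in> faces (\<Delta> - \<Gamma>) p"
  shows "cochain_with_values \<Delta> \<Gamma> p v (rel_basis \<Delta> \<Gamma> p D) = (v D :: 'k::field)"
proof -
  have "Poly_Mapping.single D 1 \<in> carrier (chains \<Delta> p :: ('k::field, 'n set \<Rightarrow>\<^sub>0 'k) module)"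
    using assms by (auto simp: chains_def faces_def)
  then show ?thesis
    using assms
    by (simp add: rel_basis_def cochain_with_values_coset lookup_single when_def if_distrib[of "(*) _"]
        cong: if_cong)
qed

lemma rel_coboundary_rel_basis:
  assumes \<phi>: "\<phi> \<in> carrier (rel_cochains \<Delta> \<Gamma> p)" and E: "E \<in> faces \<Delta> (p + 1)"
  shows "rel_coboundary \<Delta> \<Gamma> p \<phi> (rel_basis \<Delta> \<Gamma> (p + 1) E) =
     (\<Sum>j\<in>E. incidence_sign j E * \<phi> (rel_basis \<Delta> \<Gamma> p (E - {j})) :: 'k::field)"
proof -
  have m: "Poly_Mapping.single E 1 \<in> carrier (chains \<Delta> (p + 1) :: ('k::field, 'n set \<Rightarrow>\<^sub>0 'k) module)"
    using E by (simp add: chains_def)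
  have f: "E - {j} \<in> faces \<Delta> p" if "j \<in> E" for j
    using faces_remove_vertex[OF E that] closed E that by (auto simp: faces_def)
  have "rel_coboundary \<Delta> \<Gamma> p \<phi> (rel_basis \<Delta> \<Gamma> (p + 1) E) =
      \<phi> (carrier (chains \<Gamma> p) +>\<^bsub>chains \<Delta> p\<^esub> (\<Sum>j\<in>E. Poly_Mapping.single (E - {j}) (incidence_sign j E)))"
    using rel_basis_in_rel_chains[OF E, where 'k = 'k] rel_boundary_coset[OF m]
    by (simp add: rel_coboundary_def rel_basis_def boundary_single)
  also have "\<dots> = (\<Sum>j\<in>E. incidence_sign j E * \<phi> (rel_basis \<Delta> \<Gamma> p (E - {j})))"
    unfolding rel_basis_def using f
    by (intro linear_form_sum[OF cochain_coset_linear[OF \<phi>]]) simp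
  finally show ?thesis .
qed

end

locale simplicial_pair_inclusion = big: simplicial_pair \<Delta> \<Gamma> + small: simplicial_pair \<Delta>' \<Gamma>'
  for \<Delta> \<Gamma> \<Delta>' \<Gamma>' :: "'n::{finite,linorder} set set" +
  assumes \<Delta>_sub: "\<Delta>' \<subseteq> \<Delta>" and \<Gamma>_sub: "\<Gamma>' \<subseteq> \<Gamma>"
begin

lemma inclusion_chains:
  "linear_map (chains \<Delta>' p) (chains \<Delta> p :: ('k::field, 'n set \<Rightarrow>\<^sub>0 'k) module) (\<lambda>z. z)"
  "(\<lambda>z. z) ` carrier (chains \<Gamma>' p :: ('k, 'n set \<Rightarrow>\<^sub>0 'k) module) \<subseteq> carrier (chains \<Gamma> p)"
  using chains_mono[OF \<Delta>_sub] chains_mono[OF \<Gamma>_sub] by (auto intro!: linear_mapI)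

lemma inclusion_coset:
  fixes z :: "'n set \<Rightarrow>\<^sub>0 'k::field"
  assumes "z \<in> carrier (chains \<Delta>' p)"
  shows "quot_map (chains \<Delta> p) (carrier (chains \<Gamma> p)) (\<lambda>z. z) (carrier (chains \<Gamma>' p) +>\<^bsub>chains \<Delta>' p\<^esub> z) =
     carrier (chains \<Gamma> p) +>\<^bsub>chains \<Delta> p\<^esub> z"
  by (intro quot_map_coset big.quotient_pair small.quotient_pair inclusion_chains assms)

text \<open>Restriction of cochains is the transpose of the map that the inclusions induce on relative chains.\<close>

lemma linear_map_rel_restrict:
  "linear_map (rel_cochains \<Delta> \<Gamma> p) (rel_cochains \<Delta>' \<Gamma>' p)
     (rel_restrict \<Delta> \<Gamma> \<Delta>' \<Gamma>' p :: (('n set \<Rightarrow>\<^sub>0 'k::field) set \<Rightarrow> 'k) \<Rightarrow> _)"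
proof -
  have "linear_map (rel_chains \<Delta>' \<Gamma>' p) (rel_chains \<Delta> \<Gamma> p)
     (quot_map (chains \<Delta> p) (carrier (chains \<Gamma> p :: ('k, 'n set \<Rightarrow>\<^sub>0 'k) module)) (\<lambda>z. z))"
    unfolding rel_chains_def
    by (intro linear_map_quot_map big.quotient_pair small.quotient_pair inclusion_chains)
  then show ?thesis
    unfolding rel_cochains_def rel_restrict_def
    by (intro linear_map_dual big.is_module_rel_chains small.is_module_rel_chains)
qed

lemma rel_restrict_rel_basis:
  assumes "E \<in> faces \<Delta>' p"
  shows "rel_restrict \<Delta> \<Gamma> \<Delta>' \<Gamma>' p \<phi> (rel_basis \<Delta>' \<Gamma>' p E) = (\<phi> (rel_basis \<Delta> \<Gamma> p E) :: 'k::field)"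
proof -
  have "Poly_Mapping.single E 1 \<in> carrier (chains \<Delta>' p :: ('k::field, 'n set \<Rightarrow>\<^sub>0 'k) module)"
    using assms by (simp add: chains_def)
  then show ?thesis
    using small.rel_basis_in_rel_chains[OF assms, where 'k = 'k]
    by (simp add: rel_restrict_def rel_basis_def inclusion_coset)
qed

lemma cochain_map_rel_restrict:
  "cochain_map (rel_cochains \<Delta> \<Gamma>) (rel_coboundary \<Delta> \<Gamma>)
     (rel_cochains \<Delta>' \<Gamma>' :: int \<Rightarrow> ('k::field, ('n set \<Rightarrow>\<^sub>0 'k) set \<Rightarrow> 'k) module) (rel_coboundary \<Delta>' \<Gamma>') 0
     (rel_restrict \<Delta> \<Gamma> \<Delta>' \<Gamma>')"
  unfolding cochain_map_def
proof (intro allI conjI ballI)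
  fix p
  show "linear_map (rel_cochains \<Delta> \<Gamma> p) (rel_cochains \<Delta>' \<Gamma>' (p - 0))
     (rel_restrict \<Delta> \<Gamma> \<Delta>' \<Gamma>' p :: (('n set \<Rightarrow>\<^sub>0 'k::field) set \<Rightarrow> 'k) \<Rightarrow> _)"
    using linear_map_rel_restrict by simp
  fix \<phi> :: "('n set \<Rightarrow>\<^sub>0 'k::field) set \<Rightarrow> 'k" assume \<phi>: "\<phi> \<in> carrier (rel_cochains \<Delta> \<Gamma> p)"
  note c = cochain_complexD(2)[OF big.cochain_complex_rel_cochains]
    cochain_complexD(2)[OF small.cochain_complex_rel_cochains]
  have r: "rel_restrict \<Delta> \<Gamma> \<Delta>' \<Gamma>' p \<phi> \<in> carrier (rel_cochains \<Delta>' \<Gamma>' p)"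
    using linear_mapD(1)[OF linear_map_rel_restrict \<phi>] .
  show "rel_restrict \<Delta> \<Gamma> \<Delta>' \<Gamma>' (p + 1) (rel_coboundary \<Delta> \<Gamma> p \<phi>) =
      rel_coboundary \<Delta>' \<Gamma>' (p - 0) (rel_restrict \<Delta> \<Gamma> \<Delta>' \<Gamma>' p \<phi>)"
    unfolding diff_zero
  proof (rule small.cochain_eqI)
    show "rel_restrict \<Delta> \<Gamma> \<Delta>' \<Gamma>' (p + 1) (rel_coboundary \<Delta> \<Gamma> p \<phi>) \<in> carrier (rel_cochains \<Delta>' \<Gamma>' (p + 1))"
      by (intro linear_mapD(1)[OF linear_map_rel_restrict] linear_mapD(1)[OF c(1)] \<phi>)
    show "rel_coboundary \<Delta>' \<Gamma>' p (rel_restrict \<Delta> \<Gamma> \<Delta>' \<Gamma>' p \<phi>) \<in> carrier (rel_cochains \<Delta>' \<Gamma>' (p + 1))"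
      by (intro linear_mapD(1)[OF c(2)] r)
    fix E assume "E \<in> faces (\<Delta>' - \<Gamma>') (p + 1)"
    then have E: "E \<in> faces \<Delta>' (p + 1)" "E \<in> faces \<Delta> (p + 1)"
      using \<Delta>_sub by (auto simp: faces_def)
    have "E - {j} \<in> faces \<Delta>' p" if "j \<in> E" for j
      using faces_remove_vertex[OF E(1) that] small.closed E(1) that by (auto simp: faces_def)
    then show "rel_restrict \<Delta> \<Gamma> \<Delta>' \<Gamma>' (p + 1) (rel_coboundary \<Delta> \<Gamma> p \<phi>) (rel_basis \<Delta>' \<Gamma>' (p + 1) E) =
        rel_coboundary \<Delta>' \<Gamma>' p (rel_restrict \<Delta> \<Gamma> \<Delta>' \<Gamma>' p \<phi>) (rel_basis \<Delta>' \<Gamma>' (p + 1) E)"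
      by (simp add: rel_restrict_rel_basis E small.rel_coboundary_rel_basis r
          big.rel_coboundary_rel_basis \<phi>)
  qed
qed

end

section \<open>Localization at one element\<close>

locale localized_module =
  fixes M :: "('r::comm_ring_1, 'm) module" and f :: 'r
  assumes M: "is_module M"
begin

lemma power_smult:
  "m \<in> carrier M \<Longrightarrow> f ^ s \<odot>\<^bsub>M\<^esub> (f ^ t \<odot>\<^bsub>M\<^esub> m) = f ^ (s + t) \<odot>\<^bsub>M\<^esub> m"
  by (simp add: power_add is_moduleD(7)[OF M])

text \<open>
  Equality of fractions is the relation by which \<open>fraction\<close> is defined, because that relation is an
  equivalence.  Transitivity multiplies the two given identities up to the common power
  \<open>s + s' + t\<^sub>2\<close>, where \<open>t\<^sub>2\<close> is the middle denominator.
\<close>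

lemma fraction_eq_iff:
  assumes m: "m \<in> carrier M" "m' \<in> carrier M"
  shows "fraction M f m t = fraction M f m' t' \<longleftrightarrow>
     (\<exists>s. f ^ (s + t') \<odot>\<^bsub>M\<^esub> m = f ^ (s + t) \<odot>\<^bsub>M\<^esub> m')"
proof
  assume "fraction M f m t = fraction M f m' t'"
  moreover have "(m', t') \<in> fraction M f m' t'"
    using m by (auto simp: fraction_def)
  ultimately have "(m', t') \<in> fraction M f m t"
    by simp
  then show "\<exists>s. f ^ (s + t') \<odot>\<^bsub>M\<^esub> m = f ^ (s + t) \<odot>\<^bsub>M\<^esub> m'"
    by (auto simp: fraction_def)
next
  have trans: "\<exists>s. f ^ (s + t3) \<odot>\<^bsub>M\<^esub> m1 = f ^ (s + t1) \<odot>\<^bsub>M\<^esub> m3"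
    if "m1 \<in> carrier M" "m2 \<in> carrier M" "m3 \<in> carrier M"
      and 12: "f ^ (s + t2) \<odot>\<^bsub>M\<^esub> m1 = f ^ (s + t1) \<odot>\<^bsub>M\<^esub> m2"
      and 23: "f ^ (s' + t3) \<odot>\<^bsub>M\<^esub> m2 = f ^ (s' + t2) \<odot>\<^bsub>M\<^esub> m3"
    for m1 m2 m3 t1 t2 t3 s s'
  proof -
    have "f ^ (s + s' + t2 + t3) \<odot>\<^bsub>M\<^esub> m1 = f ^ (s' + t3) \<odot>\<^bsub>M\<^esub> (f ^ (s + t2) \<odot>\<^bsub>M\<^esub> m1)"
      using that(1-3) by (simp add: power_smult add_ac)
    also have "\<dots> = f ^ (s + t1) \<odot>\<^bsub>M\<^esub> (f ^ (s' + t3) \<odot>\<^bsub>M\<^esub> m2)"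
      unfolding 12 using that(1-3) by (simp add: power_smult add_ac)
    also have "\<dots> = f ^ (s + s' + t2 + t1) \<odot>\<^bsub>M\<^esub> m3"
      unfolding 23 using that(1-3) by (simp add: power_smult add_ac)
    finally show ?thesis by blast
  qed
  assume "\<exists>s. f ^ (s + t') \<odot>\<^bsub>M\<^esub> m = f ^ (s + t) \<odot>\<^bsub>M\<^esub> m'"
  then obtain s where s: "f ^ (s + t') \<odot>\<^bsub>M\<^esub> m = f ^ (s + t) \<odot>\<^bsub>M\<^esub> m'" ..
  show "fraction M f m t = fraction M f m' t'"
    unfolding fraction_def using m trans[OF _ _ _ s] trans[OF _ _ _ s[symmetric]] by blast
qed

lemma fraction_self: "m \<in> carrier M \<Longrightarrow> (m, t) \<in> fraction M f m t"
  by (auto simp: fraction_def)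

lemma fraction_memD:
  assumes "(m', t') \<in> fraction M f m t" "m \<in> carrier M"
  shows "m' \<in> carrier M" "fraction M f m' t' = fraction M f m t"
  using assms fraction_eq_iff[of m m' t t'] by (auto simp: fraction_def)

text \<open>
  The operations on a localization are unions over all representatives; such a union collapses
  as soon as its terms do not depend on the representative.
\<close>

lemma UN_fraction:
  assumes "m \<in> carrier M"
    and "\<And>m' t'. m' \<in> carrier M \<Longrightarrow> fraction M f m' t' = fraction M f m t \<Longrightarrow> g m' t' = y"
  shows "(\<Union>(m', t')\<in>fraction M f m t. g m' t') = y"
  using assms(2)[OF fraction_memD[OF _ assms(1)]] fraction_self[OF assms(1), of t] by fastforce

lemma fraction_scale:
  "m \<in> carrier M \<Longrightarrow> fraction M f (f ^ u \<odot>\<^bsub>M\<^esub> m) (u + t) = fraction M f m t"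
  by (subst fraction_eq_iff) (auto simp: is_moduleD(4)[OF M] power_smult add_ac)

lemma zero_localization: "\<zero>\<^bsub>localization M f\<^esub> = fraction M f \<zero>\<^bsub>M\<^esub> 0"
  by (simp add: localization_def)

lemma fraction_zero: "fraction M f \<zero>\<^bsub>M\<^esub> t = \<zero>\<^bsub>localization M f\<^esub>"
  unfolding zero_localization
  by (subst fraction_eq_iff) (auto simp: is_moduleD(2,10)[OF M])

lemma fraction_eq_zero_iff:
  assumes "m \<in> carrier M"
  shows "fraction M f m t = \<zero>\<^bsub>localization M f\<^esub> \<longleftrightarrow> (\<exists>s. f ^ s \<odot>\<^bsub>M\<^esub> m = \<zero>\<^bsub>M\<^esub>)"
  unfolding zero_localization using assms
  by (subst fraction_eq_iff) (auto simp: is_moduleD(2,10)[OF M])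

lemma carrier_localization:
  "carrier (localization M f) = {fraction M f m t | m t. m \<in> carrier M}"
  by (simp add: localization_def)

lemma smult_fraction:
  assumes "m \<in> carrier M"
  shows "r \<odot>\<^bsub>localization M f\<^esub> fraction M f m t = fraction M f (r \<odot>\<^bsub>M\<^esub> m) t"
proof -
  have "fraction M f (r \<odot>\<^bsub>M\<^esub> m') t' = fraction M f (r \<odot>\<^bsub>M\<^esub> m) t"
    if m': "m' \<in> carrier M" and eq: "fraction M f m' t' = fraction M f m t" for m' t'
  proof -
    obtain s where s: "f ^ (s + t) \<odot>\<^bsub>M\<^esub> m' = f ^ (s + t') \<odot>\<^bsub>M\<^esub> m"
      using eq fraction_eq_iff[OF m' assms] by auto
    have "f ^ (s + t) \<odot>\<^bsub>M\<^esub> (r \<odot>\<^bsub>M\<^esub> m') = r \<odot>\<^bsub>M\<^esub> (f ^ (s + t) \<odot>\<^bsub>M\<^esub> m')"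
      using m' by (simp add: mult.commute flip: is_moduleD(7)[OF M])
    also have "\<dots> = f ^ (s + t') \<odot>\<^bsub>M\<^esub> (r \<odot>\<^bsub>M\<^esub> m)"
      unfolding s using assms by (simp add: mult.commute flip: is_moduleD(7)[OF M])
    finally show ?thesis
      using m' assms by (subst fraction_eq_iff) (auto simp: is_moduleD(4)[OF M])
  qed
  then show ?thesis
    unfolding localization_def make_module_simps by (intro UN_fraction assms)
qed

lemma add_fraction:
  assumes m: "m \<in> carrier M" "n \<in> carrier M"
  shows "fraction M f m t \<oplus>\<^bsub>localization M f\<^esub> fraction M f n t = fraction M f (m \<oplus>\<^bsub>M\<^esub> n) t"
proof -
  note D = is_moduleD(3,4)[OF M]
  have "fraction M f (f ^ u \<odot>\<^bsub>M\<^esub> m' \<oplus>\<^bsub>M\<^esub> f ^ t' \<odot>\<^bsub>M\<^esub> n') (t' + u) = fraction M f (m \<oplus>\<^bsub>M\<^esub> n) t"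
    if m': "m' \<in> carrier M" "fraction M f m' t' = fraction M f m t"
      and n': "n' \<in> carrier M" "fraction M f n' u = fraction M f n t" for m' t' n' u
  proof -
    obtain s where s: "f ^ (s + t) \<odot>\<^bsub>M\<^esub> m' = f ^ (s + t') \<odot>\<^bsub>M\<^esub> m"
      using m' fraction_eq_iff[OF m'(1) m(1)] by auto
    obtain s' where s': "f ^ (s' + t) \<odot>\<^bsub>M\<^esub> n' = f ^ (s' + u) \<odot>\<^bsub>M\<^esub> n"
      using n' fraction_eq_iff[OF n'(1) m(2)] by auto
    have "f ^ (s + s' + t) \<odot>\<^bsub>M\<^esub> (f ^ u \<odot>\<^bsub>M\<^esub> m' \<oplus>\<^bsub>M\<^esub> f ^ t' \<odot>\<^bsub>M\<^esub> n') =
        f ^ (s' + u) \<odot>\<^bsub>M\<^esub> (f ^ (s + t) \<odot>\<^bsub>M\<^esub> m') \<oplus>\<^bsub>M\<^esub> f ^ (s + t') \<odot>\<^bsub>M\<^esub> (f ^ (s' + t) \<odot>\<^bsub>M\<^esub> n')"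
      using m' n' by (simp add: is_moduleD(6)[OF M] D power_smult add_ac)
    also have "\<dots> = f ^ (s + s' + (t' + u)) \<odot>\<^bsub>M\<^esub> (m \<oplus>\<^bsub>M\<^esub> n)"
      unfolding s s' using m by (simp add: is_moduleD(6)[OF M] D power_smult add_ac)
    finally show ?thesis
      using m' n' m by (subst fraction_eq_iff) (auto simp: D)
  qed
  then show ?thesis
    unfolding localization_def make_module_simps
    by (intro UN_fraction m) auto
qed

lemma localization_cases:
  assumes "x \<in> carrier (localization M f)"
  obtains m t where "m \<in> carrier M" "x = fraction M f m t"
  using assms by (auto simp: carrier_localization)

text \<open>
  With a common denominator, addition of fractions is addition of numerators, which
  reduces the module axioms of the localization to those of \<open>M\<close>.
\<close>

lemma common_denominator:
  assumes "x \<in> carrier (localization M f)" "y \<in> carrier (localization M f)"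
  obtains m n t where "m \<in> carrier M" "n \<in> carrier M" "x = fraction M f m t" "y = fraction M f n t"
proof -
  obtain m t n u where "m \<in> carrier M" "x = fraction M f m t" "n \<in> carrier M" "y = fraction M f n u"
    using assms localization_cases by metis
  then show ?thesis
    using that[of "f ^ u \<odot>\<^bsub>M\<^esub> m" "f ^ t \<odot>\<^bsub>M\<^esub> n" "u + t"] fraction_scale[of m u t] fraction_scale[of n t u]
    by (simp add: is_moduleD(4)[OF M] add.commute)
qed

lemma fraction_in_localization: "m \<in> carrier M \<Longrightarrow> fraction M f m t \<in> carrier (localization M f)"
  by (auto simp: carrier_localization)

lemma is_module_localization: "is_module (localization M f)"
proof -
  note D = is_moduleD[OF M]
  note ops = add_fraction smult_fraction fraction_in_localization
  show ?thesis
  proof (rule is_moduleI)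
    show "\<zero>\<^bsub>localization M f\<^esub> \<in> carrier (localization M f)"
      by (simp add: zero_localization fraction_in_localization D)
    fix x assume x: "x \<in> carrier (localization M f)"
    then obtain m t where m: "m \<in> carrier M" "x = fraction M f m t"
      by (rule localization_cases)
    show "\<zero>\<^bsub>localization M f\<^esub> \<oplus>\<^bsub>localization M f\<^esub> x = x"
      using m by (simp add: ops D flip: fraction_zero[of t])
    show "0 \<odot>\<^bsub>localization M f\<^esub> x = \<zero>\<^bsub>localization M f\<^esub>" "1 \<odot>\<^bsub>localization M f\<^esub> x = x"
      using m by (simp_all add: ops D fraction_zero)
    fix r s
    show "r \<odot>\<^bsub>localization M f\<^esub> x \<in> carrier (localization M f)"
      "(r + s) \<odot>\<^bsub>localization M f\<^esub> x =
        r \<odot>\<^bsub>localization M f\<^esub> x \<oplus>\<^bsub>localization M f\<^esub> s \<odot>\<^bsub>localization M f\<^esub> x"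
      "(r * s) \<odot>\<^bsub>localization M f\<^esub> x = r \<odot>\<^bsub>localization M f\<^esub> (s \<odot>\<^bsub>localization M f\<^esub> x)"
      using m by (simp_all add: ops D(2-12))
    fix y assume y: "y \<in> carrier (localization M f)"
    obtain m n t where mn: "m \<in> carrier M" "n \<in> carrier M" "x = fraction M f m t" "y = fraction M f n t"
      using x y by (rule common_denominator)
    show "x \<oplus>\<^bsub>localization M f\<^esub> y \<in> carrier (localization M f)"
      "r \<odot>\<^bsub>localization M f\<^esub> (x \<oplus>\<^bsub>localization M f\<^esub> y) =
        r \<odot>\<^bsub>localization M f\<^esub> x \<oplus>\<^bsub>localization M f\<^esub> r \<odot>\<^bsub>localization M f\<^esub> y"
      using mn by (simp_all add: ops D(2-12))
    show "x \<oplus>\<^bsub>localization M f\<^esub> y = y \<oplus>\<^bsub>localization M f\<^esub> x"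
      using mn by (simp add: ops D(13)[of m n])
    fix z assume "z \<in> carrier (localization M f)"
    then obtain k u where k: "k \<in> carrier M" "z = fraction M f k u"
      by (rule localization_cases)
    let ?m = "f ^ u \<odot>\<^bsub>M\<^esub> m" and ?n = "f ^ u \<odot>\<^bsub>M\<^esub> n" and ?k = "f ^ t \<odot>\<^bsub>M\<^esub> k"
    have "x = fraction M f ?m (u + t)" "y = fraction M f ?n (u + t)" "z = fraction M f ?k (u + t)"
      using mn k fraction_scale[of m u t] fraction_scale[of n u t] fraction_scale[of k t u]
      by (simp_all add: add.commute)
    then show "x \<oplus>\<^bsub>localization M f\<^esub> y \<oplus>\<^bsub>localization M f\<^esub> z =
        x \<oplus>\<^bsub>localization M f\<^esub> (y \<oplus>\<^bsub>localization M f\<^esub> z)"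
      using mn(1,2) k(1) by (simp add: ops D(3,4) D(14))
  qed
qed

lemma loc_map_fraction:
  assumes m: "m \<in> carrier M"
  shows "loc_map M f g (fraction M f m t) = fraction M (f * g) (g ^ t \<odot>\<^bsub>M\<^esub> m) t"
  unfolding loc_map_def
proof (rule UN_fraction[OF m])
  fix m' t' assume m': "m' \<in> carrier M" "fraction M f m' t' = fraction M f m t"
  interpret L: localized_module M "f * g"
    by (rule localized_module.intro[OF M])
  obtain s where s: "f ^ (s + t) \<odot>\<^bsub>M\<^esub> m' = f ^ (s + t') \<odot>\<^bsub>M\<^esub> m"
    using m' fraction_eq_iff[OF m'(1) m] by auto
  have "(f * g) ^ (s + t) \<odot>\<^bsub>M\<^esub> (g ^ t' \<odot>\<^bsub>M\<^esub> m') = g ^ (s + t + t') \<odot>\<^bsub>M\<^esub> (f ^ (s + t) \<odot>\<^bsub>M\<^esub> m')"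
    using m' by (simp add: power_mult_distrib power_add mult_ac flip: is_moduleD(7)[OF M])
  also have "\<dots> = (f * g) ^ (s + t') \<odot>\<^bsub>M\<^esub> (g ^ t \<odot>\<^bsub>M\<^esub> m)"
    unfolding s using m by (simp add: power_mult_distrib power_add mult_ac flip: is_moduleD(7)[OF M])
  finally show "fraction M (f * g) (g ^ t' \<odot>\<^bsub>M\<^esub> m') t' = fraction M (f * g) (g ^ t \<odot>\<^bsub>M\<^esub> m) t"
    using m m' by (subst L.fraction_eq_iff) (auto simp: is_moduleD(4)[OF M])
qed

lemma linear_map_loc_map:
  "linear_map (localization M f) (localization M (f * g)) (loc_map M f g)"
proof -
  interpret L: localized_module M "f * g"
    by (rule localized_module.intro[OF M])
  note D = is_moduleD(3,4)[OF M]
  show ?thesis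
  proof (rule linear_mapI)
    fix x r assume x: "x \<in> carrier (localization M f)"
    then obtain m t where m: "m \<in> carrier M" "x = fraction M f m t"
      by (rule localization_cases)
    show "loc_map M f g x \<in> carrier (localization M (f * g))"
      using m by (simp add: loc_map_fraction L.fraction_in_localization D)
    show "loc_map M f g (r \<odot>\<^bsub>localization M f\<^esub> x) = r \<odot>\<^bsub>localization M (f * g)\<^esub> loc_map M f g x"
      using m by (simp add: loc_map_fraction smult_fraction L.smult_fraction D mult.commute
          flip: is_moduleD(7)[OF M])
    fix y assume y: "y \<in> carrier (localization M f)"
    obtain m n t where mn: "m \<in> carrier M" "n \<in> carrier M" "x = fraction M f m t" "y = fraction M f n t"
      using x y by (rule common_denominator)
    then show "loc_map M f g (x \<oplus>\<^bsub>localization M f\<^esub> y) =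
        loc_map M f g x \<oplus>\<^bsub>localization M (f * g)\<^esub> loc_map M f g y"
      by (simp add: loc_map_fraction add_fraction L.add_fraction D is_moduleD(6)[OF M])
  qed
qed

end

section \<open>Monomials and degree complexes\<close>

lemma poly_ring_eq: "poly_ring = scalar_ring"
  by (simp add: poly_ring_def scalar_ring_def)

lemma xpow_mult: "xpow e * xpow e' = xpow (e + e')"
  by (simp add: xpow_def mult_single)

lemma xF_power: "xF F ^ t = xpow (\<lambda>i. t * of_bool (i \<in> F))"
proof (induction t)
  case 0
  then show ?case by (simp add: xpow_def flip: single_one zero_fun_def)
next
  case (Suc t)
  have "(\<lambda>i. of_bool (i \<in> F)) + (\<lambda>i. t * of_bool (i \<in> F)) = (\<lambda>i. Suc t * of_bool (i \<in> F))"
    by auto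
  then show ?case
    using Suc by (simp add: xF_def xpow_mult)
qed

lemma const_mult_xpow: "const r * xpow e = Poly_Mapping.single e r"
  by (simp add: const_def xpow_def mult_single)

lemma const_hom:
  "const (r + s) = const r + const s" "const (r * s) = const r * const s" "const 0 = 0"
  "const 1 = 1" "const (- r) = - const r"
  by (simp_all add: const_def single_add mult_single single_uminus)

lemma const_minus_one_power: "const ((- 1) ^ m) = (- 1) ^ m"
  by (induction m) (simp_all add: const_hom)

lemma const_incidence_sign: "incidence_sign j F = const (incidence_sign j F)"
  by (simp add: incidence_sign_def const_minus_one_power)

lemma ideal_simps:
  assumes "ideal K poly_ring"
  shows "0 \<in> K" "p \<in> K \<Longrightarrow> p' \<in> K \<Longrightarrow> p + p' \<in> K" "p \<in> K \<Longrightarrow> s * p \<in> K" "p \<in> K \<Longrightarrow> - p \<in> K"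
proof -
  interpret ideal K poly_ring by fact
  show "0 \<in> K" "p \<in> K \<Longrightarrow> p' \<in> K \<Longrightarrow> p + p' \<in> K"
    using additive_subgroup.zero_closed[OF ideal.axioms(1)[OF assms]]
      additive_subgroup.a_closed[OF ideal.axioms(1)[OF assms], of p p'] by (simp_all add: poly_ring_eq)
  show "p \<in> K \<Longrightarrow> s * p \<in> K" for s
    using I_l_closed[of p s] by (simp add: poly_ring_eq)
  from this[of "- 1"] show "p \<in> K \<Longrightarrow> - p \<in> K" by simp
qed

lemma ideal_monomial_ideal:
  assumes "monomial_ideal K"
  shows "ideal K poly_ring"
proof -
  interpret ring "poly_ring :: ('a, 'b) polyS ring"
    unfolding poly_ring_eq by (rule cring.axioms(1)[OF cring_scalar_ring])
  show ?thesis
    using assms genideal_ideal by (auto simp: monomial_ideal_def poly_ring_eq)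
qed

lemma single_in_ideal_iff:
  assumes "ideal K poly_ring"
  shows "Poly_Mapping.single e r \<in> K \<longleftrightarrow> r = 0 \<or> xpow e \<in> K"
proof (cases "r = 0")
  case False
  have "Poly_Mapping.single e r = const r * xpow e" "xpow e = const (inverse r) * Poly_Mapping.single e r"
    using False by (simp_all add: const_mult_xpow const_def xpow_def mult_single)
  then show ?thesis
    using False ideal_simps(3)[OF assms] by metis
qed (simp add: ideal_simps[OF assms])

lemma xpow_in_ideal_mono:
  assumes "ideal K poly_ring" "xpow e \<in> K" "e \<le> e'"
  shows "xpow e' \<in> K"
proof -
  have "e' = (e' - e) + e"
    using assms(3) by (auto simp: le_fun_def)
  then show ?thesis
    using ideal_simps(3)[OF assms(1,2), of "xpow (e' - e)"] by (simp add: xpow_mult)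
qed

text \<open>
  Below an exponent of \<open>K\<close> there is a minimal one: passing to a smaller exponent lowers the total
  degree.
\<close>

lemma xpow_in_ideal_iff_min_gens:
  fixes K :: "('n::finite, 'k::field) polyS set"
  assumes "ideal K poly_ring"
  shows "xpow e \<in> K \<longleftrightarrow> (\<exists>c\<in>min_gens K. c \<le> e)"
proof
  assume "xpow e \<in> K"
  then show "\<exists>c\<in>min_gens K. c \<le> e"
  proof (induction "\<Sum>i\<in>UNIV. e i" arbitrary: e rule: less_induct)
    case less
    show ?case
    proof (cases "e \<in> min_gens K")
      case False
      then obtain c where c: "xpow c \<in> K" "c \<le> e" "c \<noteq> e"
        using less.prems by (auto simp: min_gens_def)
      then obtain i where "c i < e i"
        by (metis le_fun_def le_neq_implies_less ext)
      then have "(\<Sum>i\<in>UNIV. c i) < (\<Sum>i\<in>UNIV. e i)"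
        using c(2) by (intro sum_strict_mono_ex1) (auto simp: le_fun_def)
      then show ?thesis
        using less.hyps c order_trans by blast
    qed auto
  qed
next
  assume "\<exists>c\<in>min_gens K. c \<le> e"
  then show "xpow e \<in> K"
    using xpow_in_ideal_mono[OF assms] by (auto simp: min_gens_def)
qed

text \<open>
  \<open>mono_in K a F\<close> says that \<open>x\<^sup>a\<close>, multiplied by some power of \<open>x\<^sub>F\<close>, is a monomial of
  \<open>K\<close>, in other words that \<open>x\<^sup>a\<close> lies in the localization of \<open>K\<close> at \<open>x\<^sub>F\<close>.  This condition links the
  Cech complex with the degree complexes: for \<open>F = G\<^sub>a \<union> E\<close>, a disjoint union, it expresses \<open>E \<notin> \<Delta>\<^sub>a(K)\<close>.
\<close>

definition mono_in :: "('n, 'k::field) polyS set \<Rightarrow> ('n \<Rightarrow> int) \<Rightarrow> 'n set \<Rightarrow> bool" where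
  "mono_in K a F \<longleftrightarrow> (\<exists>e t. (\<lambda>i. int (e i)) = add_eF a t F \<and> xpow e \<in> K)"

lemma int_exponent_inject: "(\<lambda>i. int (e i)) = (\<lambda>i. int (e' i)) \<longleftrightarrow> e = e'"
  by (auto simp: fun_eq_iff)

lemma exponent_shift:
  assumes "(\<lambda>i. int (e i)) = add_eF a t F"
  shows "(\<lambda>i. int ((e + (\<lambda>i. s * of_bool (i \<in> F))) i)) = add_eF a (s + t) F"
  using assms by (auto simp: add_eF_def fun_eq_iff algebra_simps)

text \<open>
  Multiplying by \<open>x\<^sub>F\<close> raises exactly the exponents in \<open>F\<close>.  So the exponents outside \<open>F\<close> must be
  nonnegative and dominate a minimal generator from the start, while those in \<open>F\<close> do so eventually.
\<close>

lemma mono_in_iff_min_gens: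
  fixes K :: "('n::finite, 'k::field) polyS set"
  assumes K: "ideal K poly_ring"
  shows "mono_in K a F \<longleftrightarrow> neg_supp a \<subseteq> F \<and> (\<exists>c\<in>min_gens K. \<forall>i. i \<notin> F \<longrightarrow> int (c i) \<le> a i)"
proof
  assume "mono_in K a F"
  then obtain e t c where e: "(\<lambda>i. int (e i)) = add_eF a t F" and c: "c \<in> min_gens K" "c \<le> e"
    by (auto simp: mono_in_def xpow_in_ideal_iff_min_gens[OF K])
  have *: "int (e i) = a i" if "i \<notin> F" for i
    using fun_cong[OF e, of i] that by (simp add: add_eF_def)
  then have "neg_supp a \<subseteq> F"
    by (force simp: neg_supp_def)
  moreover have "int (c i) \<le> a i" if "i \<notin> F" for i
    using *[OF that] c(2) by (metis le_fun_def of_nat_mono)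
  ultimately show "neg_supp a \<subseteq> F \<and> (\<exists>c\<in>min_gens K. \<forall>i. i \<notin> F \<longrightarrow> int (c i) \<le> a i)"
    using c by blast
next
  assume "neg_supp a \<subseteq> F \<and> (\<exists>c\<in>min_gens K. \<forall>i. i \<notin> F \<longrightarrow> int (c i) \<le> a i)"
  then obtain c where G: "neg_supp a \<subseteq> F" and c: "c \<in> min_gens K" "\<And>i. i \<notin> F \<Longrightarrow> int (c i) \<le> a i"
    by blast
  \<comment> \<open>a single power of \<open>x\<^sub>F\<close> that lifts every exponent in \<open>F\<close> above the generator\<close>
  define t where "t = (\<Sum>i\<in>UNIV. nat \<bar>a i\<bar> + c i)"
  have t: "int (c i) \<le> a i + int t" for i
  proof -
    have "nat \<bar>a i\<bar> + c i \<le> t"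
      unfolding t_def by (rule member_le_sum) auto
    then show ?thesis by linarith
  qed
  define e where "e = (\<lambda>i. nat (add_eF a t F i))"
  have "int (c i) \<le> add_eF a t F i" for i
    using t[of i] c(2)[of i] by (cases "i \<in> F") (auto simp: add_eF_def)
  then have "int (e i) = add_eF a t F i \<and> c i \<le> e i" for i
    unfolding e_def by (metis int_nat_eq nat_int nat_mono of_nat_0_le_iff order_trans)
  then have "(\<lambda>i. int (e i)) = add_eF a t F" "c \<le> e"
    by (auto simp: le_fun_def)
  then show "mono_in K a F"
    using c(1) xpow_in_ideal_iff_min_gens[OF K] by (auto simp: mono_in_def)
qed

lemma mem_degree_complex_iff:
  fixes K :: "('n::finite, 'k::field) polyS set"
  assumes "ideal K poly_ring"
  shows "E \<in> degree_complex a K \<longleftrightarrow> E \<inter> neg_supp a = {} \<and> \<not> mono_in K a (neg_supp a \<union> E)"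
  unfolding degree_complex_def mono_in_iff_min_gens[OF assms]
  by (auto simp: not_le Un_commute)

lemma mono_in_mono:
  assumes "J \<subseteq> I" "mono_in J a F"
  shows "mono_in I a F"
  using assms by (auto simp: mono_in_def)

lemma mono_in_supset:
  fixes K :: "('n::finite, 'k::field) polyS set"
  assumes "ideal K poly_ring" "F \<subseteq> F'" "mono_in K a F"
  shows "mono_in K a F'"
  using assms unfolding mono_in_iff_min_gens[OF assms(1)] by blast

lemma mono_in_shift_deg:
  assumes "ideal K poly_ring" "mono_in K a F"
  shows "mono_in K (shift_deg a b) F"
proof -
  obtain e t where e: "(\<lambda>i. int (e i)) = add_eF a t F" "xpow e \<in> K"
    using assms by (auto simp: mono_in_def)
  have "(\<lambda>i. int ((e + b) i)) = add_eF (shift_deg a b) t F"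
    using e(1) by (auto simp: fun_eq_iff add_eF_def shift_deg_def)
  moreover have "xpow (e + b) \<in> K"
    using xpow_in_ideal_mono[OF assms(1) e(2)] by (auto simp: le_fun_def)
  ultimately show ?thesis
    unfolding mono_in_def by blast
qed

text \<open>
  The bound \<open>u\<close> comes from one monomial of \<open>K\<close> of exponent \<open>a + u e\<^sub>F\<close>, which divides all those with a
  larger multiple of \<open>e\<^sub>F\<close>.
\<close>

lemma mono_inD:
  assumes "ideal K poly_ring" "mono_in K a F"
  obtains u where "\<And>e t. (\<lambda>i. int (e i)) = add_eF a t F \<Longrightarrow> u \<le> t \<Longrightarrow> xpow e \<in> K"
proof -
  obtain e u where e: "(\<lambda>i. int (e i)) = add_eF a u F" "xpow e \<in> K"
    using assms by (auto simp: mono_in_def)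
  have "xpow e' \<in> K" if "(\<lambda>i. int (e' i)) = add_eF a t F" "u \<le> t" for e' t
  proof -
    have "e' = e + (\<lambda>i. (t - u) * of_bool (i \<in> F))"
      using exponent_shift[OF e(1), of "t - u"] that by (metis int_exponent_inject le_add_diff_inverse2)
    then show ?thesis
      using xpow_in_ideal_mono[OF assms(1) e(2)] by (auto simp: le_fun_def)
  qed
  then show ?thesis by (rule that)
qed

section \<open>The localizations of \<open>I/J\<close> in a fixed degree\<close>

locale ideal_pair =
  fixes I J :: "('n::{finite,linorder}, 'k::field) polyS set"
  assumes I: "ideal I poly_ring" and J: "ideal J poly_ring" and JI: "J \<subseteq> I"
begin

abbreviation M where "M \<equiv> ideal_quot I J"
abbreviation D where "D \<equiv> ideal_quot_degree I J"
abbreviation L where "L F \<equiv> localization (ideal_quot I J) (xF F)"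
abbreviation cls where "cls p \<equiv> J +>\<^bsub>ideal_module I\<^esub> p"

text \<open>
  \<open>x\<^sup>a\<close> lies in the localization of \<open>I\<close> at \<open>x\<^sub>F\<close> but not in that of \<open>J\<close>; these are the \<open>F\<close> for which
  \<open>((I/J)\<^bsub>x\<^sub>F\<^esub>)\<^sub>a\<close> is nonzero.
\<close>

definition live :: "('n \<Rightarrow> int) \<Rightarrow> 'n set \<Rightarrow> bool" where
  "live a F \<longleftrightarrow> mono_in I a F \<and> \<not> mono_in J a F"

lemma ideal_module_simps [simp]:
  "carrier (ideal_module I) = I" "\<zero>\<^bsub>ideal_module I\<^esub> = 0" "p \<oplus>\<^bsub>ideal_module I\<^esub> p' = p + p'"
  "s \<odot>\<^bsub>ideal_module I\<^esub> p = s * p"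
  by (simp_all add: ideal_module_def)

lemma is_module_ideal_module: "is_module (ideal_module I)"
  by (rule is_moduleI) (auto simp: ideal_simps[OF I] algebra_simps)

lemma quotient_IJ: "module_quotient (ideal_module I) J"
  by (rule module_quotient.intro[OF is_module_ideal_module], rule is_submoduleI[OF is_module_ideal_module])
     (use JI in \<open>auto simp: ideal_simps[OF J]\<close>)

lemma is_module_M: "is_module M"
  unfolding ideal_quot_def by (rule module_quotient.is_module_quot[OF quotient_IJ])

sublocale loc: localized_module M "xF F" for F
  by (rule localized_module.intro[OF is_module_M])

lemma cls_simps:
  assumes "p \<in> I"
  shows "cls p \<in> carrier M" "s \<odot>\<^bsub>M\<^esub> cls p = cls (s * p)" "cls p = \<zero>\<^bsub>M\<^esub> \<longleftrightarrow> p \<in> J"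
  using assms module_quotient.carrier_quot[OF quotient_IJ] module_quotient.smult_quot[OF quotient_IJ]
    module_quotient.coset_eq_zero_iff[OF quotient_IJ]
  by (simp_all add: ideal_quot_def)

lemma cls_zero: "cls 0 = \<zero>\<^bsub>M\<^esub>"
  using cls_simps(3)[of 0] ideal_simps(1)[OF I] ideal_simps(1)[OF J] by simp

text \<open>
  Two exponents \<open>a + t e\<^sub>F\<close> and \<open>a + t' e\<^sub>F\<close> become equal after adding \<open>t' e\<^sub>F\<close> and \<open>t e\<^sub>F\<close> respectively, so
  the corresponding fractions coincide.
\<close>

lemma monomial_class_eq:
  assumes e: "(\<lambda>i. int (e i)) = add_eF a t F" and "xpow e \<in> I"
  shows "monomial_class I J a F = fraction M (xF F) (cls (xpow e)) t"
proof -
  have *: "fraction M (xF F) (cls (xpow e')) t' = fraction M (xF F) (cls (xpow e)) t"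
    if e': "(\<lambda>i. int (e' i)) = add_eF a t' F" "xpow e' \<in> I" for e' t'
  proof -
    have "(\<lambda>i. int ((e' + (\<lambda>i. t * of_bool (i \<in> F))) i)) =
        (\<lambda>i. int ((e + (\<lambda>i. t' * of_bool (i \<in> F))) i))"
      unfolding exponent_shift[OF e] exponent_shift[OF e'(1)] by (simp only: add.commute)
    then have "(\<lambda>i. t * of_bool (i \<in> F)) + e' = (\<lambda>i. t' * of_bool (i \<in> F)) + e"
      unfolding int_exponent_inject by (simp only: add.commute)
    then have "xF F ^ (0 + t) * xpow e' = xF F ^ (0 + t') * xpow e"
      by (simp add: xF_power xpow_mult)
    then have "cls (xF F ^ (0 + t) * xpow e') = cls (xF F ^ (0 + t') * xpow e)"
      by (rule arg_cong)
    then have "xF F ^ (0 + t) \<odot>\<^bsub>M\<^esub> cls (xpow e') = xF F ^ (0 + t') \<odot>\<^bsub>M\<^esub> cls (xpow e)"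
      using assms(2) e'(2) by (simp only: cls_simps(2))
    then show ?thesis
      using assms(2) e'(2) loc.fraction_eq_iff cls_simps(1) by blast
  qed
  have "{(e, t). (\<lambda>i. int (e i)) = add_eF a t F \<and> (xpow e :: ('n, 'k) polyS) \<in> I} \<noteq> {}"
    using assms by auto
  then show ?thesis
    unfolding monomial_class_def by (rule SUP_eq_const) (clarify, rule *)
qed

lemma const_monomial_class:
  assumes "(\<lambda>i. int (e i)) = add_eF a t F" "xpow e \<in> I"
  shows "const r \<odot>\<^bsub>L F\<^esub> monomial_class I J a F = fraction M (xF F) (cls (Poly_Mapping.single e r)) t"
  using assms by (simp add: monomial_class_eq[OF assms] loc.smult_fraction cls_simps const_mult_xpow)

lemma monomial_class_in_localization:
  assumes "mono_in I a F"
  shows "monomial_class I J a F \<in> carrier (L F)"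
  using assms monomial_class_eq cls_simps(1) loc.fraction_in_localization
  by (auto simp: mono_in_def)

text \<open>
  A fraction vanishes when a power of \<open>x\<^sub>F\<close> kills its numerator; for a nonzero multiple of a monomial
  this means that the monomial is moved into \<open>J\<close>.
\<close>

lemma const_monomial_class_eq_zero_iff:
  assumes "mono_in I a F"
  shows "const r \<odot>\<^bsub>L F\<^esub> monomial_class I J a F = \<zero>\<^bsub>L F\<^esub> \<longleftrightarrow> r = 0 \<or> mono_in J a F"
proof -
  obtain e t where e: "(\<lambda>i. int (e i)) = add_eF a t F" "xpow e \<in> I"
    using assms by (auto simp: mono_in_def)
  let ?e = "\<lambda>s. (\<lambda>i. s * of_bool (i \<in> F)) + e"
  have s: "Poly_Mapping.single e r \<in> I"
    using e by (simp add: single_in_ideal_iff[OF I])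
  have "const r \<odot>\<^bsub>L F\<^esub> monomial_class I J a F = \<zero>\<^bsub>L F\<^esub> \<longleftrightarrow>
      (\<exists>s. xF F ^ s * Poly_Mapping.single e r \<in> J)"
    using s by (simp add: const_monomial_class[OF e] loc.fraction_eq_zero_iff cls_simps ideal_simps[OF I])
  also have "\<dots> \<longleftrightarrow> (\<exists>s. r = 0 \<or> xpow (?e s) \<in> J)"
    by (simp add: xF_power xpow_def mult_single flip: single_in_ideal_iff[OF J, unfolded xpow_def])
  also have "\<dots> \<longleftrightarrow> r = 0 \<or> mono_in J a F"
  proof -
    have e': "(\<lambda>i. int (?e s i)) = add_eF a (s + t) F" for s
      using exponent_shift[OF e(1), of s] by (simp add: add.commute)
    have "\<exists>s. xpow (?e s) \<in> J" if "mono_in J a F"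
    proof -
      obtain u where "\<And>e t. (\<lambda>i. int (e i)) = add_eF a t F \<Longrightarrow> u \<le> t \<Longrightarrow> xpow e \<in> J"
        using mono_inD[OF J \<open>mono_in J a F\<close>] by blast
      from this[OF e' le_add1] show ?thesis ..
    qed
    moreover have "mono_in J a F" if "xpow (?e s) \<in> J" for s
      unfolding mono_in_def using e' that by blast
    ultimately show ?thesis by blast
  qed
  finally show ?thesis .
qed

lemma loc_degree_subset: "loc_degree M D a F \<subseteq> carrier (L F)"
  by (auto simp: loc_degree_def ideal_quot_degree_def cls_simps intro!: loc.fraction_in_localization)

lemma zero_in_loc_degree: "\<zero>\<^bsub>L F\<^esub> \<in> loc_degree M D a F"
  unfolding loc.zero_localization loc_degree_def ideal_quot_degree_def cls_zero[symmetric]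
  by (intro CollectI exI[of _ "cls 0"] exI[of _ 0]) (auto simp: ideal_simps[OF I])

text \<open>
  A polynomial all of whose monomials have the same exponent is a multiple of that monomial, so
  each graded piece of a localization of \<open>I/J\<close> has dimension at most one.
\<close>

lemma loc_degree_cases:
  assumes "y \<in> loc_degree M D a F"
  obtains (zero) "y = \<zero>\<^bsub>L F\<^esub>"
  | (monomial) e t r where "(\<lambda>i. int (e i)) = add_eF a t F" "xpow e \<in> I"
      "y = const r \<odot>\<^bsub>L F\<^esub> monomial_class I J a F"
proof -
  obtain p t where y: "y = fraction M (xF F) (cls p) t" and p: "p \<in> I"
    "\<forall>e\<in>Poly_Mapping.keys p. (\<lambda>i. int (e i)) = add_eF a t F"
    using assms unfolding loc_degree_def ideal_quot_degree_def by blast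
  show ?thesis
  proof (cases "p = 0")
    case True
    then show ?thesis
      using zero by (simp add: y cls_zero loc.fraction_zero)
  next
    case False
    then obtain e where e: "e \<in> Poly_Mapping.keys p"
      by (metis equals0I keys_eq_empty)
    have p_eq: "p = Poly_Mapping.single e (Poly_Mapping.lookup p e)"
    proof (rule poly_mapping_eqI)
      fix e'
      have "e' = e" if "e' \<in> Poly_Mapping.keys p"
        using p(2) e that int_exponent_inject by metis
      then show "Poly_Mapping.lookup p e' =
          Poly_Mapping.lookup (Poly_Mapping.single e (Poly_Mapping.lookup p e)) e'"
        by (auto simp: lookup_single when_def in_keys_iff)
    qed
    then have "xpow e \<in> I"
      using e p(1) single_in_ideal_iff[OF I] by (metis in_keys_iff)
    then show ?thesis
      using monomial[OF _ _ trans[OF y]] const_monomial_class p(2) e p_eq by metis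
  qed
qed

lemma loc_degree_mono_in:
  assumes "mono_in I a F"
  shows "loc_degree M D a F = range (\<lambda>r. const r \<odot>\<^bsub>L F\<^esub> monomial_class I J a F)"
proof
  show "range (\<lambda>r. const r \<odot>\<^bsub>L F\<^esub> monomial_class I J a F) \<subseteq> loc_degree M D a F"
  proof clarify
    fix r
    obtain e t where e: "(\<lambda>i. int (e i)) = add_eF a t F" "xpow e \<in> I"
      using assms by (auto simp: mono_in_def)
    have "cls (Poly_Mapping.single e r) \<in> D (add_eF a t F)"
      unfolding ideal_quot_degree_def using e
      by (intro CollectI exI[of _ "Poly_Mapping.single e r"]) (auto simp: single_in_ideal_iff[OF I])
    then show "const r \<odot>\<^bsub>L F\<^esub> monomial_class I J a F \<in> loc_degree M D a F"
      unfolding const_monomial_class[OF e] by (auto simp: loc_degree_def)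
  qed
next
  have "\<zero>\<^bsub>L F\<^esub> = const 0 \<odot>\<^bsub>L F\<^esub> monomial_class I J a F"
    using const_monomial_class_eq_zero_iff[OF assms, of 0] by simp
  then show "loc_degree M D a F \<subseteq> range (\<lambda>r. const r \<odot>\<^bsub>L F\<^esub> monomial_class I J a F)"
    by (auto elim!: loc_degree_cases)
qed

lemma loc_degree_not_live:
  assumes "\<not> live a F"
  shows "loc_degree M D a F = {\<zero>\<^bsub>L F\<^esub>}"
proof -
  have "y = \<zero>\<^bsub>L F\<^esub>" if "y \<in> loc_degree M D a F" for y
    using that
  proof (cases rule: loc_degree_cases)
    case (monomial e t r)
    then have "mono_in I a F"
      by (auto simp: mono_in_def)
    then show ?thesis
      using assms by (simp add: monomial const_monomial_class_eq_zero_iff live_def)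
  qed
  then show ?thesis
    using zero_in_loc_degree by blast
qed

lemma mono_in_remove_vertex:
  "mono_in I a (F - {j}) \<Longrightarrow> mono_in I a F"
  by (rule mono_in_supset[OF I]) auto

lemma xF_remove: "j \<in> F \<Longrightarrow> xF (F - {j}) * xF {j} = (xF F :: ('n, 'k) polyS)"
  by (auto simp: xF_def xpow_mult intro!: arg_cong[where f = xpow])

lemma loc_map_monomial_class:
  assumes "mono_in I a (F - {j})" "j \<in> F"
  shows "loc_map M (xF (F - {j})) (xF {j}) (monomial_class I J a (F - {j})) = monomial_class I J a F"
proof -
  obtain e t where e: "(\<lambda>i. int (e i)) = add_eF a t (F - {j})" "xpow e \<in> I"
    using assms by (auto simp: mono_in_def)
  have "(\<lambda>i. int (((\<lambda>i. t * of_bool (i \<in> {j})) + e) i)) = add_eF a t F"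
  proof
    fix i
    show "int (((\<lambda>i. t * of_bool (i \<in> {j})) + e) i) = add_eF a t F i"
      using fun_cong[OF e(1), of i] assms(2) by (auto simp: add_eF_def)
  qed
  moreover have "xpow ((\<lambda>i. t * of_bool (i \<in> {j})) + e) \<in> I"
    using ideal_simps(3)[OF I e(2)] by (simp add: xpow_mult[symmetric])
  ultimately have "monomial_class I J a F = fraction M (xF F) (cls (xF {j} ^ t * xpow e)) t"
    unfolding xF_power xpow_mult by (rule monomial_class_eq)
  then show ?thesis
    using e(2) xF_remove[OF assms(2)] by (simp add: monomial_class_eq[OF e] loc.loc_map_fraction cls_simps)
qed

lemma linear_map_loc_map:
  assumes "j \<in> F"
  shows "linear_map (L (F - {j})) (L F) (loc_map M (xF (F - {j})) (xF {j}))"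
  using loc.linear_map_loc_map[of "F - {j}" "xF {j}"] by (simp add: xF_remove[OF assms])

lemma xpow_monomial_class:
  assumes "mono_in I a F"
  shows "xpow b \<odot>\<^bsub>L F\<^esub> monomial_class I J a F = monomial_class I J (shift_deg a b) F"
proof -
  obtain e t where e: "(\<lambda>i. int (e i)) = add_eF a t F" "xpow e \<in> I"
    using assms by (auto simp: mono_in_def)
  have "(\<lambda>i. int ((b + e) i)) = add_eF (shift_deg a b) t F"
  proof
    fix i
    show "int ((b + e) i) = add_eF (shift_deg a b) t F i"
      using fun_cong[OF e(1), of i] by (auto simp: add_eF_def shift_deg_def)
  qed
  moreover have "xpow (b + e) \<in> I"
    using ideal_simps(3)[OF I e(2)] by (simp add: xpow_mult[symmetric])
  ultimately have "monomial_class I J (shift_deg a b) F = fraction M (xF F) (cls (xpow b * xpow e)) t"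
    unfolding xpow_mult by (rule monomial_class_eq)
  then show ?thesis
    using e(2) by (simp add: monomial_class_eq[OF e] loc.smult_fraction cls_simps)
qed

lemma L_simps:
  assumes "x \<in> carrier (L F)"
  shows "const (r + s) \<odot>\<^bsub>L F\<^esub> x = const r \<odot>\<^bsub>L F\<^esub> x \<oplus>\<^bsub>L F\<^esub> const s \<odot>\<^bsub>L F\<^esub> x"
    "const (r * s) \<odot>\<^bsub>L F\<^esub> x = const r \<odot>\<^bsub>L F\<^esub> (const s \<odot>\<^bsub>L F\<^esub> x)"
    "const 0 \<odot>\<^bsub>L F\<^esub> x = \<zero>\<^bsub>L F\<^esub>" "const 1 \<odot>\<^bsub>L F\<^esub> x = x"
  using assms by (simp_all add: const_hom is_moduleD[OF loc.is_module_localization])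

lemma loc_degree_closed:
  assumes "x \<in> loc_degree M D a F"
  shows "y \<in> loc_degree M D a F \<Longrightarrow> x \<oplus>\<^bsub>L F\<^esub> y \<in> loc_degree M D a F"
    and "const r \<odot>\<^bsub>L F\<^esub> x \<in> loc_degree M D a F"
    and "xpow b \<odot>\<^bsub>L F\<^esub> x \<in> loc_degree M D (shift_deg a b) F"
proof -
  note Z = is_moduleD[OF loc.is_module_localization]
  note mc = monomial_class_in_localization
  show "x \<oplus>\<^bsub>L F\<^esub> y \<in> loc_degree M D a F" if "y \<in> loc_degree M D a F"
  proof (cases "mono_in I a F")
    case True
    then show ?thesis
      using assms that by (auto simp: loc_degree_mono_in mc simp flip: L_simps)
  next
    case False
    then show ?thesis
      using assms that by (simp add: loc_degree_not_live live_def Z(2,11))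
  qed
  show "const r \<odot>\<^bsub>L F\<^esub> x \<in> loc_degree M D a F"
  proof (cases "mono_in I a F")
    case True
    then show ?thesis
      using assms by (auto simp: loc_degree_mono_in mc simp flip: L_simps)
  next
    case False
    then show ?thesis
      using assms by (simp add: loc_degree_not_live live_def Z(10))
  qed
  show "xpow b \<odot>\<^bsub>L F\<^esub> x \<in> loc_degree M D (shift_deg a b) F"
  proof (cases "mono_in I a F")
    case True
    have "xpow b \<odot>\<^bsub>L F\<^esub> (const r \<odot>\<^bsub>L F\<^esub> monomial_class I J a F) =
        const r \<odot>\<^bsub>L F\<^esub> monomial_class I J (shift_deg a b) F" for r
      using mc[OF True] by (simp add: mult.commute flip: Z(7) xpow_monomial_class[OF True])
    then show ?thesis
      using assms True mono_in_shift_deg[OF I True, of b] by (auto simp: loc_degree_mono_in)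
  next
    case False
    then show ?thesis
      using assms zero_in_loc_degree by (simp add: loc_degree_not_live live_def Z(10))
  qed
qed

lemma loc_map_loc_degree:
  assumes "x \<in> loc_degree M D a (F - {j})" "j \<in> F"
  shows "loc_map M (xF (F - {j})) (xF {j}) x \<in> loc_degree M D a F"
proof (cases "mono_in I a (F - {j})")
  case True
  obtain r where x: "x = const r \<odot>\<^bsub>L (F - {j})\<^esub> monomial_class I J a (F - {j})"
    using assms(1) by (auto simp: loc_degree_mono_in[OF True])
  have "loc_map M (xF (F - {j})) (xF {j}) x = const r \<odot>\<^bsub>L F\<^esub> monomial_class I J a F"
    by (simp add: x linear_mapD(3)[OF linear_map_loc_map[OF assms(2)] monomial_class_in_localization[OF True]]
        loc_map_monomial_class[OF True assms(2)])
  then show ?thesis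
    by (simp add: loc_degree_mono_in[OF mono_in_remove_vertex[OF True]])
next
  case False
  then show ?thesis
    using assms zero_in_loc_degree
      linear_map_zero[OF linear_map_loc_map[OF assms(2)] loc.is_module_localization loc.is_module_localization]
    by (simp add: loc_degree_not_live live_def)
qed

text \<open>
  Where \<open>F\<close> is not live the class of \<open>x\<^sup>a\<close> is missing or zero and \<open>monomial_coeff\<close> is not determined;
  the value zero there makes the coefficient linear for every \<open>F\<close>.
\<close>

definition coeff :: "('n \<Rightarrow> int) \<Rightarrow> 'n set \<Rightarrow> (('n, 'k) polyS set \<times> nat) set \<Rightarrow> 'k" where
  "coeff a F y = (if live a F then monomial_coeff I J a F y else 0)"

text \<open>
  A nonzero multiple of the class of \<open>x\<^sup>a\<close> is nonzero for live \<open>F\<close>, hence the coefficient chosen by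
  \<open>monomial_coeff\<close> is unique.
\<close>

lemma const_monomial_class_inject:
  assumes "live a F"
  shows "const r \<odot>\<^bsub>L F\<^esub> monomial_class I J a F = const s \<odot>\<^bsub>L F\<^esub> monomial_class I J a F \<longleftrightarrow> r = s"
proof
  have m: "mono_in I a F" "\<not> mono_in J a F"
    using assms by (auto simp: live_def)
  note mc = monomial_class_in_localization[OF m(1)]
  assume eq: "const r \<odot>\<^bsub>L F\<^esub> monomial_class I J a F = const s \<odot>\<^bsub>L F\<^esub> monomial_class I J a F"
  have "const (r + (- s)) \<odot>\<^bsub>L F\<^esub> monomial_class I J a F = const (s + (- s)) \<odot>\<^bsub>L F\<^esub> monomial_class I J a F"
    using mc by (simp only: L_simps(1) eq)
  then have "r + (- s) = 0"
    using m const_monomial_class_eq_zero_iff[OF m(1)] mc by (simp add: L_simps)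
  then show "r = s" by simp
qed simp

lemma coeff_const_monomial_class:
  assumes "live a F"
  shows "coeff a F (const r \<odot>\<^bsub>L F\<^esub> monomial_class I J a F) = r"
  using assms const_monomial_class_inject[OF assms]
  by (auto simp: coeff_def monomial_coeff_def intro!: the_equality)

lemma coeff_zero: "coeff a F \<zero>\<^bsub>L F\<^esub> = 0"
  using coeff_const_monomial_class[of a F 0] monomial_class_in_localization[of a F]
  by (cases "live a F") (auto simp: coeff_def live_def L_simps)

lemma eq_coeff_monomial_class:
  assumes "y \<in> loc_degree M D a F" "mono_in I a F"
  shows "y = const (coeff a F y) \<odot>\<^bsub>L F\<^esub> monomial_class I J a F"
proof (cases "live a F")
  case True
  then show ?thesis
    using assms by (auto simp: loc_degree_mono_in coeff_const_monomial_class)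
next
  case False
  then show ?thesis
    using assms monomial_class_in_localization[OF assms(2)]
    by (simp add: loc_degree_not_live coeff_def L_simps)
qed

lemma loc_degree_eqI:
  assumes "x \<in> loc_degree M D a F" "y \<in> loc_degree M D a F" "coeff a F x = coeff a F y"
  shows "x = y"
proof (cases "mono_in I a F")
  case True
  then show ?thesis
    using eq_coeff_monomial_class[OF assms(1)] eq_coeff_monomial_class[OF assms(2)] assms(3) by simp
next
  case False
  then show ?thesis
    using assms by (simp add: loc_degree_not_live live_def)
qed

lemma coeff_add:
  assumes x: "x \<in> loc_degree M D a F" and y: "y \<in> loc_degree M D a F"
  shows "coeff a F (x \<oplus>\<^bsub>L F\<^esub> y) = coeff a F x + coeff a F y"
proof (cases "live a F")
  case True
  then have m: "mono_in I a F" by (simp add: live_def)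
  have "x \<oplus>\<^bsub>L F\<^esub> y = const (coeff a F x + coeff a F y) \<odot>\<^bsub>L F\<^esub> monomial_class I J a F"
    using eq_coeff_monomial_class[OF x m] eq_coeff_monomial_class[OF y m]
    by (simp add: L_simps monomial_class_in_localization[OF m])
  then show ?thesis
    by (simp add: coeff_const_monomial_class[OF True])
qed (simp add: coeff_def)

lemma coeff_scale:
  assumes x: "x \<in> loc_degree M D a F"
  shows "coeff a F (const r \<odot>\<^bsub>L F\<^esub> x) = r * coeff a F x"
proof (cases "live a F")
  case True
  then have m: "mono_in I a F" by (simp add: live_def)
  have "const r \<odot>\<^bsub>L F\<^esub> x = const (r * coeff a F x) \<odot>\<^bsub>L F\<^esub> monomial_class I J a F"
    by (subst eq_coeff_monomial_class[OF x m]) (simp add: L_simps monomial_class_in_localization[OF m])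
  then show ?thesis
    by (simp add: coeff_const_monomial_class[OF True])
qed (simp add: coeff_def)

text \<open>
  The localization maps, and multiplication by \<open>x\<^sup>b\<close>, send the class of \<open>x\<^sup>a\<close> to the class of \<open>x\<^sup>a\<close> and
  of \<open>x\<^bsup>a+b\<^esup>\<close>, so they preserve coefficients.  The hypothesis asks that the target class
  is not killed by \<open>J\<close>; if \<open>x\<^sup>a\<close> is not in the localization of \<open>I\<close> at the source, the source element is zero.
\<close>

lemma coeff_loc_map:
  assumes x: "x \<in> loc_degree M D a (F - {j})" and j: "j \<in> F" and F: "\<not> mono_in J a F"
  shows "coeff a F (loc_map M (xF (F - {j})) (xF {j}) x) = coeff a (F - {j}) x"
proof (cases "mono_in I a (F - {j})")
  case True
  then have live: "live a F"
    using F mono_in_remove_vertex[OF True] by (simp add: live_def)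
  have "loc_map M (xF (F - {j})) (xF {j}) x = const (coeff a (F - {j}) x) \<odot>\<^bsub>L F\<^esub> monomial_class I J a F"
    by (subst eq_coeff_monomial_class[OF x True])
       (simp add: linear_mapD(3)[OF linear_map_loc_map[OF j]] monomial_class_in_localization True
         loc_map_monomial_class[OF True j])
  then show ?thesis
    by (simp add: coeff_const_monomial_class[OF live])
next
  case False
  then show ?thesis
    using x linear_map_zero[OF linear_map_loc_map[OF j] loc.is_module_localization loc.is_module_localization]
    by (simp add: loc_degree_not_live live_def coeff_zero)
qed

lemma coeff_xpow:
  assumes x: "x \<in> loc_degree M D a F" and F: "\<not> mono_in J (shift_deg a b) F"
  shows "coeff (shift_deg a b) F (xpow b \<odot>\<^bsub>L F\<^esub> x) = coeff a F x"
proof (cases "mono_in I a F")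
  case True
  then have live: "live (shift_deg a b) F"
    using F mono_in_shift_deg[OF I] by (simp add: live_def)
  note Z = is_moduleD[OF loc.is_module_localization]
  have "xpow b \<odot>\<^bsub>L F\<^esub> x = const (coeff a F x) \<odot>\<^bsub>L F\<^esub> monomial_class I J (shift_deg a b) F"
    by (subst eq_coeff_monomial_class[OF x True])
       (simp add: mult.commute monomial_class_in_localization[OF True]
         flip: Z(7) xpow_monomial_class[OF True])
  then show ?thesis
    by (simp add: coeff_const_monomial_class[OF live])
next
  case False
  then show ?thesis
    using x by (simp add: loc_degree_not_live live_def coeff_zero is_moduleD(10)[OF loc.is_module_localization])
qed

end

section \<open>The Cech complex in coordinates\<close>

context ideal_pair
begin

lemma finsum_loc_degree:
  assumes "finite A" "\<And>i. i \<in> A \<Longrightarrow> g i \<in> loc_degree M D a F"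
  shows "finsum (L F) g A \<in> loc_degree M D a F"
    and "coeff a F (finsum (L F) g A) = (\<Sum>i\<in>A. coeff a F (g i))"
proof -
  interpret Z: abelian_group "L F"
    by (rule is_moduleD(1)[OF loc.is_module_localization])
  have "finsum (L F) g A \<in> loc_degree M D a F \<and>
      coeff a F (finsum (L F) g A) = (\<Sum>i\<in>A. coeff a F (g i))"
    using assms
  proof (induction A rule: finite_induct)
    case empty
    then show ?case
      by (simp add: zero_in_loc_degree coeff_zero)
  next
    case (insert i A)
    then have "finsum (L F) g (insert i A) = g i \<oplus>\<^bsub>L F\<^esub> finsum (L F) g A"
      using loc_degree_subset by (intro Z.finsum_insert) (auto simp: Pi_def subset_iff)
    then show ?case
      using insert by (simp add: loc_degree_closed coeff_add)
  qed
  then show "finsum (L F) g A \<in> loc_degree M D a F"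
    "coeff a F (finsum (L F) g A) = (\<Sum>i\<in>A. coeff a F (g i))" by auto
qed

lemma cech_simps [simp]:
  "carrier (cech M D a p) = (\<Pi>\<^sub>E F\<in>subsets_of_size p. loc_degree M D a F)"
  "\<zero>\<^bsub>cech M D a p\<^esub> = (\<lambda>F\<in>subsets_of_size p. \<zero>\<^bsub>L F\<^esub>)"
  "c \<oplus>\<^bsub>cech M D a p\<^esub> c' = (\<lambda>F\<in>subsets_of_size p. c F \<oplus>\<^bsub>L F\<^esub> c' F)"
  "r \<odot>\<^bsub>cech M D a p\<^esub> c = (\<lambda>F\<in>subsets_of_size p. const r \<odot>\<^bsub>L F\<^esub> c F)"
  by (simp_all add: cech_def)

text \<open>
  A Cech cochain of degree \<open>a\<close> is determined by its coefficients at the live \<open>F\<close>, since the other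
  components lie in zero spaces.  This turns identities of Cech cochains into identities of scalars.
\<close>

lemma cech_eqI:
  assumes c: "c \<in> carrier (cech M D a p)" "c' \<in> carrier (cech M D a p)"
    and eq: "\<And>F. F \<in> subsets_of_size p \<Longrightarrow> live a F \<Longrightarrow> coeff a F (c F) = coeff a F (c' F)"
  shows "c = c'"
proof (rule PiE_ext)
  show "c \<in> (\<Pi>\<^sub>E F\<in>subsets_of_size p. loc_degree M D a F)"
    "c' \<in> (\<Pi>\<^sub>E F\<in>subsets_of_size p. loc_degree M D a F)"
    using c by simp_all
  fix F :: "'n set" assume F: "F \<in> subsets_of_size p"
  then have "c F \<in> loc_degree M D a F" "c' F \<in> loc_degree M D a F"
    using c by auto
  moreover have "coeff a F (c F) = coeff a F (c' F)"
    using eq[OF F] by (cases "live a F") (auto simp: coeff_def)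
  ultimately show "c F = c' F"
    by (rule loc_degree_eqI)
qed

lemma is_module_cech: "is_module (cech M D a p)"
proof -
  note Z = is_moduleD(2-12,14)[OF loc.is_module_localization]
  have L: "x \<in> loc_degree M D a F \<Longrightarrow> x \<in> carrier (L F)" for x F
    using loc_degree_subset by blast
  have ext: "(\<lambda>F\<in>subsets_of_size p. g F) = c"
    if "c \<in> carrier (cech M D a p)" "\<And>F. F \<in> subsets_of_size p \<Longrightarrow> g F = c F" for g c
    using that PiE_restrict[of c "subsets_of_size p" "loc_degree M D a"] restrict_ext[of "subsets_of_size p" g c]
    by simp
  show ?thesis
  proof (rule is_moduleI)
    fix c assume c: "c \<in> carrier (cech M D a p)"
    then have "c F \<in> carrier (L F)" if "F \<in> subsets_of_size p" for F
      using that L by auto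
    then show "\<zero>\<^bsub>cech M D a p\<^esub> \<oplus>\<^bsub>cech M D a p\<^esub> c = c" "1 \<odot>\<^bsub>cech M D a p\<^esub> c = c"
      unfolding cech_simps by (auto intro!: ext[OF c] simp: Z L_simps)
  qed (auto simp: zero_in_loc_degree loc_degree_closed PiE_mem L Z const_hom L_simps
         intro!: restrict_ext is_moduleD(13)[OF loc.is_module_localization])
qed

lemma remove_in_subsets_of_size:
  fixes F :: "'n set"
  assumes "F \<in> subsets_of_size (p + 1)" "j \<in> F"
  shows "F - {j} \<in> subsets_of_size p"
  using assms card_Suc_Diff1[of F j] by (auto simp: subsets_of_size_def)

text \<open>
  In coordinates the Cech differential is the signed sum over all \<open>F - {j}\<close>, which
  has the shape of the simplicial coboundary.
\<close>

lemma cech_diff: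
  assumes c: "c \<in> carrier (cech M D a p)" and F: "F \<in> subsets_of_size (p + 1)"
  shows "cech_diff M p c F \<in> loc_degree M D a F"
    and "\<not> mono_in J a F \<Longrightarrow> coeff a F (cech_diff M p c F) =
      (\<Sum>j\<in>F. incidence_sign j F * coeff a (F - {j}) (c (F - {j})))"
proof -
  have cF: "c (F - {j}) \<in> loc_degree M D a (F - {j})" if "j \<in> F" for j
    using c remove_in_subsets_of_size[OF F that] by auto
  let ?term = "\<lambda>j. const (incidence_sign j F) \<odot>\<^bsub>L F\<^esub> loc_map M (xF (F - {j})) (xF {j}) (c (F - {j}))"
  have eq: "cech_diff M p c F = finsum (L F) ?term F"
    using F by (simp add: cech_diff_def const_incidence_sign)
  have mem: "?term j \<in> loc_degree M D a F" if "j \<in> F" for j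
    using that cF by (intro loc_degree_closed(2) loc_map_loc_degree)
  show "cech_diff M p c F \<in> loc_degree M D a F"
    unfolding eq by (rule finsum_loc_degree(1)[OF _ mem]) auto
  assume "\<not> mono_in J a F"
  then have "coeff a F (?term j) = incidence_sign j F * coeff a (F - {j}) (c (F - {j}))" if "j \<in> F" for j
    using that cF by (simp add: coeff_scale[OF loc_map_loc_degree] coeff_loc_map)
  then show "coeff a F (cech_diff M p c F) =
      (\<Sum>j\<in>F. incidence_sign j F * coeff a (F - {j}) (c (F - {j})))"
    unfolding eq by (subst finsum_loc_degree(2)[OF _ mem]) auto
qed

lemma cech_diff_in_cech:
  assumes "c \<in> carrier (cech M D a p)"
  shows "cech_diff M p c \<in> carrier (cech M D a (p + 1))"
  using cech_diff(1)[OF assms] by (auto simp: cech_diff_def)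

lemma coeff_cech_ops:
  assumes "c \<in> carrier (cech M D a p)" "F \<in> subsets_of_size p"
  shows "c' \<in> carrier (cech M D a p) \<Longrightarrow>
      coeff a F ((c \<oplus>\<^bsub>cech M D a p\<^esub> c') F) = coeff a F (c F) + coeff a F (c' F)"
    and "coeff a F ((r \<odot>\<^bsub>cech M D a p\<^esub> c) F) = r * coeff a F (c F)"
proof -
  have mem: "c F \<in> loc_degree M D a F" if "c \<in> carrier (cech M D a p)" for c
    using that assms(2) by auto
  show "c' \<in> carrier (cech M D a p) \<Longrightarrow>
      coeff a F ((c \<oplus>\<^bsub>cech M D a p\<^esub> c') F) = coeff a F (c F) + coeff a F (c' F)"
    "coeff a F ((r \<odot>\<^bsub>cech M D a p\<^esub> c) F) = r * coeff a F (c F)"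
    using assms(2) coeff_add[OF mem[OF assms(1)] mem[of c']] coeff_scale[OF mem[OF assms(1)]] by simp_all
qed

lemma linear_map_cech_diff: "linear_map (cech M D a p) (cech M D a (p + 1)) (cech_diff M p)"
proof (rule linear_mapI)
  note mod = is_moduleD[OF is_module_cech]
  fix c c' r
  assume c: "c \<in> carrier (cech M D a p)"
  show dc: "cech_diff M p c \<in> carrier (cech M D a (p + 1))"
    by (rule cech_diff_in_cech[OF c])
  show "cech_diff M p (r \<odot>\<^bsub>cech M D a p\<^esub> c) = r \<odot>\<^bsub>cech M D a (p + 1)\<^esub> cech_diff M p c"
  proof (rule cech_eqI[OF cech_diff_in_cech[OF mod(4)[OF c]] mod(4)[OF dc]])
    fix F assume F: "F \<in> subsets_of_size (p + 1)" "live a F"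
    then have J: "\<not> mono_in J a F" by (simp add: live_def)
    show "coeff a F (cech_diff M p (r \<odot>\<^bsub>cech M D a p\<^esub> c) F) =
        coeff a F ((r \<odot>\<^bsub>cech M D a (p + 1)\<^esub> cech_diff M p c) F)"
      unfolding coeff_cech_ops(2)[OF dc F(1)] cech_diff(2)[OF c F(1) J] cech_diff(2)[OF mod(4)[OF c] F(1) J]
        sum_distrib_left
      by (intro sum.cong refl)
         (simp only: coeff_cech_ops(2)[OF c remove_in_subsets_of_size[OF F(1)]] mult.left_commute)
  qed
  assume c': "c' \<in> carrier (cech M D a p)"
  have dc': "cech_diff M p c' \<in> carrier (cech M D a (p + 1))"
    by (rule cech_diff_in_cech[OF c'])
  show "cech_diff M p (c \<oplus>\<^bsub>cech M D a p\<^esub> c') = cech_diff M p c \<oplus>\<^bsub>cech M D a (p + 1)\<^esub> cech_diff M p c'"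
  proof (rule cech_eqI[OF cech_diff_in_cech[OF mod(3)[OF c c']] mod(3)[OF dc dc']])
    fix F assume F: "F \<in> subsets_of_size (p + 1)" "live a F"
    then have J: "\<not> mono_in J a F" by (simp add: live_def)
    show "coeff a F (cech_diff M p (c \<oplus>\<^bsub>cech M D a p\<^esub> c') F) =
        coeff a F ((cech_diff M p c \<oplus>\<^bsub>cech M D a (p + 1)\<^esub> cech_diff M p c') F)"
      unfolding coeff_cech_ops(1)[OF dc F(1) dc'] cech_diff(2)[OF c F(1) J] cech_diff(2)[OF c' F(1) J]
        cech_diff(2)[OF mod(3)[OF c c'] F(1) J] sum.distrib[symmetric]
      by (intro sum.cong refl)
         (simp only: coeff_cech_ops(1)[OF c remove_in_subsets_of_size[OF F(1)] c'] distrib_left)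
  qed
qed

lemma cech_mult_in_cech:
  assumes "c \<in> carrier (cech M D a p)"
  shows "cech_mult M b p c \<in> carrier (cech M D (shift_deg a b) p)"
  using assms by (auto simp: cech_mult_def intro!: loc_degree_closed(3))

text \<open>In coordinates, multiplication by \<open>x\<^sup>b\<close> is restriction to the \<open>F\<close> that stay outside \<open>J\<close>.\<close>

lemma coeff_cech_mult:
  assumes "c \<in> carrier (cech M D a p)" "F \<in> subsets_of_size p" "\<not> mono_in J (shift_deg a b) F"
  shows "coeff (shift_deg a b) F (cech_mult M b p c F) = coeff a F (c F)"
  using assms by (auto simp: cech_mult_def intro!: coeff_xpow)

lemma cochain_map_cech_mult:
  "cochain_map (cech M D a) (cech_diff M) (cech M D (shift_deg a b)) (cech_diff M) 0 (cech_mult M b)"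
  unfolding cochain_map_def diff_zero
proof (intro allI conjI ballI)
  fix p
  note mod = is_moduleD[OF is_module_cech]
  note mult = cech_mult_in_cech
  show "linear_map (cech M D a p) (cech M D (shift_deg a b) p) (cech_mult M b p)"
  proof (rule linear_mapI)
    fix c c' r
    assume c: "c \<in> carrier (cech M D a p)"
    show "cech_mult M b p c \<in> carrier (cech M D (shift_deg a b) p)"
      by (rule mult[OF c])
    show "cech_mult M b p (r \<odot>\<^bsub>cech M D a p\<^esub> c) = r \<odot>\<^bsub>cech M D (shift_deg a b) p\<^esub> cech_mult M b p c"
      by (rule cech_eqI[OF mult[OF mod(4)[OF c]] mod(4)[OF mult[OF c]]])
         (simp add: live_def coeff_cech_mult[OF mod(4)[OF c]] coeff_cech_mult[OF c]
           coeff_cech_ops(2)[OF c] coeff_cech_ops(2)[OF mult[OF c]] del: cech_simps)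
    assume c': "c' \<in> carrier (cech M D a p)"
    show "cech_mult M b p (c \<oplus>\<^bsub>cech M D a p\<^esub> c') =
        cech_mult M b p c \<oplus>\<^bsub>cech M D (shift_deg a b) p\<^esub> cech_mult M b p c'"
      by (rule cech_eqI[OF mult[OF mod(3)[OF c c']] mod(3)[OF mult[OF c] mult[OF c']]])
         (simp add: live_def coeff_cech_mult[OF mod(3)[OF c c']] coeff_cech_mult[OF c] coeff_cech_mult[OF c']
           coeff_cech_ops(1)[OF c _ c'] coeff_cech_ops(1)[OF mult[OF c] _ mult[OF c']] del: cech_simps)
  qed
  fix c assume c: "c \<in> carrier (cech M D a p)"
  show "cech_mult M b (p + 1) (cech_diff M p c) = cech_diff M p (cech_mult M b p c)"
  proof (rule cech_eqI[OF mult[OF cech_diff_in_cech[OF c]] cech_diff_in_cech[OF mult[OF c]]])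
    fix F assume F: "F \<in> subsets_of_size (p + 1)" "live (shift_deg a b) F"
    then have J': "\<not> mono_in J (shift_deg a b) F" by (simp add: live_def)
    then have aJ: "\<not> mono_in J a F"
      using mono_in_shift_deg[OF J] by blast
    have "\<not> mono_in J (shift_deg a b) (F - {j})" for j
      using J' mono_in_supset[OF J, of "F - {j}" F] by blast
    then show "coeff (shift_deg a b) F (cech_mult M b (p + 1) (cech_diff M p c) F) =
        coeff (shift_deg a b) F (cech_diff M p (cech_mult M b p c) F)"
      unfolding coeff_cech_mult[OF cech_diff_in_cech[OF c] F(1) J'] cech_diff(2)[OF c F(1) aJ]
        cech_diff(2)[OF mult[OF c] F(1) J']
      by (intro sum.cong refl) (simp add: coeff_cech_mult[OF c remove_in_subsets_of_size[OF F(1)]])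
  qed
qed

section \<open>The relative Hochster--Takayama isomorphism\<close>

abbreviation \<Delta>J where "\<Delta>J a \<equiv> degree_complex a J"
abbreviation \<Delta>I where "\<Delta>I a \<equiv> degree_complex a I"
abbreviation ht_shift :: "('n \<Rightarrow> int) \<Rightarrow> int" where "ht_shift a \<equiv> int (card (neg_supp a)) + 1"

lemma live_iff:
  "live a F \<longleftrightarrow> neg_supp a \<subseteq> F \<and> F - neg_supp a \<in> \<Delta>J a - \<Delta>I a"
proof -
  have "neg_supp a \<subseteq> F" if "mono_in I a F"
    using that mono_in_iff_min_gens[OF I] by blast
  moreover have "neg_supp a \<union> (F - neg_supp a) = F" if "neg_supp a \<subseteq> F"
    using that by auto
  ultimately show ?thesis
    by (auto simp: live_def mem_degree_complex_iff[OF I] mem_degree_complex_iff[OF J])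
qed

lemma simplicial_pair_degree_complex: "simplicial_pair (\<Delta>J a) (\<Delta>I a)"
proof
  show "\<Delta>I a \<subseteq> \<Delta>J a"
    using mono_in_mono[OF JI] by (auto simp: mem_degree_complex_iff[OF I] mem_degree_complex_iff[OF J])
  have step: "\<not> mono_in K a (neg_supp a \<union> (E - {j}))"
    if "ideal K poly_ring" "\<not> mono_in K a (neg_supp a \<union> E)" for E j and K :: "('n, 'k) polyS set"
    using that mono_in_supset[OF that(1), of "neg_supp a \<union> (E - {j})" "neg_supp a \<union> E"] by blast
  show "E - {j} \<in> \<Delta>J a" if "E \<in> \<Delta>J a" for E j
    using that step[OF J] by (auto simp: mem_degree_complex_iff[OF J])
  show "E - {j} \<in> \<Delta>I a" if "E \<in> \<Delta>I a" for E j
    using that step[OF I] by (auto simp: mem_degree_complex_iff[OF I])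
qed

sublocale pair: simplicial_pair "\<Delta>J a" "\<Delta>I a" for a
  by (rule simplicial_pair_degree_complex)

lemma face_union:
  assumes "E \<in> faces (\<Delta>J a) (p - ht_shift a)"
  shows "neg_supp a \<union> E \<in> subsets_of_size p" "neg_supp a \<inter> E = {}" "\<not> mono_in J a (neg_supp a \<union> E)"
    and "live a (neg_supp a \<union> E) \<longleftrightarrow> E \<notin> \<Delta>I a"
proof -
  show disj: "neg_supp a \<inter> E = {}" and J': "\<not> mono_in J a (neg_supp a \<union> E)"
    using assms by (auto simp: faces_def mem_degree_complex_iff[OF J])
  have "card (neg_supp a \<union> E) = card (neg_supp a) + card E"
    using disj by (simp add: card_Un_disjoint)
  then show "neg_supp a \<union> E \<in> subsets_of_size p"
    using assms by (simp add: subsets_of_size_def faces_def)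
  show "live a (neg_supp a \<union> E) \<longleftrightarrow> E \<notin> \<Delta>I a"
    using disj J' by (auto simp: live_def mem_degree_complex_iff[OF I])
qed

lemma ht_cochain_eq_cochain_with_values:
  "ht_cochain I J a q c = cochain_with_values (\<Delta>J a) (\<Delta>I a) q
     (\<lambda>E. ht_sign (neg_supp a) E * coeff a (neg_supp a \<union> E) (c (neg_supp a \<union> E)))"
proof -
  have "live a (neg_supp a \<union> E)" if "E \<in> faces (\<Delta>J a - \<Delta>I a) q" for E
    using that face_union(4)[of E a "q + ht_shift a"] by (auto simp: faces_def)
  then show ?thesis
    unfolding ht_cochain_def cochain_with_values_def
    by (intro restrict_ext sum.cong refl) (simp add: coeff_def)
qed

lemma ht_cochain_in_rel_cochains:
  "ht_cochain I J a q c \<in> carrier (rel_cochains (\<Delta>J a) (\<Delta>I a) q)"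
  unfolding ht_cochain_eq_cochain_with_values by (rule pair.cochain_with_values_in_rel_cochains)

text \<open>
  On faces of \<open>\<Delta>\<^sub>a(I)\<close> both sides vanish: the left one since the class of such a face is zero, the right
  one since \<open>G\<^sub>a \<union> E\<close> is not live.  Covering these faces too saves case distinctions for
  the terms of the differential.
\<close>

lemma ht_cochain_rel_basis:
  assumes "E \<in> faces (\<Delta>J a) q"
  shows "ht_cochain I J a q c (rel_basis (\<Delta>J a) (\<Delta>I a) q E) =
     ht_sign (neg_supp a) E * coeff a (neg_supp a \<union> E) (c (neg_supp a \<union> E))"
proof (cases "E \<in> \<Delta>I a")
  case True
  then have "\<not> live a (neg_supp a \<union> E)"
    using face_union(4)[of E a "q + ht_shift a"] assms by simp
  moreover have "E \<in> faces (\<Delta>I a) q"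
    using assms True by (simp add: faces_def)
  ultimately show ?thesis
    using pair.cochain_rel_basis_subcomplex[OF ht_cochain_in_rel_cochains] by (simp add: coeff_def)
next
  case False
  then have "E \<in> faces (\<Delta>J a - \<Delta>I a) q"
    using assms by (simp add: faces_def)
  then show ?thesis
    unfolding ht_cochain_eq_cochain_with_values by (rule pair.cochain_with_values_rel_basis)
qed

lemma ht_sign_square: "ht_sign G E * ht_sign G E = (1 :: 'k)" for E :: "'n set"
proof -
  have "incidence_sign j G * incidence_sign j G = (1 :: 'k)" for j :: 'n
    by (simp add: incidence_sign_def flip: power_add)
  then show ?thesis
    by (simp add: ht_sign_def flip: prod.distrib)
qed

lemma linear_map_ht_cochain:
  "linear_map (cech M D a p) (rel_cochains (\<Delta>J a) (\<Delta>I a) (p - ht_shift a))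
     (ht_cochain I J a (p - ht_shift a))"
proof (rule linear_mapI)
  let ?q = "p - ht_shift a"
  note mod = is_moduleD[OF cochain_complexD(1)[OF pair.cochain_complex_rel_cochains]]
  have faces: "E \<in> faces (\<Delta>J a - \<Delta>I a) ?q \<Longrightarrow> E \<in> faces (\<Delta>J a) ?q" for E
    by (auto simp: faces_def)
  fix c c' r
  assume c: "c \<in> carrier (cech M D a p)"
  show "ht_cochain I J a ?q c \<in> carrier (rel_cochains (\<Delta>J a) (\<Delta>I a) ?q)"
    by (rule ht_cochain_in_rel_cochains)
  show "ht_cochain I J a ?q (r \<odot>\<^bsub>cech M D a p\<^esub> c) =
      r \<odot>\<^bsub>rel_cochains (\<Delta>J a) (\<Delta>I a) ?q\<^esub> ht_cochain I J a ?q c"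
  proof (rule pair.cochain_eqI[OF ht_cochain_in_rel_cochains mod(4)[OF ht_cochain_in_rel_cochains]])
    fix E assume "E \<in> faces (\<Delta>J a - \<Delta>I a) ?q"
    then have E: "E \<in> faces (\<Delta>J a) ?q" by (rule faces)
    show "ht_cochain I J a ?q (r \<odot>\<^bsub>cech M D a p\<^esub> c) (rel_basis (\<Delta>J a) (\<Delta>I a) ?q E) =
        (r \<odot>\<^bsub>rel_cochains (\<Delta>J a) (\<Delta>I a) ?q\<^esub> ht_cochain I J a ?q c) (rel_basis (\<Delta>J a) (\<Delta>I a) ?q E)"
      using pair.rel_basis_in_rel_chains[OF E, where 'k = 'k]
      by (simp add: ht_cochain_rel_basis[OF E] coeff_cech_ops(2)[OF c face_union(1)[OF E]] rel_cochains_def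
          del: cech_simps)
  qed
  assume c': "c' \<in> carrier (cech M D a p)"
  show "ht_cochain I J a ?q (c \<oplus>\<^bsub>cech M D a p\<^esub> c') =
      ht_cochain I J a ?q c \<oplus>\<^bsub>rel_cochains (\<Delta>J a) (\<Delta>I a) ?q\<^esub> ht_cochain I J a ?q c'"
  proof (rule pair.cochain_eqI[OF ht_cochain_in_rel_cochains
        mod(3)[OF ht_cochain_in_rel_cochains ht_cochain_in_rel_cochains]])
    fix E assume "E \<in> faces (\<Delta>J a - \<Delta>I a) ?q"
    then have E: "E \<in> faces (\<Delta>J a) ?q" by (rule faces)
    show "ht_cochain I J a ?q (c \<oplus>\<^bsub>cech M D a p\<^esub> c') (rel_basis (\<Delta>J a) (\<Delta>I a) ?q E) =
        (ht_cochain I J a ?q c \<oplus>\<^bsub>rel_cochains (\<Delta>J a) (\<Delta>I a) ?q\<^esub> ht_cochain I J a ?q c')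
          (rel_basis (\<Delta>J a) (\<Delta>I a) ?q E)"
      using pair.rel_basis_in_rel_chains[OF E, where 'k = 'k]
      by (simp add: ht_cochain_rel_basis[OF E] coeff_cech_ops(1)[OF c face_union(1)[OF E] c'] rel_cochains_def
          distrib_left del: cech_simps)
  qed
qed

text \<open>
  \<open>E \<mapsto> G\<^sub>a \<union> E\<close> matches the faces of \<open>\<Delta>\<^sub>a(J)\<close> outside \<open>\<Delta>\<^sub>a(I)\<close> with the live \<open>F\<close>, and on coordinates the
  map multiplies by signs.
\<close>

lemma bij_betw_ht_cochain:
  "bij_betw (ht_cochain I J a (p - ht_shift a)) (carrier (cech M D a p))
     (carrier (rel_cochains (\<Delta>J a) (\<Delta>I a) (p - ht_shift a)))"
  unfolding bij_betw_def
proof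
  let ?q = "p - ht_shift a"
  have face: "F - neg_supp a \<in> faces (\<Delta>J a) ?q" "neg_supp a \<union> (F - neg_supp a) = F"
    if "F \<in> subsets_of_size p" "live a F" for F
  proof -
    have "card (F - neg_supp a) = card F - card (neg_supp a)" "card (neg_supp a) \<le> card F"
      using that by (auto simp: live_iff card_Diff_subset card_mono)
    then show "F - neg_supp a \<in> faces (\<Delta>J a) ?q" "neg_supp a \<union> (F - neg_supp a) = F"
      using that by (auto simp: faces_def live_iff subsets_of_size_def)
  qed
  show "inj_on (ht_cochain I J a ?q) (carrier (cech M D a p))"
  proof (rule inj_onI)
    fix c c' assume c: "c \<in> carrier (cech M D a p)" "c' \<in> carrier (cech M D a p)"
      and eq: "ht_cochain I J a ?q c = ht_cochain I J a ?q c'"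
    show "c = c'"
    proof (rule cech_eqI[OF c])
      fix F assume F: "F \<in> subsets_of_size p" "live a F"
      let ?E = "F - neg_supp a"
      have "ht_sign (neg_supp a) ?E * coeff a F (c F) = ht_sign (neg_supp a) ?E * coeff a F (c' F)"
        using ht_cochain_rel_basis[OF face(1)[OF F]] face(2)[OF F] eq by metis
      moreover have "ht_sign (neg_supp a) ?E \<noteq> (0 :: 'k)"
        using ht_sign_square[of "neg_supp a" ?E] by auto
      ultimately show "coeff a F (c F) = coeff a F (c' F)" by simp
    qed
  qed
  show "ht_cochain I J a ?q ` carrier (cech M D a p) = carrier (rel_cochains (\<Delta>J a) (\<Delta>I a) ?q)"
  proof (intro equalityI subsetI)
    fix \<phi> :: "('n set \<Rightarrow>\<^sub>0 'k) set \<Rightarrow> 'k"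
    assume \<phi>: "\<phi> \<in> carrier (rel_cochains (\<Delta>J a) (\<Delta>I a) ?q)"
    define v where "v F = ht_sign (neg_supp a) (F - neg_supp a) *
      \<phi> (rel_basis (\<Delta>J a) (\<Delta>I a) ?q (F - neg_supp a))" for F
    define c where "c = (\<lambda>F\<in>subsets_of_size p.
      if live a F then const (v F) \<odot>\<^bsub>L F\<^esub> monomial_class I J a F else \<zero>\<^bsub>L F\<^esub>)"
    have c: "c \<in> carrier (cech M D a p)"
      by (auto simp: c_def zero_in_loc_degree loc_degree_mono_in live_def)
    have "ht_cochain I J a ?q c = \<phi>"
    proof (rule pair.cochain_eqI[OF ht_cochain_in_rel_cochains \<phi>])
      fix E assume E: "E \<in> faces (\<Delta>J a - \<Delta>I a) ?q"
      then have E': "E \<in> faces (\<Delta>J a) ?q" "E \<notin> \<Delta>I a"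
        by (auto simp: faces_def)
      note u = face_union[OF E'(1)]
      have "neg_supp a \<union> E - neg_supp a = E"
        using u(2) by auto
      then have "coeff a (neg_supp a \<union> E) (c (neg_supp a \<union> E)) =
          ht_sign (neg_supp a) E * \<phi> (rel_basis (\<Delta>J a) (\<Delta>I a) ?q E)"
        using u(1,4) E'(2) by (simp add: c_def coeff_const_monomial_class v_def)
      then show "ht_cochain I J a ?q c (rel_basis (\<Delta>J a) (\<Delta>I a) ?q E) = \<phi> (rel_basis (\<Delta>J a) (\<Delta>I a) ?q E)"
        by (simp add: ht_cochain_rel_basis[OF E'(1)] ht_sign_square flip: mult.assoc)
    qed
    then show "\<phi> \<in> ht_cochain I J a ?q ` carrier (cech M D a p)"
      using c by blast
  qed (use ht_cochain_in_rel_cochains in auto)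
qed

text \<open>
  The Cech differential at \<open>F = G\<^sub>a \<union> E\<close> removes vertices of \<open>G\<^sub>a\<close> as well, but then \<open>F - {j}\<close> no longer
  contains \<open>G\<^sub>a\<close> and the term is zero.  For \<open>j \<in> E\<close> the sign of \<open>j\<close> in \<open>F\<close> is the sign of \<open>j\<close> in \<open>E\<close> times
  that of \<open>j\<close> in \<open>G\<^sub>a\<close>, and the second factor is the quotient of \<open>ht_sign\<close> at \<open>E\<close> and at \<open>E - {j}\<close>.
\<close>

lemma ht_cochain_cech_diff:
  assumes c: "c \<in> carrier (cech M D a p)"
  shows "ht_cochain I J a (p + 1 - ht_shift a) (cech_diff M p c) =
     rel_coboundary (\<Delta>J a) (\<Delta>I a) (p - ht_shift a) (ht_cochain I J a (p - ht_shift a) c)"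
proof -
  let ?q = "p - ht_shift a" and ?G = "neg_supp a"
  have shift: "p + 1 - ht_shift a = ?q + 1" by simp
  show ?thesis
    unfolding shift
  proof (rule pair.cochain_eqI[OF ht_cochain_in_rel_cochains])
    show "rel_coboundary (\<Delta>J a) (\<Delta>I a) ?q (ht_cochain I J a ?q c) \<in>
        carrier (rel_cochains (\<Delta>J a) (\<Delta>I a) (?q + 1))"
      by (rule linear_mapD(1)[OF cochain_complexD(2)[OF pair.cochain_complex_rel_cochains]
            ht_cochain_in_rel_cochains])
    fix E assume "E \<in> faces (\<Delta>J a - \<Delta>I a) (?q + 1)"
    then have E: "E \<in> faces (\<Delta>J a) (?q + 1)"
      by (auto simp: faces_def)
    note u = face_union[of E a "p + 1", unfolded shift, OF E]
    have face: "E - {j} \<in> faces (\<Delta>J a) ?q" if "j \<in> E" for j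
      using faces_remove_vertex[OF E that] pair.closed E that by (auto simp: faces_def)
    let ?t = "\<lambda>j. incidence_sign j (?G \<union> E) * coeff a (?G \<union> E - {j}) (c (?G \<union> E - {j}))"
    have G_terms: "?t j = 0" if "j \<in> ?G" for j
      using that by (auto simp: coeff_def live_iff)
    have E_terms: "ht_sign ?G E * ?t j = incidence_sign j E *
        ht_cochain I J a ?q c (rel_basis (\<Delta>J a) (\<Delta>I a) ?q (E - {j}))" if j: "j \<in> E" for j
    proof -
      have "{l \<in> ?G \<union> E. l < j} = {l \<in> ?G. l < j} \<union> {l \<in> E. l < j}"
        by auto
      then have "incidence_sign j (?G \<union> E) = (incidence_sign j ?G * incidence_sign j E :: 'k)"
        using u(2) by (simp add: incidence_sign_def power_add card_Un_disjoint disjoint_iff)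
      moreover have "ht_sign ?G E = (incidence_sign j ?G * ht_sign ?G (E - {j}) :: 'k)"
        using j by (simp add: ht_sign_def prod.remove)
      moreover have "incidence_sign j ?G * incidence_sign j ?G = (1 :: 'k)"
        by (simp add: incidence_sign_def flip: power_add)
      moreover have "?G \<union> E - {j} = ?G \<union> (E - {j})"
        using j u(2) by auto
      ultimately show ?thesis
        by (simp add: ht_cochain_rel_basis[OF face[OF j]] mult_ac)
    qed
    have "ht_cochain I J a (?q + 1) (cech_diff M p c) (rel_basis (\<Delta>J a) (\<Delta>I a) (?q + 1) E) =
        ht_sign ?G E * (\<Sum>j\<in>?G \<union> E. ?t j)"
      by (simp only: ht_cochain_rel_basis[OF E] cech_diff(2)[OF c u(1,3)])
    also have "(\<Sum>j\<in>?G \<union> E. ?t j) = (\<Sum>j\<in>E. ?t j)"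
      using G_terms by (intro sum.mono_neutral_right) auto
    also have "ht_sign ?G E * \<dots> = (\<Sum>j\<in>E. incidence_sign j E *
        ht_cochain I J a ?q c (rel_basis (\<Delta>J a) (\<Delta>I a) ?q (E - {j})))"
      unfolding sum_distrib_left by (intro sum.cong refl E_terms)
    also have "\<dots> = rel_coboundary (\<Delta>J a) (\<Delta>I a) ?q (ht_cochain I J a ?q c) (rel_basis (\<Delta>J a) (\<Delta>I a) (?q + 1) E)"
      by (rule pair.rel_coboundary_rel_basis[OF ht_cochain_in_rel_cochains E, symmetric])
    finally show "ht_cochain I J a (?q + 1) (cech_diff M p c) (rel_basis (\<Delta>J a) (\<Delta>I a) (?q + 1) E) =
        rel_coboundary (\<Delta>J a) (\<Delta>I a) ?q (ht_cochain I J a ?q c) (rel_basis (\<Delta>J a) (\<Delta>I a) (?q + 1) E)" .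
  qed
qed

text \<open>
  The Cech differential squares to zero because the simplicial one does and the Hochster--Takayama
  map is injective on cochains.
\<close>

lemma cochain_complex_cech: "cochain_complex (cech M D a) (cech_diff M)"
  unfolding cochain_complex_def
proof (intro allI conjI ballI)
  fix p
  show "is_module (cech M D a p)"
    by (rule is_module_cech)
  show "linear_map (cech M D a p) (cech M D a (p + 1)) (cech_diff M p)"
    by (rule linear_map_cech_diff)
  fix c assume c: "c \<in> carrier (cech M D a p)"
  let ?s = "ht_shift a"
  note dc = cech_diff_in_cech[OF c]
  have "ht_cochain I J a (p + 1 + 1 - ?s) (cech_diff M (p + 1) (cech_diff M p c)) =
      rel_coboundary (\<Delta>J a) (\<Delta>I a) (p - ?s + 1)
        (rel_coboundary (\<Delta>J a) (\<Delta>I a) (p - ?s) (ht_cochain I J a (p - ?s) c))"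
    using ht_cochain_cech_diff[OF dc] ht_cochain_cech_diff[OF c] by (simp add: algebra_simps)
  also have "\<dots> = \<zero>\<^bsub>rel_cochains (\<Delta>J a) (\<Delta>I a) (p - ?s + 2)\<^esub>"
    by (rule cochain_complexD(3)[OF pair.cochain_complex_rel_cochains ht_cochain_in_rel_cochains])
  also have "\<dots> = ht_cochain I J a (p + 2 - ?s) \<zero>\<^bsub>cech M D a (p + 2)\<^esub>"
    using linear_map_zero[OF linear_map_ht_cochain is_module_cech
        cochain_complexD(1)[OF pair.cochain_complex_rel_cochains], of a "p + 2"]
    by (simp add: algebra_simps)
  finally have "ht_cochain I J a (p + 2 - ?s) (cech_diff M (p + 1) (cech_diff M p c)) =
      ht_cochain I J a (p + 2 - ?s) \<zero>\<^bsub>cech M D a (p + 2)\<^esub>"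
    by (simp add: add.assoc)
  moreover have "cech_diff M (p + 1) (cech_diff M p c) \<in> carrier (cech M D a (p + 2))"
    using cech_diff_in_cech[OF dc] by (simp add: add.assoc)
  ultimately show "cech_diff M (p + 1) (cech_diff M p c) = \<zero>\<^bsub>cech M D a (p + 2)\<^esub>"
    using bij_betw_imp_inj_on[OF bij_betw_ht_cochain] is_moduleD(2)[OF is_module_cech] by (meson inj_onD)
qed

lemma cochain_map_ht_cochain:
  "cochain_map (cech M D a) (cech_diff M) (rel_cochains (\<Delta>J a) (\<Delta>I a))
     (rel_coboundary (\<Delta>J a) (\<Delta>I a)) (ht_shift a) (\<lambda>p. ht_cochain I J a (p - ht_shift a))"
  unfolding cochain_map_def using linear_map_ht_cochain ht_cochain_cech_diff by blast

lemma degree_complex_shift_subset: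
  assumes "ideal K poly_ring" "neg_supp (shift_deg a b) = neg_supp a"
  shows "degree_complex (shift_deg a b) K \<subseteq> degree_complex a (K :: ('n, 'k) polyS set)"
  using mono_in_shift_deg[OF assms(1)] by (auto simp: mem_degree_complex_iff[OF assms(1)] assms(2))

text \<open>
  The square commutes already on cochains: both composites have at a face \<open>E\<close> of the smaller pair the
  value \<open>ht_sign\<close> times the coefficient of the given cochain at \<open>G\<^sub>a \<union> E\<close>.  The equality of the
  negative supports makes the signs and the index sets \<open>G\<^sub>a \<union> E\<close> on the two sides agree.
\<close>

lemma ht_cochain_cech_mult:
  assumes G: "neg_supp (shift_deg a b) = neg_supp a" and c: "c \<in> carrier (cech M D a p)"
  shows "ht_cochain I J (shift_deg a b) (p - ht_shift a) (cech_mult M b p c) =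
     rel_restrict (\<Delta>J a) (\<Delta>I a) (\<Delta>J (shift_deg a b)) (\<Delta>I (shift_deg a b)) (p - ht_shift a)
       (ht_cochain I J a (p - ht_shift a) c)"
proof -
  let ?q = "p - ht_shift a" and ?a = "shift_deg a b"
  interpret inc: simplicial_pair_inclusion "\<Delta>J a" "\<Delta>I a" "\<Delta>J ?a" "\<Delta>I ?a"
    by unfold_locales (intro degree_complex_shift_subset I J G)+
  show ?thesis
  proof (rule pair.cochain_eqI[OF ht_cochain_in_rel_cochains
        linear_mapD(1)[OF inc.linear_map_rel_restrict ht_cochain_in_rel_cochains]])
    fix E assume "E \<in> faces (\<Delta>J ?a - \<Delta>I ?a) ?q"
    then have E: "E \<in> faces (\<Delta>J ?a) ?q" "E \<in> faces (\<Delta>J a) ?q"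
      using inc.\<Delta>_sub by (auto simp: faces_def)
    show "ht_cochain I J ?a ?q (cech_mult M b p c) (rel_basis (\<Delta>J ?a) (\<Delta>I ?a) ?q E) =
        rel_restrict (\<Delta>J a) (\<Delta>I a) (\<Delta>J ?a) (\<Delta>I ?a) ?q (ht_cochain I J a ?q c)
          (rel_basis (\<Delta>J ?a) (\<Delta>I ?a) ?q E)"
      using coeff_cech_mult[OF c, of "neg_supp a \<union> E" b] face_union(1)[OF E(2)]
        face_union(3)[of E ?a p, unfolded G, OF E(1)]
      by (simp add: ht_cochain_rel_basis[OF E(1)] ht_cochain_rel_basis[OF E(2)] G
          inc.rel_restrict_rel_basis[OF E(1)])
  qed
qed

end

theorem theorem3p7:
  fixes I J :: "('n::{finite,linorder}, 'k::field) polyS set"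
    and i :: nat
    and a :: "'n \<Rightarrow> int"
    and b :: "'n \<Rightarrow> nat"
  assumes "monomial_ideal I" and "monomial_ideal J" and "J \<subseteq> I"
    and "neg_supp (shift_deg a b) = neg_supp a"
  shows
    "let
       M = ideal_quot I J;
       D = ideal_quot_degree I J;
       a' = shift_deg a b;
       q = int i - int (card (neg_supp a)) - 1;
       \<Delta>J = degree_complex a J;
       \<Delta>I = degree_complex a I;
       \<Delta>J' = degree_complex a' J;
       \<Delta>I' = degree_complex a' I;
       HM = local_cohomology M D a (int i);
       HM' = local_cohomology M D a' (int i);
       H\<Delta> = (rel_cohomology \<Delta>J \<Delta>I q :: ('k, (('n set \<Rightarrow>\<^sub>0 'k) set \<Rightarrow> 'k) set) module);
       H\<Delta>' = (rel_cohomology \<Delta>J' \<Delta>I' q :: ('k, (('n set \<Rightarrow>\<^sub>0 'k) set \<Rightarrow> 'k) set) module);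
       mult_xb = local_cohomology_mult M D a b (int i);
       incl = rel_cohomology_inclusion \<Delta>J \<Delta>I \<Delta>J' \<Delta>I' q;
       ht = ht_map I J a q;
       ht' = ht_map I J a' q
     in
       \<Delta>J' \<subseteq> \<Delta>J \<and> \<Delta>I' \<subseteq> \<Delta>I \<and>
       linear_map HM HM' mult_xb \<and>
       linear_map H\<Delta> H\<Delta>' incl \<and>
       linear_iso HM H\<Delta> ht \<and>
       linear_iso HM' H\<Delta>' ht' \<and>
       (\<forall>\<xi>\<in>carrier HM. ht' (mult_xb \<xi>) = incl (ht \<xi>)) \<and>
       (zero_map HM HM' mult_xb \<longleftrightarrow> zero_map H\<Delta> H\<Delta>' incl)"
proof -
  interpret ideal_pair I J
    using assms by (intro ideal_pair.intro ideal_monomial_ideal)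
  note G = assms(4)
  let ?a = "shift_deg a b"
  define s where "s = ht_shift a"
  have s': "ht_shift ?a = s" by (simp add: s_def G)
  have q: "int i - int (card (neg_supp a)) - 1 = int i - s"
    by (simp add: s_def)
  note subJ = degree_complex_shift_subset[OF J G] and subI = degree_complex_shift_subset[OF I G]
  interpret inc: simplicial_pair_inclusion "\<Delta>J a" "\<Delta>I a" "\<Delta>J ?a" "\<Delta>I ?a"
    by unfold_locales (intro subJ subI)+
  note cech = cochain_complex_cech[of a] cochain_complex_cech[of ?a]
  note rel = pair.cochain_complex_rel_cochains[of a, where 'k = 'k]
    pair.cochain_complex_rel_cochains[of ?a, where 'k = 'k]
  note ht_maps = cochain_map_ht_cochain[of a, folded s_def] cochain_map_ht_cochain[of ?a, unfolded s']
  note mult_map = cochain_map_cech_mult[of a b]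
  note incl_map = inc.cochain_map_rel_restrict[where 'k = 'k]
  let ?HM = "local_cohomology M D a (int i)" and ?HM' = "local_cohomology M D ?a (int i)"
  let ?H = "rel_cohomology (\<Delta>J a) (\<Delta>I a) (int i - s) :: ('k, (('n set \<Rightarrow>\<^sub>0 'k) set \<Rightarrow> 'k) set) module"
  let ?H' = "rel_cohomology (\<Delta>J ?a) (\<Delta>I ?a) (int i - s) :: ('k, (('n set \<Rightarrow>\<^sub>0 'k) set \<Rightarrow> 'k) set) module"
  let ?mult = "local_cohomology_mult M D a b (int i)"
  let ?incl = "rel_cohomology_inclusion (\<Delta>J a) (\<Delta>I a) (\<Delta>J ?a) (\<Delta>I ?a) (int i - s)
    :: (('n set \<Rightarrow>\<^sub>0 'k) set \<Rightarrow> 'k) set \<Rightarrow> _"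
  let ?ht = "ht_map I J a (int i - s)" and ?ht' = "ht_map I J ?a (int i - s)"
  have mult: "linear_map ?HM ?HM' ?mult"
    using linear_map_cohomology_map[OF cech mult_map, of "int i"]
    by (simp add: local_cohomology_def local_cohomology_mult_def)
  have incl: "linear_map ?H ?H' ?incl"
    using linear_map_cohomology_map[OF rel incl_map, of "int i - s"]
    by (simp add: rel_cohomology_def rel_cohomology_inclusion_def)
  have ht: "linear_iso ?HM ?H ?ht"
    using linear_iso_cohomology_map[OF cech(1) rel(1) ht_maps(1) bij_betw_ht_cochain[of a, folded s_def], of "int i"]
    by (simp add: local_cohomology_def rel_cohomology_def ht_map_def)
  have ht': "linear_iso ?HM' ?H' ?ht'"
    using linear_iso_cohomology_map[OF cech(2) rel(2) ht_maps(2) bij_betw_ht_cochain[of ?a, unfolded s'], of "int i"]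
    by (simp add: local_cohomology_def rel_cohomology_def ht_map_def)
  have comm: "?ht' (?mult \<xi>) = ?incl (?ht \<xi>)" if \<xi>: "\<xi> \<in> carrier ?HM" for \<xi>
  proof -
    obtain z where z: "z \<in> carrier (cocycles (cech M D a) (cech_diff M) (int i))"
      "\<xi> = coboundaries (cech M D a) (cech_diff M) (int i) +>\<^bsub>cocycles (cech M D a) (cech_diff M) (int i)\<^esub> z"
      using cohomology_cases[OF cech(1)] \<xi> by (metis local_cohomology_def)
    have mz: "cech_mult M b (int i) z \<in> carrier (cocycles (cech M D ?a) (cech_diff M) (int i))"
      using linear_mapD(1)[OF cochain_map_cocycles(1)[OF cech mult_map] z(1)] by simp
    have hz: "ht_cochain I J a (int i - s) z \<in>
        carrier (cocycles (rel_cochains (\<Delta>J a) (\<Delta>I a)) (rel_coboundary (\<Delta>J a) (\<Delta>I a)) (int i - s))"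
      using linear_mapD(1)[OF cochain_map_cocycles(1)[OF cech(1) rel(1) ht_maps(1)] z(1)] .
    have "?ht' (?mult \<xi>) = coboundaries (rel_cochains (\<Delta>J ?a) (\<Delta>I ?a)) (rel_coboundary (\<Delta>J ?a) (\<Delta>I ?a)) (int i - s)
        +>\<^bsub>cocycles (rel_cochains (\<Delta>J ?a) (\<Delta>I ?a)) (rel_coboundary (\<Delta>J ?a) (\<Delta>I ?a)) (int i - s)\<^esub>
        ht_cochain I J ?a (int i - s) (cech_mult M b (int i) z)"
      using cohomology_map_coset[OF cech mult_map z(1)] cohomology_map_coset[OF cech(2) rel(2) ht_maps(2) mz]
      by (simp add: z(2) local_cohomology_mult_def ht_map_def)
    also have "ht_cochain I J ?a (int i - s) (cech_mult M b (int i) z) =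
        rel_restrict (\<Delta>J a) (\<Delta>I a) (\<Delta>J ?a) (\<Delta>I ?a) (int i - s) (ht_cochain I J a (int i - s) z)"
      using z(1) unfolding s_def by (intro ht_cochain_cech_mult[OF G]) simp
    also have "coboundaries (rel_cochains (\<Delta>J ?a) (\<Delta>I ?a)) (rel_coboundary (\<Delta>J ?a) (\<Delta>I ?a)) (int i - s)
        +>\<^bsub>cocycles (rel_cochains (\<Delta>J ?a) (\<Delta>I ?a)) (rel_coboundary (\<Delta>J ?a) (\<Delta>I ?a)) (int i - s)\<^esub> \<dots> = ?incl (?ht \<xi>)"
      using cohomology_map_coset[OF cech(1) rel(1) ht_maps(1) z(1)] cohomology_map_coset[OF rel incl_map hz]
      by (simp add: z(2) rel_cohomology_inclusion_def ht_map_def)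
    finally show ?thesis .
  qed
  have mod: "is_module ?HM" "is_module ?HM'" "is_module ?H" "is_module ?H'"
    unfolding local_cohomology_def rel_cohomology_def
    by (intro is_module_cohomology cech rel)+
  have "zero_map ?HM ?HM' ?mult \<longleftrightarrow> zero_map ?H ?H' ?incl"
  proof -
    have lin: "linear_map ?HM ?H ?ht" "linear_map ?HM' ?H' ?ht'"
      and inj': "inj_on ?ht' (carrier ?HM')" and surj: "?ht ` carrier ?HM = carrier ?H"
      using ht ht' by (auto simp: linear_iso_def bij_betw_def)
    have ht'0: "?ht' \<zero>\<^bsub>?HM'\<^esub> = \<zero>\<^bsub>?H'\<^esub>"
      by (rule linear_map_zero[OF lin(2) mod(2,4)])
    have "?mult \<xi> = \<zero>\<^bsub>?HM'\<^esub> \<longleftrightarrow> ?incl (?ht \<xi>) = \<zero>\<^bsub>?H'\<^esub>" if \<xi>: "\<xi> \<in> carrier ?HM" for \<xi>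
      using inj_on_eq_iff[OF inj' linear_mapD(1)[OF mult \<xi>] is_moduleD(2)[OF mod(2)]] comm[OF \<xi>] ht'0 by simp
    then show ?thesis
      unfolding zero_map_def surj[symmetric] by simp
  qed
  then show ?thesis
    unfolding Let_def q using subJ subI mult incl ht ht' comm by blast
qed

end
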